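(* Let $(M,\phi,\xi,\eta,g)$ be a non-Sasakian contact metric $(\kappa,\mu)$-space and let $(\phi_1,\phi_2,\phi_3)$ be its standard almost bi-paracontact structure. For $\alpha\in\{1,2\}$ let $g_\alpha$ be the semi-Riemannian metric $g_\alpha(X,Y):=d\eta(X,\phi_\alpha Y)+\eta(X)\eta(Y)$, compatible with the almost paracontact structure $\phi_\alpha$, and let $h_\alpha:=\frac12\mathcal L_\xi\phi_\alpha$. Then the paracontact metric structures $(\phi_\alpha,\xi,\eta,g_\alpha)$, $\alpha\in\{1,2\}$, satisfy, for all $X,Y\in\Gamma(TM)$, $$R^{g_\alpha}(X,Y)\xi=\kappa_\alpha(\eta(Y)X-\eta(X)Y)+\mu_\alpha(\eta(Y)h_\alpha X-\eta(X)h_\alpha Y),$$ where $$\kappa_1=\Bigl(1-\frac\mu2\Bigr)^2-1,\quad \mu_1=2(1-\sqrt{1-\kappa}),\qquad \kappa_2=\kappa-2+\Bigl(1-\frac\mu2\Bigr)^2,\quad \mu_2=2.$$ Furthermore, $I_M=0$ if and only if $(\phi_1,\xi,\eta,g_1)$ is para-Sasakian, where $I_M:=\frac{1-\mu/2}{\sqrt{1-\kappa}}$.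
   Context: Everything is smooth. A contact metric manifold $(M,\phi,\xi,\eta,g)$ is a $(2n+1)$-dimensional manifold with a $(1,1)$-tensor $\phi$, vector field $\xi$, $1$-form $\eta$ and Riemannian metric $g$ such that $\phi^2=-I+\eta\otimes\xi$, $\eta(\xi)=1$, $g(\phi X,\phi Y)=g(X,Y)-\eta(X)\eta(Y)$ and $d\eta(X,Y)=g(X,\phi Y)$, where $2d\eta(X,Y)=X(\eta(Y))-Y(\eta(X))-\eta([X,Y])$. Put $h:=\frac12\mathcal L_\xi\phi$. For a $(1,1)$-tensor $\psi$ put $[\psi,\psi](X,Y)=\psi^2[X,Y]+[\psi X,\psi Y]-\psi[\psi X,Y]-\psi[X,\psi Y]$. The contact metric manifold is Sasakian if $[\phi,\phi]+2d\eta\otimes\xi=0$. For a semi-Riemannian metric $g$, $R^g(X,Y)=[\nabla^g_X,\nabla^g_Y]-\nabla^g_{[X,Y]}$ is the curvature of its Levi-Civita connection. A contact metric $(\kappa,\mu)$-space, $\kappa,\mu\in\mathbb R$, is a contact metric manifold with $R^g(X,Y)\xi=\kappa(\eta(Y)X-\eta(X)Y)+\mu(\eta(Y)hX-\eta(X)hY)$; non-Sasakian implies $\kappa<1$. The standard almost bi-paracontact structure of a non-Sasakian contact metric $(\kappa,\mu)$-space is $\phi_1=\frac1{\sqrt{1-\kappa}}\phi h$, $\phi_2=\frac1{\sqrt{1-\kappa}}h$, $\phi_3=\phi$. An almost paracontact structure is $(\tilde\phi,\xi,\eta)$ with $\eta(\xi)=1$, $\tilde\phi^2=I-\eta\otimes\xi$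 and $\pm1$-eigendistributions of $\tilde\phi$ on $\ker\eta$ both of rank $n$. A paracontact metric structure $(\tilde\phi,\xi,\eta,\tilde g)$ is an almost paracontact structure with a semi-Riemannian metric $\tilde g$ such that $\tilde g(\tilde\phi X,\tilde\phi Y)=-\tilde g(X,Y)+\eta(X)\eta(Y)$ and $d\eta(X,Y)=\tilde g(X,\tilde\phi Y)$. It is para-Sasakian if it is normal, i.e. $[\tilde\phi,\tilde\phi]-2d\eta\otimes\xi=0$. *)

theory Defs
  imports "HOL-Analysis.Analysis" "HOL-Library.Function_Algebras"
begin

section \<open>Smooth manifolds\<close>

text \<open>The operations \<open>+\<close>, \<open>-\<close>, \<open>*\<close>, \<open>0\<close> on functions are the pointwise ones
  of \<^theory>\<open>HOL-Library.Function_Algebras\<close>.\<close>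

primrec Ck_on :: "nat \<Rightarrow> ('e::euclidean_space \<Rightarrow> 'f::real_normed_vector) \<Rightarrow> 'e set \<Rightarrow> bool" where
  "Ck_on 0 f S \<longleftrightarrow> continuous_on S f"
| "Ck_on (Suc k) f S \<longleftrightarrow> f differentiable_on S \<and>
     (\<forall>v. Ck_on k (\<lambda>x. frechet_derivative f (at x) v) S)"

text \<open>Only meaningful for open \<open>S\<close>, which is how it is used below.\<close>

definition smooth_on :: "'e set \<Rightarrow> ('e::euclidean_space \<Rightarrow> 'f::real_normed_vector) \<Rightarrow> bool" where
  "smooth_on S f \<longleftrightarrow> (\<forall>k. Ck_on k f S)"

text \<open>The underlying set of a manifold is the whole type \<open>'a\<close>, and a chart is a pair \<open>(U, c)\<close> of an
  open set and a homeomorphism \<open>c\<close> of \<open>U\<close> onto an open subset of the model space \<open>'e\<close>. The dimension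
  of the manifold is \<open>DIM('e)\<close>. The atlas is not required to be maximal.\<close>

type_synonym ('a, 'e) atlas = "('a set \<times> ('a \<Rightarrow> 'e)) set"

definition smooth_manifold ::
  "('a::{t2_space, second_countable_topology}, 'e::euclidean_space) atlas \<Rightarrow> bool" where
  "smooth_manifold A \<longleftrightarrow>
     (\<Union>(U, c)\<in>A. U) = UNIV \<and>
     (\<forall>(U, c)\<in>A. open U \<and> open (c ` U) \<and> homeomorphism U (c ` U) c (the_inv_into U c)) \<and>
     (\<forall>(U, c)\<in>A. \<forall>(V, d)\<in>A. smooth_on (c ` (U \<inter> V)) (d \<circ> the_inv_into U c))"

definition smooth_funs ::
  "('a::{t2_space, second_countable_topology}, 'e::euclidean_space) atlas \<Rightarrow> ('a \<Rightarrow> real) set" where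
  "smooth_funs A = {f. \<forall>(U, c)\<in>A. smooth_on (c ` U) (f \<circ> the_inv_into U c)}"


section \<open>Vector fields and tensor fields\<close>

text \<open>Vector fields are the derivations of the algebra of smooth functions. They are normalised to \<open>0\<close>
  on functions that are not smooth, so that HOL equality of vector fields is the intended one. The
  tangent vector of \<open>X\<close> at \<open>p\<close> is the functional \<open>\<lambda>f. X f p\<close>, and every tangent vector at \<open>p\<close> is
  of this form.\<close>

type_synonym 'a vfield = "('a \<Rightarrow> real) \<Rightarrow> 'a \<Rightarrow> real"

definition vector_fields ::
  "('a::{t2_space, second_countable_topology}, 'e::euclidean_space) atlas \<Rightarrow> 'a vfield set" where
  "vector_fields A = {X.
     (\<forall>f\<in>smooth_funs A. X f \<in> smooth_funs A) \<and>
     (\<forall>f. f \<notin> smooth_funs A \<longrightarrow> X f = 0) \<and>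
     (\<forall>f\<in>smooth_funs A. \<forall>h\<in>smooth_funs A. X (f + h) = X f + X h) \<and>
     (\<forall>c. \<forall>f\<in>smooth_funs A. X (\<lambda>p. c * f p) = (\<lambda>p. c * X f p)) \<and>
     (\<forall>f\<in>smooth_funs A. \<forall>h\<in>smooth_funs A. X (f * h) = f * X h + h * X f)}"

definition vec_at :: "'a vfield \<Rightarrow> 'a \<Rightarrow> ('a \<Rightarrow> real) \<Rightarrow> real" where
  "vec_at X p = (\<lambda>f. X f p)"

definition fmul :: "('a \<Rightarrow> real) \<Rightarrow> 'a vfield \<Rightarrow> 'a vfield" (infixr "\<odot>" 75) where
  "f \<odot> X = (\<lambda>h. f * X h)"

definition cmul :: "real \<Rightarrow> 'a vfield \<Rightarrow> 'a vfield" (infixr "\<odot>\<^sub>R" 75) where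
  "c \<odot>\<^sub>R X = (\<lambda>h p. c * X h p)"

definition lie_bracket :: "'a vfield \<Rightarrow> 'a vfield \<Rightarrow> 'a vfield" where
  "lie_bracket X Y = (\<lambda>f. X (Y f) - Y (X f))"

text \<open>Tensor fields are maps on vector fields that are multilinear over the smooth functions. Their
  values outside \<^const>\<open>vector_fields\<close> are irrelevant.\<close>

definition one_form ::
  "('a::{t2_space, second_countable_topology}, 'e::euclidean_space) atlas \<Rightarrow>
   ('a vfield \<Rightarrow> 'a \<Rightarrow> real) \<Rightarrow> bool" where
  "one_form A \<omega> \<longleftrightarrow>
     (\<forall>X\<in>vector_fields A. \<omega> X \<in> smooth_funs A) \<and>
     (\<forall>X\<in>vector_fields A. \<forall>Y\<in>vector_fields A. \<omega> (X + Y) = \<omega> X + \<omega> Y) \<and>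
     (\<forall>f\<in>smooth_funs A. \<forall>X\<in>vector_fields A. \<omega> (f \<odot> X) = f * \<omega> X)"

definition tensor11 ::
  "('a::{t2_space, second_countable_topology}, 'e::euclidean_space) atlas \<Rightarrow>
   ('a vfield \<Rightarrow> 'a vfield) \<Rightarrow> bool" where
  "tensor11 A \<psi> \<longleftrightarrow>
     (\<forall>X\<in>vector_fields A. \<psi> X \<in> vector_fields A) \<and>
     (\<forall>X\<in>vector_fields A. \<forall>Y\<in>vector_fields A. \<psi> (X + Y) = \<psi> X + \<psi> Y) \<and>
     (\<forall>f\<in>smooth_funs A. \<forall>X\<in>vector_fields A. \<psi> (f \<odot> X) = f \<odot> \<psi> X)"

definition symmetric_tensor02 ::
  "('a::{t2_space, second_countable_topology}, 'e::euclidean_space) atlas \<Rightarrow>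
   ('a vfield \<Rightarrow> 'a vfield \<Rightarrow> 'a \<Rightarrow> real) \<Rightarrow> bool" where
  "symmetric_tensor02 A g \<longleftrightarrow>
     (\<forall>X\<in>vector_fields A. one_form A (g X)) \<and>
     (\<forall>X\<in>vector_fields A. \<forall>Y\<in>vector_fields A. g X Y = g Y X)"

text \<open>On a paracontact metric structure (below) the compatibility conditions force signature
  \<open>(n + 1, n)\<close> at every point, so there the index of a metric is constant automatically.\<close>

definition semi_riemannian_metric ::
  "('a::{t2_space, second_countable_topology}, 'e::euclidean_space) atlas \<Rightarrow>
   ('a vfield \<Rightarrow> 'a vfield \<Rightarrow> 'a \<Rightarrow> real) \<Rightarrow> bool" where
  "semi_riemannian_metric A g \<longleftrightarrow> symmetric_tensor02 A g \<and>
     (\<forall>p. \<forall>X\<in>vector_fields A. (\<forall>Y\<in>vector_fields A. g X Y p = 0) \<longrightarrow> vec_at X p = 0)"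

definition riemannian_metric ::
  "('a::{t2_space, second_countable_topology}, 'e::euclidean_space) atlas \<Rightarrow>
   ('a vfield \<Rightarrow> 'a vfield \<Rightarrow> 'a \<Rightarrow> real) \<Rightarrow> bool" where
  "riemannian_metric A g \<longleftrightarrow> symmetric_tensor02 A g \<and>
     (\<forall>p. \<forall>X\<in>vector_fields A. vec_at X p \<noteq> 0 \<longrightarrow> g X X p > 0)"

text \<open>The exterior derivative of a 1-form, with the factor 1/2.\<close>

definition ext_deriv ::
  "('a vfield \<Rightarrow> 'a \<Rightarrow> real) \<Rightarrow> 'a vfield \<Rightarrow> 'a vfield \<Rightarrow> 'a \<Rightarrow> real" where
  "ext_deriv \<eta> X Y = (\<lambda>p. (X (\<eta> Y) p - Y (\<eta> X) p - \<eta> (lie_bracket X Y) p) / 2)"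

definition lie_deriv11 ::
  "'a vfield \<Rightarrow> ('a vfield \<Rightarrow> 'a vfield) \<Rightarrow> 'a vfield \<Rightarrow> 'a vfield" where
  "lie_deriv11 \<xi> \<psi> X = lie_bracket \<xi> (\<psi> X) - \<psi> (lie_bracket \<xi> X)"

definition half_lie ::
  "'a vfield \<Rightarrow> ('a vfield \<Rightarrow> 'a vfield) \<Rightarrow> 'a vfield \<Rightarrow> 'a vfield" where
  "half_lie \<xi> \<psi> X = (1/2) \<odot>\<^sub>R lie_deriv11 \<xi> \<psi> X"

definition nijenhuis ::
  "('a vfield \<Rightarrow> 'a vfield) \<Rightarrow> 'a vfield \<Rightarrow> 'a vfield \<Rightarrow> 'a vfield" where
  "nijenhuis \<psi> X Y = \<psi> (\<psi> (lie_bracket X Y)) + lie_bracket (\<psi> X) (\<psi> Y)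
     - \<psi> (lie_bracket (\<psi> X) Y) - \<psi> (lie_bracket X (\<psi> Y))"


section \<open>Levi-Civita connection and curvature\<close>

definition affine_connection ::
  "('a::{t2_space, second_countable_topology}, 'e::euclidean_space) atlas \<Rightarrow>
   ('a vfield \<Rightarrow> 'a vfield \<Rightarrow> 'a vfield) \<Rightarrow> bool" where
  "affine_connection A D \<longleftrightarrow>
     (\<forall>Y\<in>vector_fields A. tensor11 A (\<lambda>X. D X Y)) \<and>
     (\<forall>X\<in>vector_fields A. \<forall>Y\<in>vector_fields A. \<forall>Z\<in>vector_fields A. D X (Y + Z) = D X Y + D X Z) \<and>
     (\<forall>f\<in>smooth_funs A. \<forall>X\<in>vector_fields A. \<forall>Y\<in>vector_fields A.
        D X (f \<odot> Y) = X f \<odot> Y + f \<odot> D X Y)"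

definition levi_civita ::
  "('a::{t2_space, second_countable_topology}, 'e::euclidean_space) atlas \<Rightarrow>
   ('a vfield \<Rightarrow> 'a vfield \<Rightarrow> 'a \<Rightarrow> real) \<Rightarrow> ('a vfield \<Rightarrow> 'a vfield \<Rightarrow> 'a vfield) \<Rightarrow> bool" where
  "levi_civita A g D \<longleftrightarrow> affine_connection A D \<and>
     (\<forall>X\<in>vector_fields A. \<forall>Y\<in>vector_fields A. D X Y - D Y X = lie_bracket X Y) \<and>
     (\<forall>X\<in>vector_fields A. \<forall>Y\<in>vector_fields A. \<forall>Z\<in>vector_fields A.
        X (g Y Z) = g (D X Y) Z + g Y (D X Z))"

definition curvature ::
  "('a vfield \<Rightarrow> 'a vfield \<Rightarrow> 'a vfield) \<Rightarrow> 'a vfield \<Rightarrow> 'a vfield \<Rightarrow> 'a vfield \<Rightarrow> 'a vfield" where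
  "curvature D X Y Z = D X (D Y Z) - D Y (D X Z) - D (lie_bracket X Y) Z"

text \<open>The condition \<open>R(X, Y)\<xi> = \<kappa>(\<eta>(Y)X - \<eta>(X)Y) + \<mu>(\<eta>(Y)hX - \<eta>(X)hY)\<close> on the curvature of the
  Levi-Civita connection of \<open>g\<close>. That connection is unique on vector fields, but as a HOL function it
  is not determined outside them; hence existence and a universal quantification instead of a
  definite description.\<close>

definition kappa_mu_curvature ::
  "('a::{t2_space, second_countable_topology}, 'e::euclidean_space) atlas \<Rightarrow>
   'a vfield \<Rightarrow> ('a vfield \<Rightarrow> 'a \<Rightarrow> real) \<Rightarrow> ('a vfield \<Rightarrow> 'a vfield \<Rightarrow> 'a \<Rightarrow> real) \<Rightarrow>
   ('a vfield \<Rightarrow> 'a vfield) \<Rightarrow> real \<Rightarrow> real \<Rightarrow> bool" where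
  "kappa_mu_curvature A \<xi> \<eta> g h \<kappa> \<mu> \<longleftrightarrow>
     (\<exists>D. levi_civita A g D) \<and>
     (\<forall>D. levi_civita A g D \<longrightarrow>
       (\<forall>X\<in>vector_fields A. \<forall>Y\<in>vector_fields A.
          curvature D X Y \<xi> =
            \<kappa> \<odot>\<^sub>R (\<eta> Y \<odot> X - \<eta> X \<odot> Y) + \<mu> \<odot>\<^sub>R (\<eta> Y \<odot> h X - \<eta> X \<odot> h Y)))"


section \<open>Contact metric structures\<close>

definition contact_metric ::
  "('a::{t2_space, second_countable_topology}, 'e::euclidean_space) atlas \<Rightarrow> nat \<Rightarrow>
   ('a vfield \<Rightarrow> 'a vfield) \<Rightarrow> 'a vfield \<Rightarrow> ('a vfield \<Rightarrow> 'a \<Rightarrow> real) \<Rightarrow>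
   ('a vfield \<Rightarrow> 'a vfield \<Rightarrow> 'a \<Rightarrow> real) \<Rightarrow> bool" where
  "contact_metric A n \<phi> \<xi> \<eta> g \<longleftrightarrow>
     smooth_manifold A \<and> DIM('e) = 2 * n + 1 \<and>
     tensor11 A \<phi> \<and> \<xi> \<in> vector_fields A \<and> one_form A \<eta> \<and> riemannian_metric A g \<and>
     (\<forall>X\<in>vector_fields A. \<phi> (\<phi> X) = - X + \<eta> X \<odot> \<xi>) \<and>
     \<eta> \<xi> = 1 \<and>
     (\<forall>X\<in>vector_fields A. \<forall>Y\<in>vector_fields A. g (\<phi> X) (\<phi> Y) = g X Y - \<eta> X * \<eta> Y) \<and>
     (\<forall>X\<in>vector_fields A. \<forall>Y\<in>vector_fields A. ext_deriv \<eta> X Y = g X (\<phi> Y))"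

definition sasakian ::
  "('a::{t2_space, second_countable_topology}, 'e::euclidean_space) atlas \<Rightarrow> nat \<Rightarrow>
   ('a vfield \<Rightarrow> 'a vfield) \<Rightarrow> 'a vfield \<Rightarrow> ('a vfield \<Rightarrow> 'a \<Rightarrow> real) \<Rightarrow>
   ('a vfield \<Rightarrow> 'a vfield \<Rightarrow> 'a \<Rightarrow> real) \<Rightarrow> bool" where
  "sasakian A n \<phi> \<xi> \<eta> g \<longleftrightarrow> contact_metric A n \<phi> \<xi> \<eta> g \<and>
     (\<forall>X\<in>vector_fields A. \<forall>Y\<in>vector_fields A.
        nijenhuis \<phi> X Y + 2 \<odot>\<^sub>R (ext_deriv \<eta> X Y \<odot> \<xi>) = 0)"

definition kappa_mu_space ::
  "('a::{t2_space, second_countable_topology}, 'e::euclidean_space) atlas \<Rightarrow> nat \<Rightarrow>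
   ('a vfield \<Rightarrow> 'a vfield) \<Rightarrow> 'a vfield \<Rightarrow> ('a vfield \<Rightarrow> 'a \<Rightarrow> real) \<Rightarrow>
   ('a vfield \<Rightarrow> 'a vfield \<Rightarrow> 'a \<Rightarrow> real) \<Rightarrow> real \<Rightarrow> real \<Rightarrow> bool" where
  "kappa_mu_space A n \<phi> \<xi> \<eta> g \<kappa> \<mu> \<longleftrightarrow> contact_metric A n \<phi> \<xi> \<eta> g \<and>
     kappa_mu_curvature A \<xi> \<eta> g (half_lie \<xi> \<phi>) \<kappa> \<mu>"

text \<open>The standard almost bi-paracontact structure is \<open>(std1 \<kappa> \<phi> \<xi>, std2 \<kappa> \<phi> \<xi>, \<phi>)\<close>.\<close>

definition std1 ::
  "real \<Rightarrow> ('a vfield \<Rightarrow> 'a vfield) \<Rightarrow> 'a vfield \<Rightarrow> 'a vfield \<Rightarrow> 'a vfield" where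
  "std1 \<kappa> \<phi> \<xi> X = (1 / sqrt (1 - \<kappa>)) \<odot>\<^sub>R \<phi> (half_lie \<xi> \<phi> X)"

definition std2 ::
  "real \<Rightarrow> ('a vfield \<Rightarrow> 'a vfield) \<Rightarrow> 'a vfield \<Rightarrow> 'a vfield \<Rightarrow> 'a vfield" where
  "std2 \<kappa> \<phi> \<xi> X = (1 / sqrt (1 - \<kappa>)) \<odot>\<^sub>R half_lie \<xi> \<phi> X"

definition assoc_metric ::
  "('a vfield \<Rightarrow> 'a \<Rightarrow> real) \<Rightarrow> ('a vfield \<Rightarrow> 'a vfield) \<Rightarrow> 'a vfield \<Rightarrow> 'a vfield \<Rightarrow> 'a \<Rightarrow> real" where
  "assoc_metric \<eta> \<psi> X Y = ext_deriv \<eta> X (\<psi> Y) + \<eta> X * \<eta> Y"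

definition boeckx_invariant :: "real \<Rightarrow> real \<Rightarrow> real" where
  "boeckx_invariant \<kappa> \<mu> = (1 - \<mu> / 2) / sqrt (1 - \<kappa>)"


section \<open>Paracontact metric structures\<close>

text \<open>Functions form a real vector space under pointwise operations; \<open>fdim\<close> is the dimension in it.\<close>

definition fscale :: "real \<Rightarrow> ('b \<Rightarrow> real) \<Rightarrow> 'b \<Rightarrow> real" where
  "fscale c v = (\<lambda>b. c * v b)"

interpretation fun_space: vector_space fscale
  by standard (auto simp: fscale_def fun_eq_iff algebra_simps)

definition fdim :: "('b \<Rightarrow> real) set \<Rightarrow> nat" where
  "fdim V = vector_space.dim fscale V"

text \<open>The eigenspace for \<open>e\<close> of \<open>\<psi>\<close> on \<open>ker \<eta>\<close> in the tangent space at \<open>p\<close>.\<close>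

definition eigenspace_at ::
  "('a::{t2_space, second_countable_topology}, 'e::euclidean_space) atlas \<Rightarrow>
   ('a vfield \<Rightarrow> 'a vfield) \<Rightarrow> ('a vfield \<Rightarrow> 'a \<Rightarrow> real) \<Rightarrow> real \<Rightarrow> 'a \<Rightarrow> (('a \<Rightarrow> real) \<Rightarrow> real) set" where
  "eigenspace_at A \<psi> \<eta> e p =
     {vec_at X p | X. X \<in> vector_fields A \<and> \<eta> X p = 0 \<and> vec_at (\<psi> X) p = fscale e (vec_at X p)}"

definition almost_paracontact ::
  "('a::{t2_space, second_countable_topology}, 'e::euclidean_space) atlas \<Rightarrow> nat \<Rightarrow>
   ('a vfield \<Rightarrow> 'a vfield) \<Rightarrow> 'a vfield \<Rightarrow> ('a vfield \<Rightarrow> 'a \<Rightarrow> real) \<Rightarrow> bool" where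
  "almost_paracontact A n \<psi> \<xi> \<eta> \<longleftrightarrow>
     smooth_manifold A \<and> DIM('e) = 2 * n + 1 \<and>
     tensor11 A \<psi> \<and> \<xi> \<in> vector_fields A \<and> one_form A \<eta> \<and>
     \<eta> \<xi> = 1 \<and>
     (\<forall>X\<in>vector_fields A. \<psi> (\<psi> X) = X - \<eta> X \<odot> \<xi>) \<and>
     (\<forall>p. fdim (eigenspace_at A \<psi> \<eta> 1 p) = n \<and> fdim (eigenspace_at A \<psi> \<eta> (-1) p) = n)"

definition paracontact_metric ::
  "('a::{t2_space, second_countable_topology}, 'e::euclidean_space) atlas \<Rightarrow> nat \<Rightarrow>
   ('a vfield \<Rightarrow> 'a vfield) \<Rightarrow> 'a vfield \<Rightarrow> ('a vfield \<Rightarrow> 'a \<Rightarrow> real) \<Rightarrow>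
   ('a vfield \<Rightarrow> 'a vfield \<Rightarrow> 'a \<Rightarrow> real) \<Rightarrow> bool" where
  "paracontact_metric A n \<psi> \<xi> \<eta> g \<longleftrightarrow>
     almost_paracontact A n \<psi> \<xi> \<eta> \<and> semi_riemannian_metric A g \<and>
     (\<forall>X\<in>vector_fields A. \<forall>Y\<in>vector_fields A. g (\<psi> X) (\<psi> Y) = - g X Y + \<eta> X * \<eta> Y) \<and>
     (\<forall>X\<in>vector_fields A. \<forall>Y\<in>vector_fields A. ext_deriv \<eta> X Y = g X (\<psi> Y))"

definition para_sasakian ::
  "('a::{t2_space, second_countable_topology}, 'e::euclidean_space) atlas \<Rightarrow> nat \<Rightarrow>
   ('a vfield \<Rightarrow> 'a vfield) \<Rightarrow> 'a vfield \<Rightarrow> ('a vfield \<Rightarrow> 'a \<Rightarrow> real) \<Rightarrow>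
   ('a vfield \<Rightarrow> 'a vfield \<Rightarrow> 'a \<Rightarrow> real) \<Rightarrow> bool" where
  "para_sasakian A n \<psi> \<xi> \<eta> g \<longleftrightarrow> paracontact_metric A n \<psi> \<xi> \<eta> g \<and>
     (\<forall>X\<in>vector_fields A. \<forall>Y\<in>vector_fields A.
        nijenhuis \<psi> X Y - 2 \<odot>\<^sub>R (ext_deriv \<eta> X Y \<odot> \<xi>) = 0)"

end

theory Submission
  imports Defs
begin

text \<open>
  Why the theorem holds. Let \<open>D\<close> be the Levi-Civita connection of \<open>g\<close>, and write
  \<open>\<lambda> = sqrt (1 - \<kappa>)\<close>, \<open>a = 1 - \<mu> / 2\<close>, \<open>P = \<phi> h / \<lambda>\<close>, \<open>Q = h / \<lambda>\<close>; so \<open>P\<close> and \<open>Q\<close> are the two members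
  of the standard almost bi-paracontact structure. On every contact metric manifold
  \<open>D\<^sub>X \<xi> = - \<phi> X - \<phi> h X\<close> (\<open>D_xi\<close>), and the nullity condition, read on the pairs \<open>(\<xi>, X)\<close>, says that
  \<open>h\<^sup>2 = (1 - \<kappa>) (I - \<eta> \<otimes> \<xi>)\<close> and \<open>D\<^sub>\<xi> h = - \<mu> \<phi> h\<close> (\<open>h_h\<close>, \<open>nab_h_xi_dir\<close>). If \<open>\<kappa> > 1\<close> the first
  identity contradicts positivity of \<open>g\<close> unless \<open>\<phi> = 0\<close>, and if \<open>\<kappa> = 1\<close> it gives \<open>h = 0\<close>; either way
  the structure is Sasakian (\<open>kappa_lt_1\<close>). So \<open>\<kappa> < 1\<close>, and on the horizontal bundle \<open>ker \<eta>\<close> the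
  operators \<open>\<phi>\<close>, \<open>P\<close>, \<open>Q\<close> obey the relations of the split quaternions: \<open>- \<phi>\<^sup>2 = P\<^sup>2 = Q\<^sup>2 = I\<close>, they
  anticommute in pairs, and \<open>\<phi> Q = P\<close>.

  The heart of the matter is that the covariant derivatives of \<open>\<phi>\<close>, \<open>P\<close> and \<open>Q\<close> are completely
  determined (\<open>nab_phi\<close>, \<open>nab_P\<close>, \<open>nab_Q\<close>). Their vertical parts, those with an entry \<open>\<xi>\<close>, follow from
  the formulas for \<open>D \<xi>\<close>, \<open>D\<^sub>\<xi> \<phi>\<close> and \<open>D\<^sub>\<xi> h\<close>. Their horizontal parts vanish: on horizontal fields the
  nullity condition says \<open>R(X, Y) \<xi> = 0\<close>, which is a Codazzi equation for \<open>\<phi> + \<lambda> P\<close>. Split the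
  arguments into \<open>\<plusminus>1\<close>-eigenfields of \<open>P\<close>. By the Codazzi equation, \<open>d (d \<eta>) = 0\<close> and the algebraic
  identities for \<open>\<phi>\<close> and \<open>P\<close>, a component of \<open>D \<phi>\<close> either is zero at once or gives a trilinear form
  that is symmetric in one pair of arguments and skew in an overlapping pair, hence zero
  (\<open>nab_phi_eig\<close>). Then \<open>D P\<close> is totally symmetric on horizontal fields while every \<open>D\<^sub>X P\<close> exchanges the
  two eigenspaces, so it vanishes as well (\<open>nab_P_horizontal\<close>).

  Once these derivatives are known everything else is substitution. The metrics are
  \<open>g\<^sub>1(X, Y) = - g(X, Q Y) + \<eta>(X) \<eta>(Y)\<close> and \<open>g\<^sub>2(X, Y) = g(X, P Y) + \<eta>(X) \<eta>(Y)\<close>. The Koszul formula yields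
  explicit symmetric tensors \<open>C\<^sub>1\<close>, \<open>C\<^sub>2\<close> such that \<open>D + C\<^sub>1\<close>, \<open>D + C\<^sub>2\<close> are the Levi-Civita connections
  (\<open>levi_civita_g1\<close>, \<open>levi_civita_g2\<close>), and expanding their curvatures on \<open>\<xi>\<close> gives the constants of
  the theorem (\<open>kappa_mu_curvature_g1\<close>, \<open>kappa_mu_curvature_g2\<close>). In the same way the normality tensor
  of \<open>P\<close> is \<open>2 a (\<eta>(X) \<phi> Y - \<eta>(Y) \<phi> X)\<close> (\<open>nijenhuis_P\<close>). Since \<open>\<phi> \<noteq> 0\<close> on a non-Sasakian structure, it
  vanishes exactly if \<open>a = 0\<close>, that is, if the Boeckx invariant is zero.

  What leaves this global tensor calculus is the passage to single points: the inequality
  \<open>g(X, X) \<ge> 0\<close>, and the rank of the eigendistributions. It needs that tensors act pointwise and that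
  tangent spaces have the dimension of the model space. Both come from a local frame of cut-off coordinate fields and Hadamard's lemma
  (\<open>frame\<close>). The operator \<open>\<phi>\<close> exchanges the two eigenspaces of \<open>P\<close> (and of \<open>Q\<close>), so that both have
  half the dimension of \<open>ker \<eta>\<close> (\<open>fdim_eigenspace\<close>).
\<close>

section \<open>Calculus of smooth functions\<close>

lemma Ck_on_cong:
  assumes "open S" "\<And>x. x \<in> S \<Longrightarrow> f x = g x" "Ck_on k f S"
  shows "Ck_on k g S"
  using assms(2,3)
proof (induction k arbitrary: f g)
  case 0
  then show ?case by (auto cong: continuous_on_cong)
next
  case (Suc k)
  have D: "(f has_derivative D) (at x) \<longleftrightarrow> (g has_derivative D) (at x)" if "x \<in> S" for x D
    using has_derivative_transform_within_open[OF _ assms(1) that, of f D UNIV g]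
      has_derivative_transform_within_open[OF _ assms(1) that, of g D UNIV f] Suc.prems(1)
    by auto
  have "frechet_derivative f (at x) = frechet_derivative g (at x)" if "x \<in> S" for x
    using D[OF that] by (simp add: frechet_derivative_def)
  then have "Ck_on k (\<lambda>x. frechet_derivative g (at x) v) S" for v
    using Suc.IH[of "\<lambda>x. frechet_derivative f (at x) v"] Suc.prems by auto
  moreover have "g differentiable_on S"
    using Suc.prems(2) D assms(1)
    by (auto simp: differentiable_on_eq_differentiable_at differentiable_def)
  ultimately show ?case by auto
qed

lemma Ck_on_subset:
  assumes "Ck_on k f S" "S' \<subseteq> S"
  shows "Ck_on k f S'"
  using assms
  by (induction k arbitrary: f) (auto intro: continuous_on_subset differentiable_on_subset)

lemma Ck_on_SucD: "Ck_on (Suc k) f S \<Longrightarrow> Ck_on k f S"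
  by (induction k arbitrary: f) (auto intro: differentiable_imp_continuous_on)

lemma Ck_on_open_Union:
  assumes "\<And>x. x \<in> S \<Longrightarrow> \<exists>U. open U \<and> x \<in> U \<and> Ck_on k f U" "open S"
  shows "Ck_on k f S"
  using assms(1)
proof (induction k arbitrary: f)
  case 0
  have "continuous (at x within S) f" if "x \<in> S" for x
    using 0[OF that] by (auto simp: continuous_on_eq_continuous_at intro: continuous_at_imp_continuous_within)
  then show ?case by (auto simp: continuous_on_eq_continuous_within)
next
  case (Suc k)
  have "f differentiable at x within S" if "x \<in> S" for x
  proof -
    have "\<exists>U. open U \<and> x \<in> U \<and> f differentiable_on U" using Suc.prems that by auto
    then obtain U where "open U" "x \<in> U" "f differentiable_on U" by blast
    then have "f differentiable at x" by (auto simp: differentiable_on_eq_differentiable_at)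
    then show ?thesis by (rule differentiable_at_withinI)
  qed
  moreover have "Ck_on k (\<lambda>x. frechet_derivative f (at x) v) S" for v
    by (rule Suc.IH) (use Suc.prems in fastforce)
  ultimately show ?case by (auto simp: differentiable_on_def)
qed

lemma Ck_on_differentiable_at:
  "Ck_on (Suc k) f S \<Longrightarrow> open S \<Longrightarrow> x \<in> S \<Longrightarrow> f differentiable at x"
  by (auto simp: differentiable_on_eq_differentiable_at)

lemma Ck_on_has_derivative:
  "Ck_on (Suc k) f S \<Longrightarrow> open S \<Longrightarrow> x \<in> S \<Longrightarrow> (f has_derivative frechet_derivative f (at x)) (at x)"
  using Ck_on_differentiable_at frechet_derivative_works by blast

text \<open>This replaces the unwieldy \<^const>\<open>frechet_derivative\<close> in the recursive definition by
  whatever derivative the differentiation rules produce.\<close>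
lemma Ck_on_SucI:
  assumes "open S" "\<And>x. x \<in> S \<Longrightarrow> (f has_derivative f' x) (at x)" "\<And>v. Ck_on k (\<lambda>x. f' x v) S"
  shows "Ck_on (Suc k) f S"
proof -
  have "f differentiable_on S"
    using assms(1,2) by (auto simp: differentiable_on_eq_differentiable_at differentiable_def)
  moreover have "Ck_on k (\<lambda>x. frechet_derivative f (at x) v) S" for v
    by (rule Ck_on_cong[OF assms(1) _ assms(3)[of v]]) (use assms(2) frechet_derivative_at in metis)
  ultimately show ?thesis by simp
qed

lemma Ck_on_const: "Ck_on k (\<lambda>x. c) S"
  by (induction k arbitrary: c) (auto simp: frechet_derivative_const)

lemma Ck_on_bounded_linear:
  assumes "bounded_linear l" "open S" "Ck_on k f S"
  shows "Ck_on k (\<lambda>x. l (f x)) S"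
  using assms(3)
proof (induction k arbitrary: f)
  case 0
  then show ?case using bounded_linear.continuous_on[OF assms(1)] by auto
next
  case (Suc k)
  show ?case
    by (rule Ck_on_SucI[OF assms(2) bounded_linear.has_derivative[OF assms(1) Ck_on_has_derivative]])
      (use Suc assms(2) in auto)
qed

lemma Ck_on_id: "Ck_on k (\<lambda>x. x) S"
  by (cases k) (auto simp: frechet_derivative_ident[unfolded id_def] Ck_on_const)

lemma Ck_on_add:
  assumes "open S" "Ck_on k f S" "Ck_on k g S"
  shows "Ck_on k (\<lambda>x. f x + g x) S"
  using assms(2,3)
proof (induction k arbitrary: f g)
  case 0
  then show ?case by (auto intro: continuous_on_add)
next
  case (Suc k)
  show ?case
    by (rule Ck_on_SucI[OF assms(1) has_derivative_add[OF Ck_on_has_derivative Ck_on_has_derivative]])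
      (use Suc assms(1) in auto)
qed

lemma Ck_on_sum:
  assumes "open S" "\<And>i. i \<in> I \<Longrightarrow> Ck_on k (f i) S"
  shows "Ck_on k (\<lambda>x. \<Sum>i\<in>I. f i x) S"
  using assms(2)
  by (induction I rule: infinite_finite_induct) (auto intro: Ck_on_const Ck_on_add[OF assms(1)])

text \<open>The product rule sends a pair of \<open>C\<^sup>k\<^sup>+\<^sup>1\<close> functions to sums of products of \<open>C\<^sup>k\<close> functions, so
  the order drops by one and the induction closes.\<close>
lemma Ck_on_mult:
  fixes f g :: "'e::euclidean_space \<Rightarrow> real"
  assumes "open S" "Ck_on k f S" "Ck_on k g S"
  shows "Ck_on k (\<lambda>x. f x * g x) S"
  using assms(2,3)
proof (induction k arbitrary: f g)
  case 0
  then show ?case by (auto intro: continuous_on_mult)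
next
  case (Suc k)
  show ?case
    by (rule Ck_on_SucI[OF assms(1) has_derivative_mult[OF Ck_on_has_derivative Ck_on_has_derivative]])
      (use Suc assms(1) in \<open>auto intro!: Ck_on_add Suc.IH simp: Ck_on_SucD simp del: Ck_on.simps(2), auto\<close>)
qed

lemma smooth_onD: "smooth_on S f \<Longrightarrow> Ck_on k f S"
  by (simp add: smooth_on_def)

lemma smooth_on_frechet:
  "smooth_on S f \<Longrightarrow> smooth_on S (\<lambda>x. frechet_derivative f (at x) v)"
  using Ck_on.simps(2) unfolding smooth_on_def by blast

lemma smooth_on_has_derivative:
  "smooth_on S f \<Longrightarrow> open S \<Longrightarrow> x \<in> S \<Longrightarrow> (f has_derivative frechet_derivative f (at x)) (at x)"
  using Ck_on_has_derivative smooth_onD by blast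

lemma frechet_derivative_Basis:
  fixes f :: "'e::euclidean_space \<Rightarrow> 'f::real_normed_vector"
  assumes "(f has_derivative f') F"
  shows "f' v = (\<Sum>i\<in>Basis. (v \<bullet> i) *\<^sub>R f' i)"
proof -
  interpret bounded_linear f' using assms by (rule has_derivative_bounded_linear)
  have "f' v = f' (\<Sum>i\<in>Basis. (v \<bullet> i) *\<^sub>R i)" by (simp add: euclidean_representation)
  then show ?thesis by (simp add: sum scaleR)
qed

text \<open>By the chain rule in coordinates a derivative of \<open>u \<circ> t\<close> is a sum of products of components of
  the derivative of \<open>t\<close> with functions \<open>(\<partial>\<^sub>i u) \<circ> t\<close>. The latter have again the form of the claim,
  which is why the induction generalises over \<open>u\<close>.\<close>
lemma smooth_on_compose:
  fixes u :: "'e::euclidean_space \<Rightarrow> real" and t :: "'d::euclidean_space \<Rightarrow> 'e"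
  assumes u: "smooth_on S u" and t: "smooth_on S' t" and o: "open S" "open S'" and sub: "t ` S' \<subseteq> S"
  shows "smooth_on S' (\<lambda>x. u (t x))"
proof -
  have "Ck_on k (\<lambda>x. u (t x)) S'" for k
    using u
  proof (induction k arbitrary: u)
    case 0
    then show ?case
      using smooth_onD[OF 0, of 0] smooth_onD[OF t, of 0] sub by (auto intro: continuous_on_compose2)
  next
    case (Suc k)
    let ?u = "\<lambda>y. frechet_derivative u (at y)" and ?t = "\<lambda>y. frechet_derivative t (at y)"
    show ?case
    proof (rule Ck_on_SucI[OF o(2)])
      fix x assume x: "x \<in> S'"
      then have u': "(u has_derivative ?u (t x)) (at (t x))"
        using smooth_on_has_derivative[OF Suc.prems o(1)] sub by blast
      have "((\<lambda>x. u (t x)) has_derivative (\<lambda>v. ?u (t x) (?t x v))) (at x)"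
        using diff_chain_at[OF smooth_on_has_derivative[OF t o(2) x] u'] by (simp add: o_def)
      then show "((\<lambda>x. u (t x)) has_derivative (\<lambda>v. \<Sum>i\<in>Basis. (?t x v \<bullet> i) * ?u (t x) i)) (at x)"
        by (subst (asm) frechet_derivative_Basis[OF u']) simp
    next
      fix v
      have "Ck_on k (\<lambda>x. ?t x v \<bullet> i) S'" for i
        by (rule Ck_on_bounded_linear[OF bounded_linear_inner_left o(2)])
          (rule smooth_onD[OF smooth_on_frechet[OF t]])
      then show "Ck_on k (\<lambda>x. \<Sum>i\<in>Basis. (?t x v \<bullet> i) * ?u (t x) i) S'"
        by (intro Ck_on_sum Ck_on_mult o Suc.IH smooth_on_frechet Suc.prems)
    qed
  qed
  then show ?thesis by (simp add: smooth_on_def)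
qed

lemma smooth_on_cong:
  "open S \<Longrightarrow> (\<And>x. x \<in> S \<Longrightarrow> f x = g x) \<Longrightarrow> smooth_on S f \<Longrightarrow> smooth_on S g"
  unfolding smooth_on_def using Ck_on_cong by metis

lemma smooth_on_subset: "smooth_on S f \<Longrightarrow> S' \<subseteq> S \<Longrightarrow> smooth_on S' f"
  unfolding smooth_on_def using Ck_on_subset by metis

lemma smooth_on_const: "smooth_on S (\<lambda>x. c)"
  and smooth_on_id: "smooth_on S (\<lambda>x. x)"
  by (auto simp: smooth_on_def Ck_on_const Ck_on_id)

lemma smooth_on_add:
  "open S \<Longrightarrow> smooth_on S f \<Longrightarrow> smooth_on S g \<Longrightarrow> smooth_on S (\<lambda>x. f x + g x)"
  by (simp add: smooth_on_def Ck_on_add)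

lemma smooth_on_mult:
  fixes f g :: "'e::euclidean_space \<Rightarrow> real"
  shows "open S \<Longrightarrow> smooth_on S f \<Longrightarrow> smooth_on S g \<Longrightarrow> smooth_on S (\<lambda>x. f x * g x)"
  by (simp add: smooth_on_def Ck_on_mult)

lemma smooth_on_sum:
  "open S \<Longrightarrow> (\<And>i. i \<in> I \<Longrightarrow> smooth_on S (f i)) \<Longrightarrow> smooth_on S (\<lambda>x. \<Sum>i\<in>I. f i x)"
  by (simp add: smooth_on_def Ck_on_sum)

lemma smooth_on_bounded_linear:
  "bounded_linear l \<Longrightarrow> open S \<Longrightarrow> smooth_on S f \<Longrightarrow> smooth_on S (\<lambda>x. l (f x))"
  by (simp add: smooth_on_def Ck_on_bounded_linear)

lemma smooth_on_local:
  assumes "open S" "\<And>x. x \<in> S \<Longrightarrow> \<exists>U. open U \<and> x \<in> U \<and> smooth_on U f"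
  shows "smooth_on S f"
  unfolding smooth_on_def
proof
  fix k show "Ck_on k f S"
    by (rule Ck_on_open_Union[OF _ assms(1)]) (use assms(2) in \<open>auto simp: smooth_on_def\<close>)
qed

section \<open>Bump functions and Hadamard's lemma\<close>

text \<open>The functions \<open>t\<^sup>-\<^sup>m exp (- 1 / t)\<close>, extended by \<open>0\<close>. The powers are included because this family is
  closed under differentiation up to linear combinations.\<close>
definition flat :: "nat \<Rightarrow> real \<Rightarrow> real" where
  "flat m t = (if t \<le> 0 then 0 else inverse t ^ m * exp (- inverse t))"

text \<open>Substitute \<open>s = 1 / t\<close>: an exponential beats every power at infinity.\<close>
lemma flat_tendsto_0: "(flat m \<longlongrightarrow> 0) (at 0)"
proof -
  have "((\<lambda>t. inverse t ^ m / exp (inverse t)) \<longlongrightarrow> 0) (at_right (0::real))"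
    by (rule filterlim_compose[OF tendsto_power_div_exp_0 filterlim_inverse_at_top_right])
  moreover have "eventually (\<lambda>t. inverse t ^ m / exp (inverse t) = flat m t) (at_right (0::real))"
    using eventually_at_right_less[of "0::real"]
    by eventually_elim (simp add: flat_def exp_minus divide_inverse)
  ultimately have "(flat m \<longlongrightarrow> 0) (at_right 0)"
    using tendsto_cong by force
  moreover have "(flat m \<longlongrightarrow> 0) (at_left 0)"
    by (rule tendsto_eventually) (auto simp: flat_def eventually_at_filter)
  ultimately show ?thesis by (simp add: filterlim_split_at)
qed

lemma flat_deriv: "(flat m has_real_derivative (flat (m + 2) t - m * flat (m + 1) t)) (at t)"
proof -
  consider "t < 0" | "t = 0" | "t > 0" by linarith
  then show ?thesis
  proof cases
    case 1
    have "((\<lambda>t. 0) has_real_derivative (flat (m + 2) t - m * flat (m + 1) t)) (at t)"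
      using 1 by (auto simp: flat_def)
    then show ?thesis
      by (rule has_field_derivative_transform_within_open[where S = "{..<0}"]) (use 1 in \<open>auto simp: flat_def\<close>)
  next
    case 2
    \<comment> \<open>The difference quotient of \<open>flat m\<close> at \<open>0\<close> is \<open>flat (m + 1)\<close>, which tends to \<open>0\<close>.\<close>
    have "((\<lambda>s. (flat m (0 + s) - flat m 0) / s) \<longlongrightarrow> 0) (at 0)"
      by (rule Lim_transform_eventually[OF flat_tendsto_0[of "m + 1"]])
        (auto simp: flat_def divide_inverse eventually_at_filter)
    then show ?thesis using 2 by (simp add: DERIV_def) (simp add: flat_def)
  next
    case 3
    have "((\<lambda>t. inverse t ^ m * exp (- inverse t)) has_real_derivative (flat (m + 2) t - m * flat (m + 1) t)) (at t)"
    proof -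
      have i: "(inverse has_real_derivative - (inverse t * inverse t)) (at t)"
        using DERIV_inverse[of t] 3 by (simp add: numeral_2_eq_2)
      have d1: "((\<lambda>t. inverse t ^ m) has_real_derivative real m * (- (inverse t * inverse t) * inverse t ^ (m - Suc 0))) (at t)"
        using DERIV_power[OF i, of m] by simp
      have d2: "((\<lambda>t. exp (- inverse t)) has_real_derivative exp (- inverse t) * (inverse t * inverse t)) (at t)"
        using DERIV_fun_exp[OF DERIV_minus[OF i]] by simp
      have e: "real m * (- (inverse t * inverse t) * inverse t ^ (m - Suc 0)) * exp (- inverse t)
          + exp (- inverse t) * (inverse t * inverse t) * inverse t ^ m = flat (m + 2) t - m * flat (m + 1) t"
        using 3 by (cases m) (simp_all add: flat_def algebra_simps)
      show ?thesis unfolding e[symmetric] by (rule DERIV_mult[OF d1 d2])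
    qed
    then show ?thesis
      by (rule has_field_derivative_transform_within_open[where S = "{0<..}"]) (use 3 in \<open>auto simp: flat_def\<close>)
  qed
qed

lemma flat_smooth: "smooth_on UNIV (flat m)"
proof -
  have "Ck_on k (flat m) UNIV" for k m
  proof (induction k arbitrary: m)
    case 0
    show ?case
      using DERIV_isCont[OF flat_deriv[of m]] by (auto intro: continuous_at_imp_continuous_on)
  next
    case (Suc k)
    show ?case
    proof (rule Ck_on_SucI[OF open_UNIV])
      fix t show "(flat m has_derivative (\<lambda>v. (flat (m + 2) t + (- m) * flat (m + 1) t) * v)) (at t)"
        using flat_deriv[of m t] by (simp add: has_field_derivative_def)
    next
      fix v show "Ck_on k (\<lambda>t. (flat (m + 2) t + (- m) * flat (m + 1) t) * v) UNIV"
        by (intro Ck_on_mult Ck_on_add Ck_on_const Suc.IH open_UNIV)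
    qed
  qed
  then show ?thesis by (simp add: smooth_on_def)
qed

definition bump :: "'e::euclidean_space \<Rightarrow> real \<Rightarrow> 'e \<Rightarrow> real" where
  "bump c r x = flat 0 (r\<^sup>2 - (norm (x - c))\<^sup>2)"

lemma bump_pos: "0 \<le> r \<Longrightarrow> norm (x - c) < r \<Longrightarrow> bump c r x > 0"
  using power_strict_mono[of "norm (x - c)" r 2] by (simp add: bump_def flat_def)

lemma bump_0: "0 \<le> r \<Longrightarrow> norm (x - c) \<ge> r \<Longrightarrow> bump c r x = 0"
  using power_mono[of r "norm (x - c)" 2] by (simp add: bump_def flat_def)

lemma bump_smooth: "smooth_on UNIV (bump c r)"
proof -
  have i: "smooth_on UNIV (\<lambda>x. (x - c) \<bullet> i)" for i
    using smooth_on_add[OF open_UNIV smooth_on_bounded_linear[OF bounded_linear_inner_left open_UNIV smooth_on_id] smooth_on_const, of i "- (c \<bullet> i)"]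
    by (simp add: inner_diff_left)
  have *: "(norm (x - c))\<^sup>2 = (\<Sum>i\<in>Basis. ((x - c) \<bullet> i) * ((x - c) \<bullet> i))" for x
    unfolding power2_norm_eq_inner by (rule euclidean_inner)
  from i have "smooth_on UNIV (\<lambda>x. r\<^sup>2 + (- 1) * (\<Sum>i\<in>Basis. ((x - c) \<bullet> i) * ((x - c) \<bullet> i)))"
    by (intro smooth_on_add smooth_on_mult smooth_on_sum smooth_on_const open_UNIV)
  then have "smooth_on UNIV (\<lambda>x. r\<^sup>2 - (norm (x - c))\<^sup>2)"
    by (simp only: *) simp
  then show ?thesis
    unfolding bump_def[abs_def] by (rule smooth_on_compose[OF flat_smooth]) auto
qed

lemma segment_in_convex: "convex B \<Longrightarrow> q \<in> B \<Longrightarrow> y \<in> B \<Longrightarrow> t \<in> {0..1} \<Longrightarrow> q + t *\<^sub>R (y - q) \<in> B"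
  using convexD_alt[of B q y t] by (auto simp: algebra_simps)

text \<open>Differentiation under the integral sign. The weight \<open>t\<^sup>j\<close> makes the induction work: the inner
  derivative of \<open>q + t (y - q)\<close> contributes one more factor \<open>t\<close>.\<close>
lemma smooth_on_integral:
  fixes w :: "'e::euclidean_space \<Rightarrow> real"
  assumes B: "open B" "convex B" "q \<in> B" and w: "smooth_on B w"
  shows "smooth_on B (\<lambda>y. integral (cbox 0 1) (\<lambda>t::real. t ^ j * w (q + t *\<^sub>R (y - q))))"
proof -
  have seg: "q + t *\<^sub>R (y - q) \<in> B" if "y \<in> B" "t \<in> cbox 0 1" for y t
    using segment_in_convex[OF B(2,3)] that by auto
  have cont: "continuous_on (B \<times> cbox 0 1) (\<lambda>(y, t). t ^ j * w (q + t *\<^sub>R (y - q)))"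
    if "smooth_on B w" for w :: "'e \<Rightarrow> real" and j
    unfolding split_beta
    by (intro continuous_intros continuous_on_compose2[OF smooth_onD[OF that, of 0, simplified]])
      (auto intro: segment_in_convex[OF B(2,3)])
  have "Ck_on k (\<lambda>y. integral (cbox 0 1) (\<lambda>t::real. t ^ j * w (q + t *\<^sub>R (y - q)))) B" for k
    using w
  proof (induction k arbitrary: w j)
    case 0
    show ?case using integral_continuous_on_param[OF cont[OF 0]] by simp
  next
    case (Suc k)
    note w = Suc.prems
    let ?w = "\<lambda>y. frechet_derivative w (at y)"
    define W where "W y t = Blinfun (\<lambda>v. t ^ Suc j * ?w (q + t *\<^sub>R (y - q)) v)" for y t
    have dw: "(w has_derivative ?w y) (at y)" if "y \<in> B" for y
      using smooth_on_has_derivative[OF w B(1) that] .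
    have W: "blinfun_apply (W y t) = (\<lambda>v. t ^ Suc j * ?w (q + t *\<^sub>R (y - q)) v)" if "y \<in> B" "t \<in> cbox 0 1" for y t
      unfolding W_def
      by (rule bounded_linear_Blinfun_apply)
        (rule bounded_linear_mult_right[THEN bounded_linear_compose], rule has_derivative_bounded_linear[OF dw[OF seg[OF that]]])
    have contW: "continuous_on (B \<times> cbox 0 1) (\<lambda>(y, t). W y t)"
      unfolding split_beta
    proof (rule continuous_on_blinfun_componentwise)
      fix i :: 'e
      have "continuous_on (B \<times> cbox 0 1) (\<lambda>(y, t). t ^ Suc j * ?w (q + t *\<^sub>R (y - q)) i)"
        by (rule cont[OF smooth_on_frechet[OF w]])
      then show "continuous_on (B \<times> cbox 0 1) (\<lambda>x. blinfun_apply (W (fst x) (snd x)) i)"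
        by (rule continuous_on_eq) (auto simp: W)
    qed
    show ?case
    proof (rule Ck_on_SucI[OF B(1)])
      fix y assume y: "y \<in> B"
      have *: "((\<lambda>y. t ^ j * w (q + t *\<^sub>R (y - q))) has_derivative blinfun_apply (W y t)) (at y within B)"
        if "y \<in> B" "t \<in> cbox 0 1" for y t
      proof -
        have "((\<lambda>y. q + t *\<^sub>R (y - q)) has_derivative (\<lambda>v. t *\<^sub>R v)) (at y)"
          by (auto intro!: derivative_eq_intros)
        then have "((\<lambda>y. w (q + t *\<^sub>R (y - q))) has_derivative (\<lambda>v. ?w (q + t *\<^sub>R (y - q)) (t *\<^sub>R v))) (at y)"
          using diff_chain_at[where f = "\<lambda>y. q + t *\<^sub>R (y - q)" and x = y, OF _ dw[OF seg[OF that]]] by (simp add: o_def)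
        then have "((\<lambda>y. t ^ j * w (q + t *\<^sub>R (y - q))) has_derivative (\<lambda>v. t ^ j * ?w (q + t *\<^sub>R (y - q)) (t *\<^sub>R v))) (at y)"
          by (rule has_derivative_mult_right)
        moreover have "?w (q + t *\<^sub>R (y - q)) (t *\<^sub>R v) = t * ?w (q + t *\<^sub>R (y - q)) v" for v
          using has_derivative_linear[OF dw[OF seg[OF that]]] by (simp add: linear_cmul)
        ultimately show ?thesis by (simp add: W[OF that] has_derivative_at_withinI ac_simps)
      qed
      have "((\<lambda>y. integral (cbox 0 1) (\<lambda>t. t ^ j * w (q + t *\<^sub>R (y - q)))) has_derivative
        integral (cbox 0 1) (W y)) (at y within B)"
      proof (rule leibniz_rule[OF * _ contW y B(2)])
        fix y assume y: "y \<in> B"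
        have "continuous_on (cbox 0 1) (\<lambda>t. t ^ j * w (q + t *\<^sub>R (y - q)))"
          using continuous_on_compose2[OF cont[OF w, of j], of "cbox 0 1" "\<lambda>t. (y, t)"] y
          by (auto simp: continuous_on_Pair[OF continuous_on_const continuous_on_id])
        then show "(\<lambda>t. t ^ j * w (q + t *\<^sub>R (y - q))) integrable_on cbox 0 1"
          by (rule integrable_continuous)
      qed
      then have "((\<lambda>y. integral (cbox 0 1) (\<lambda>t. t ^ j * w (q + t *\<^sub>R (y - q)))) has_derivative
        integral (cbox 0 1) (W y)) (at y)"
        by (simp only: at_within_open[OF y B(1)])
      moreover have "blinfun_apply (integral (cbox 0 1) (W y)) =
         (\<lambda>v. integral (cbox 0 1) (\<lambda>t. t ^ Suc j * ?w (q + t *\<^sub>R (y - q)) v))"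
      proof
        fix v
        have "continuous_on (cbox 0 1) (\<lambda>t. (y, t))"
          by (rule continuous_on_Pair[OF continuous_on_const continuous_on_id])
        moreover have "(\<lambda>t. (y, t)) ` cbox 0 1 \<subseteq> B \<times> cbox 0 1" using y by auto
        ultimately have "continuous_on (cbox 0 1) (W y)"
          using continuous_on_compose2[OF contW] by fastforce
        then have "blinfun_apply (integral (cbox 0 1) (W y)) v = integral (cbox 0 1) (\<lambda>t. blinfun_apply (W y t) v)"
          by (intro blinfun_apply_integral integrable_continuous)
        also have "\<dots> = integral (cbox 0 1) (\<lambda>t. t ^ Suc j * ?w (q + t *\<^sub>R (y - q)) v)"
          by (rule integral_cong) (simp only: W[OF y])
        finally show "blinfun_apply (integral (cbox 0 1) (W y)) v = integral (cbox 0 1) (\<lambda>t. t ^ Suc j * ?w (q + t *\<^sub>R (y - q)) v)" .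
      qed
      ultimately show "((\<lambda>y. integral (cbox 0 1) (\<lambda>t. t ^ j * w (q + t *\<^sub>R (y - q)))) has_derivative
         (\<lambda>v. integral (cbox 0 1) (\<lambda>t. t ^ Suc j * ?w (q + t *\<^sub>R (y - q)) v))) (at y)"
        by (simp only:)
    next
      fix v show "Ck_on k (\<lambda>y. integral (cbox 0 1) (\<lambda>t. t ^ Suc j * ?w (q + t *\<^sub>R (y - q)) v)) B"
        by (rule Suc.IH[OF smooth_on_frechet[OF w]])
    qed
  qed
  then show ?thesis by (simp add: smooth_on_def)
qed

text \<open>Integrate the derivative of \<open>u\<close> along the segment from \<open>q\<close> to \<open>y\<close>; the coefficients \<open>G\<^sub>i\<close> are
  the averages of the partial derivatives over the segment.\<close>
lemma hadamard:
  fixes u :: "'e::euclidean_space \<Rightarrow> real"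
  assumes B: "open B" "convex B" "q \<in> B" and u: "smooth_on B u"
  obtains G where "\<And>i. smooth_on B (G i)" "\<And>i. G i q = frechet_derivative u (at q) i"
    "\<And>y. y \<in> B \<Longrightarrow> u y = u q + (\<Sum>i\<in>Basis. ((y - q) \<bullet> i) * G i y)"
proof
  let ?u = "\<lambda>y. frechet_derivative u (at y)"
  let ?G = "\<lambda>i y. integral (cbox 0 1) (\<lambda>t::real. t ^ 0 * ?u (q + t *\<^sub>R (y - q)) i)"
  show "smooth_on B (?G i)" for i
    by (rule smooth_on_integral[OF B smooth_on_frechet[OF u]])
  show "?G i q = ?u q i" for i by simp
  fix y assume y: "y \<in> B"
  have seg: "q + t *\<^sub>R (y - q) \<in> B" if "t \<in> cbox 0 1" for t
    using segment_in_convex[OF B(2,3) y] that by auto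
  have du: "(u has_derivative ?u y) (at y)" if "y \<in> B" for y
    using smooth_on_has_derivative[OF u B(1) that] .
  have "((\<lambda>t. ?u (q + t *\<^sub>R (y - q)) (y - q)) has_integral u (q + 1 *\<^sub>R (y - q)) - u (q + 0 *\<^sub>R (y - q))) {0..1}"
  proof (rule fundamental_theorem_of_calculus)
    fix t :: real assume t: "t \<in> {0..1}"
    have "((\<lambda>t. q + t *\<^sub>R (y - q)) has_vector_derivative (y - q)) (at t within {0..1})"
      by (auto intro!: derivative_eq_intros)
    then show "((\<lambda>t. u (q + t *\<^sub>R (y - q))) has_vector_derivative ?u (q + t *\<^sub>R (y - q)) (y - q)) (at t within {0..1})"
      using vector_derivative_diff_chain_within[of "\<lambda>t. q + t *\<^sub>R (y - q)" "y - q" t "{0..1}" u]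
        has_derivative_at_withinI[OF du[OF seg]] t by (auto simp: o_def)
  qed simp
  then have "u y = u q + integral (cbox 0 1) (\<lambda>t. ?u (q + t *\<^sub>R (y - q)) (y - q))"
    by (simp add: has_integral_iff)
  also have "integral (cbox 0 1) (\<lambda>t. ?u (q + t *\<^sub>R (y - q)) (y - q))
     = integral (cbox 0 1) (\<lambda>t. \<Sum>i\<in>Basis. ((y - q) \<bullet> i) * ?u (q + t *\<^sub>R (y - q)) i)"
  proof (rule integral_cong)
    fix t :: real assume "t \<in> cbox 0 1"
    then show "?u (q + t *\<^sub>R (y - q)) (y - q) = (\<Sum>i\<in>Basis. ((y - q) \<bullet> i) * ?u (q + t *\<^sub>R (y - q)) i)"
      using frechet_derivative_Basis[OF du[OF seg], of t "y - q"] by simp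
  qed
  also have "\<dots> = (\<Sum>i\<in>Basis. integral (cbox 0 1) (\<lambda>t. ((y - q) \<bullet> i) * ?u (q + t *\<^sub>R (y - q)) i))"
  proof (rule integral_sum)
    fix i :: 'e
    have "continuous_on (cbox 0 1) (\<lambda>t. ?u (q + t *\<^sub>R (y - q)) i)"
      by (rule continuous_on_compose2[OF smooth_onD[OF smooth_on_frechet[OF u], of 0, simplified]])
        (auto intro!: continuous_intros simp: seg)
    then show "(\<lambda>t. ((y - q) \<bullet> i) * ?u (q + t *\<^sub>R (y - q)) i) integrable_on cbox 0 1"
      by (intro integrable_continuous continuous_on_mult continuous_on_const)
  qed simp
  finally show "u y = u q + (\<Sum>i\<in>Basis. ((y - q) \<bullet> i) * ?G i y)" by simp
qed

section \<open>Smooth functions, vector fields and tensors on a manifold\<close>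

lemma smooth_manifoldD:
  assumes "smooth_manifold A" "(U, c) \<in> A"
  shows "open U" "open (c ` U)" "homeomorphism U (c ` U) c (the_inv_into U c)" "inj_on c U"
proof -
  have "\<forall>(U, c)\<in>A. open U \<and> open (c ` U) \<and> homeomorphism U (c ` U) c (the_inv_into U c)"
    using assms(1) by (simp add: smooth_manifold_def)
  then have *: "open U \<and> open (c ` U) \<and> homeomorphism U (c ` U) c (the_inv_into U c)"
    using assms(2) by blast
  then show "open U" "open (c ` U)" "homeomorphism U (c ` U) c (the_inv_into U c)" by auto
  from * show "inj_on c U" by (auto intro: inj_on_inverseI[where g = "the_inv_into U c"] homeomorphism_apply1)
qed

lemma const_smooth_funs: "(\<lambda>p. k) \<in> smooth_funs A"
  by (auto simp: smooth_funs_def o_def smooth_on_const)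

text \<open>All algebra below takes place in the algebra \<open>F\<close> of smooth functions and the \<open>F\<close>-module \<open>V\<close>
  of vector fields. Rules such as \<open>X (f + h) = X f + X h\<close> have the derivation itself in head position;
  they are therefore used only instantiated with a fixed vector field \<open>X\<close>.\<close>
locale manifold =
  fixes A :: "('a::{t2_space, second_countable_topology}, 'e::euclidean_space) atlas"
  assumes manifold: "smooth_manifold A"
begin

abbreviation F :: "('a \<Rightarrow> real) set" where "F \<equiv> smooth_funs A"
abbreviation V :: "'a vfield set" where "V \<equiv> vector_fields A"

lemma smooth_funs_const [simp, intro]: "(\<lambda>p. k) \<in> F"
  by (rule const_smooth_funs)

lemma smooth_funs_0 [simp, intro]: "0 \<in> F" and smooth_funs_1 [simp, intro]: "1 \<in> F"
  using smooth_funs_const[of 0] smooth_funs_const[of 1] by (simp_all add: zero_fun_def one_fun_def)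

lemma smooth_funs_add [simp, intro]: "f \<in> F \<Longrightarrow> h \<in> F \<Longrightarrow> f + h \<in> F"
  using smooth_manifoldD(2)[OF manifold]
  by (auto simp: smooth_funs_def o_def intro!: smooth_on_add)

lemma smooth_funs_mult [simp, intro]: "f \<in> F \<Longrightarrow> h \<in> F \<Longrightarrow> f * h \<in> F"
  using smooth_manifoldD(2)[OF manifold]
  by (auto simp: smooth_funs_def o_def intro!: smooth_on_mult)

lemma smooth_funs_cmult [simp, intro]: "f \<in> F \<Longrightarrow> (\<lambda>p. k * f p) \<in> F"
  using smooth_funs_mult[OF smooth_funs_const[of k], of f] by (simp add: times_fun_def)

lemma smooth_funs_neg [simp, intro]: "f \<in> F \<Longrightarrow> - f \<in> F"
  using smooth_funs_cmult[of f "-1"] by (simp add: fun_Compl_def)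

lemma smooth_funs_diff [simp, intro]: "f \<in> F \<Longrightarrow> h \<in> F \<Longrightarrow> f - h \<in> F"
  using smooth_funs_add[of f "- h"] by simp

lemma
  assumes "X \<in> V"
  shows vf_app: "f \<in> F \<Longrightarrow> X f \<in> F"
    and vf_nonsmooth: "f \<notin> F \<Longrightarrow> X f = 0"
    and vf_app_add: "f \<in> F \<Longrightarrow> h \<in> F \<Longrightarrow> X (f + h) = X f + X h"
    and vf_app_cmult: "f \<in> F \<Longrightarrow> X (\<lambda>p. k * f p) = (\<lambda>p. k * X f p)"
    and vf_app_mult: "f \<in> F \<Longrightarrow> h \<in> F \<Longrightarrow> X (f * h) = f * X h + h * X f"
  using assms by (auto simp: vector_fields_def)

lemma
  assumes X: "X \<in> V"
  shows vf_app_0: "X 0 = 0"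
    and vf_app_1: "X 1 = 0"
    and vf_app_const: "X (\<lambda>p. k) = 0"
    and vf_app_diff: "f \<in> F \<Longrightarrow> h \<in> F \<Longrightarrow> X (f - h) = X f - X h"
proof -
  show "X 0 = 0"
    using vf_app_cmult[OF X smooth_funs_0, of 0] by (simp add: zero_fun_def)
  show one: "X 1 = 0"
    using vf_app_mult[OF X smooth_funs_1 smooth_funs_1] by (simp add: fun_eq_iff)
  show "X (\<lambda>p. k) = 0"
    using vf_app_cmult[OF X smooth_funs_1, of k] by (simp add: one fun_eq_iff)
  have neg: "X (- f) = - X f" if "f \<in> F" for f
    using vf_app_cmult[OF X that, of "-1"] by (simp add: fun_Compl_def)
  show "f \<in> F \<Longrightarrow> h \<in> F \<Longrightarrow> X (f - h) = X f - X h"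
    using vf_app_add[OF X, of f "- h"] neg[of h] by (simp add: fun_eq_iff diff_conv_add_uminus del: add_uminus_conv_diff)
qed

lemma vfI:
  assumes "\<And>f. f \<in> F \<Longrightarrow> X f \<in> F" "\<And>f. f \<notin> F \<Longrightarrow> X f = 0"
    "\<And>f h. f \<in> F \<Longrightarrow> h \<in> F \<Longrightarrow> X (f + h) = X f + X h"
    "\<And>k f. f \<in> F \<Longrightarrow> X (\<lambda>p. k * f p) = (\<lambda>p. k * X f p)"
    "\<And>f h. f \<in> F \<Longrightarrow> h \<in> F \<Longrightarrow> X (f * h) = f * X h + h * X f"
  shows "X \<in> V"
  using assms by (simp add: vector_fields_def)

lemma vf_zero [simp, intro]: "0 \<in> V"
  by (rule vfI) (auto simp: zero_fun_def)

lemma vf_add [simp, intro]: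
  assumes X: "X \<in> V" and Y: "Y \<in> V"
  shows "X + Y \<in> V"
  by (rule vfI; simp add: vf_app_add[OF X] vf_app_cmult[OF X] vf_app_mult[OF X] vf_nonsmooth[OF X] vf_app[OF X]
      vf_app_add[OF Y] vf_app_cmult[OF Y] vf_app_mult[OF Y] vf_nonsmooth[OF Y] vf_app[OF Y])
    (simp_all add: fun_eq_iff algebra_simps)

lemma vf_fmul [simp, intro]:
  assumes f: "f \<in> F" and X: "X \<in> V"
  shows "f \<odot> X \<in> V"
  by (rule vfI; simp add: f fmul_def vf_app_add[OF X] vf_app_cmult[OF X] vf_app_mult[OF X] vf_nonsmooth[OF X] vf_app[OF X])
    (simp_all add: fun_eq_iff algebra_simps)

lemma cmul_eq_fmul: "k \<odot>\<^sub>R X = (\<lambda>p. k) \<odot> X"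
  by (simp add: cmul_def fmul_def fun_eq_iff)

lemma vf_cmul [simp, intro]: "X \<in> V \<Longrightarrow> k \<odot>\<^sub>R X \<in> V"
  by (simp add: cmul_eq_fmul)

lemma vf_neg [simp, intro]: "X \<in> V \<Longrightarrow> - X \<in> V"
  using vf_cmul[of X "-1"] by (simp add: cmul_def fun_Compl_def)

lemma vf_diff [simp, intro]: "X \<in> V \<Longrightarrow> Y \<in> V \<Longrightarrow> X - Y \<in> V"
  using vf_add[of X "- Y"] by simp

lemma vf_bracket [simp, intro]:
  assumes X: "X \<in> V" and Y: "Y \<in> V"
  shows "lie_bracket X Y \<in> V"
  by (rule vfI; simp add: lie_bracket_def vf_app_0[OF X] vf_app_0[OF Y]
      vf_app_add[OF X] vf_app_cmult[OF X] vf_app_mult[OF X] vf_nonsmooth[OF X] vf_app[OF X]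
      vf_app_add[OF Y] vf_app_cmult[OF Y] vf_app_mult[OF Y] vf_nonsmooth[OF Y] vf_app[OF Y])
    (simp_all add: fun_eq_iff algebra_simps)

lemma fmul_apply [simp]: "(f \<odot> X) k = f * X k"
  by (simp add: fmul_def)

lemma cmul_apply [simp]: "(c \<odot>\<^sub>R X) k p = c * X k p"
  by (simp add: cmul_def)

lemma fmul_simps [simp]: "f \<odot> (0 :: 'b vfield) = 0" "0 \<odot> Y = (0 :: 'b vfield)" "1 \<odot> Y = Y"
  and cmul_0 [simp]: "c \<odot>\<^sub>R (0 :: 'b vfield) = 0"
  by (simp_all add: fun_eq_iff)

lemma bracket_fmul:
  assumes "X \<in> V" "Y \<in> V" "f \<in> F"
  shows "lie_bracket X (f \<odot> Y) = X f \<odot> Y + f \<odot> lie_bracket X Y"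
proof
  fix k show "lie_bracket X (f \<odot> Y) k = (X f \<odot> Y + f \<odot> lie_bracket X Y) k"
  proof (cases "k \<in> F")
    case True
    then show ?thesis
      by (simp add: lie_bracket_def vf_app_mult[OF assms(1)] vf_app[OF assms(2)] assms(3) algebra_simps)
  next
    case False
    then show ?thesis
      by (simp add: lie_bracket_def vf_nonsmooth[OF assms(1)] vf_nonsmooth[OF assms(2)] vf_app_0[OF assms(1)] vf_app_0[OF assms(2)])
  qed
qed

lemma bracket_add:
  assumes "X \<in> V" "Y \<in> V" "Z \<in> V"
  shows "lie_bracket X (Y + Z) = lie_bracket X Y + lie_bracket X Z"
proof
  fix k show "lie_bracket X (Y + Z) k = (lie_bracket X Y + lie_bracket X Z) k"
    by (cases "k \<in> F")
      (simp_all add: lie_bracket_def vf_app_add[OF assms(1)] vf_app[OF assms(2)] vf_app[OF assms(3)]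
       vf_nonsmooth[OF assms(1)] vf_nonsmooth[OF assms(2)] vf_nonsmooth[OF assms(3)]
       vf_app_0[OF assms(1)] vf_app_0[OF assms(2)] vf_app_0[OF assms(3)])
qed

lemma bracket_swap: "lie_bracket X Y = - lie_bracket Y X"
  by (simp add: lie_bracket_def fun_eq_iff)

lemma jacobi:
  assumes "X \<in> V" "Y \<in> V" "Z \<in> V"
  shows "lie_bracket (lie_bracket X Y) Z + lie_bracket (lie_bracket Y Z) X + lie_bracket (lie_bracket Z X) Y = 0"
proof
  fix k show "(lie_bracket (lie_bracket X Y) Z + lie_bracket (lie_bracket Y Z) X + lie_bracket (lie_bracket Z X) Y) k = 0 k"
    by (cases "k \<in> F")
      (simp_all add: lie_bracket_def vf_app_diff[OF assms(1)] vf_app_diff[OF assms(2)] vf_app_diff[OF assms(3)]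
       vf_app[OF assms(1)] vf_app[OF assms(2)] vf_app[OF assms(3)]
       vf_nonsmooth[OF assms(1)] vf_nonsmooth[OF assms(2)] vf_nonsmooth[OF assms(3)]
       vf_app_0[OF assms(1)] vf_app_0[OF assms(2)] vf_app_0[OF assms(3)])
qed

lemma
  assumes "tensor11 A \<psi>"
  shows tensor11_vf: "X \<in> V \<Longrightarrow> \<psi> X \<in> V"
    and tensor11_add: "X \<in> V \<Longrightarrow> Y \<in> V \<Longrightarrow> \<psi> (X + Y) = \<psi> X + \<psi> Y"
    and tensor11_fmul: "f \<in> F \<Longrightarrow> X \<in> V \<Longrightarrow> \<psi> (f \<odot> X) = f \<odot> \<psi> X"
  using assms by (auto simp: tensor11_def)

lemma cmul_m1: "(-1) \<odot>\<^sub>R X = - X" by (simp add: fun_eq_iff)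

lemma
  assumes \<psi>: "tensor11 A \<psi>"
  shows tensor11_cmul: "X \<in> V \<Longrightarrow> \<psi> (c \<odot>\<^sub>R X) = c \<odot>\<^sub>R \<psi> X"
    and tensor11_neg: "X \<in> V \<Longrightarrow> \<psi> (- X) = - \<psi> X"
    and tensor11_diff: "X \<in> V \<Longrightarrow> Y \<in> V \<Longrightarrow> \<psi> (X - Y) = \<psi> X - \<psi> Y"
    and tensor11_0: "\<psi> 0 = 0"
proof -
  show c: "\<psi> (c \<odot>\<^sub>R X) = c \<odot>\<^sub>R \<psi> X" if "X \<in> V" for c X
    by (simp add: cmul_eq_fmul tensor11_fmul[OF \<psi>] that)
  show neg: "\<psi> (- X) = - \<psi> X" if "X \<in> V" for X
    using c[OF that, of "-1"] by (simp add: cmul_m1)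
  show "\<psi> (X - Y) = \<psi> X - \<psi> Y" if "X \<in> V" "Y \<in> V" for X Y
    using tensor11_add[OF \<psi>, of X "- Y"] neg[of Y] that by simp
  show "\<psi> 0 = 0" using tensor11_add[OF \<psi>, of 0 0] by simp
qed

lemmas tensor11_rules = tensor11_vf tensor11_add tensor11_fmul tensor11_cmul tensor11_neg tensor11_diff tensor11_0

lemma
  assumes \<omega>: "one_form A \<omega>"
  shows one_form_smooth: "X \<in> V \<Longrightarrow> \<omega> X \<in> F"
    and one_form_add: "X \<in> V \<Longrightarrow> Y \<in> V \<Longrightarrow> \<omega> (X + Y) = \<omega> X + \<omega> Y"
    and one_form_fmul: "f \<in> F \<Longrightarrow> X \<in> V \<Longrightarrow> \<omega> (f \<odot> X) = f * \<omega> X"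
    and one_form_cmul: "X \<in> V \<Longrightarrow> \<omega> (c \<odot>\<^sub>R X) = (\<lambda>p. c) * \<omega> X"
    and one_form_neg: "X \<in> V \<Longrightarrow> \<omega> (- X) = - \<omega> X"
    and one_form_diff: "X \<in> V \<Longrightarrow> Y \<in> V \<Longrightarrow> \<omega> (X - Y) = \<omega> X - \<omega> Y"
    and one_form_0: "\<omega> 0 = 0"
proof -
  show "X \<in> V \<Longrightarrow> \<omega> X \<in> F" for X using \<omega> by (auto simp: one_form_def)
  show add: "X \<in> V \<Longrightarrow> Y \<in> V \<Longrightarrow> \<omega> (X + Y) = \<omega> X + \<omega> Y" for X Y using \<omega> by (auto simp: one_form_def)
  show f: "f \<in> F \<Longrightarrow> X \<in> V \<Longrightarrow> \<omega> (f \<odot> X) = f * \<omega> X" for f X using \<omega> by (auto simp: one_form_def)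
  show c: "\<omega> (c \<odot>\<^sub>R X) = (\<lambda>p. c) * \<omega> X" if "X \<in> V" for c X
    by (simp add: cmul_eq_fmul f that)
  show neg: "\<omega> (- X) = - \<omega> X" if "X \<in> V" for X
    using c[OF that, of "-1"] by (simp add: cmul_m1 fun_eq_iff)
  show "\<omega> (X - Y) = \<omega> X - \<omega> Y" if "X \<in> V" "Y \<in> V" for X Y
    using add[of X "- Y"] neg[of Y] that by simp
  show "\<omega> 0 = 0" using add[of 0 0] by simp
qed

lemmas one_form_rules = one_form_smooth one_form_add one_form_fmul one_form_cmul one_form_neg one_form_diff one_form_0

lemma tensor11I:
  assumes "\<And>X. X \<in> V \<Longrightarrow> \<psi> X \<in> V"
    "\<And>X Y. X \<in> V \<Longrightarrow> Y \<in> V \<Longrightarrow> \<psi> (X + Y) = \<psi> X + \<psi> Y"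
    "\<And>f X. f \<in> F \<Longrightarrow> X \<in> V \<Longrightarrow> \<psi> (f \<odot> X) = f \<odot> \<psi> X"
  shows "tensor11 A \<psi>"
  using assms by (simp add: tensor11_def)

lemma half_lie_tensor11:
  assumes "Z \<in> V" "tensor11 A \<psi>"
  shows "tensor11 A (half_lie Z \<psi>)"
  by (rule tensor11I; simp add: half_lie_def lie_deriv11_def tensor11_rules[OF assms(2)] assms(1)
     bracket_fmul bracket_add vf_app[OF assms(1)])
    (simp_all add: fun_eq_iff algebra_simps)

text \<open>The identity \<open>d (d \<eta>) = 0\<close>, written out on three vector fields. All terms cancel in pairs
  except the value of \<open>\<eta>\<close> on the Jacobi sum.\<close>
lemma ext_deriv_closed:
  assumes \<eta>: "one_form A \<eta>" and X: "X \<in> V" and Y: "Y \<in> V" and Z: "Z \<in> V"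
  shows "X (ext_deriv \<eta> Y Z) + Y (ext_deriv \<eta> Z X) + Z (ext_deriv \<eta> X Y)
    = ext_deriv \<eta> (lie_bracket X Y) Z + ext_deriv \<eta> (lie_bracket Y Z) X + ext_deriv \<eta> (lie_bracket Z X) Y"
proof -
  have e: "ext_deriv \<eta> U W = (\<lambda>p. (1/2) * (U (\<eta> W) - W (\<eta> U) - \<eta> (lie_bracket U W)) p)" for U W
    by (simp add: ext_deriv_def)
  have br: "lie_bracket U W f = U (W f) - W (U f)" for U W f
    by (simp add: lie_bracket_def)
  have app: "U (ext_deriv \<eta> W W') = (\<lambda>p. (1/2) * (U (W (\<eta> W')) - U (W' (\<eta> W)) - U (\<eta> (lie_bracket W W'))) p)"
    if "U \<in> V" "W \<in> V" "W' \<in> V" for U W W'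
  proof -
    have *: "W (\<eta> W') - W' (\<eta> W) - \<eta> (lie_bracket W W') \<in> F"
      using that by (simp add: vf_app[OF that(2)] vf_app[OF that(3)] one_form_rules[OF \<eta>])
    show ?thesis
      unfolding e vf_app_cmult[OF that(1) *]
      by (simp add: vf_app_diff[OF that(1)] vf_app[OF that(2)] vf_app[OF that(3)] one_form_rules[OF \<eta>] that)
  qed
  have "\<eta> (lie_bracket (lie_bracket X Y) Z) + \<eta> (lie_bracket (lie_bracket Y Z) X)
     + \<eta> (lie_bracket (lie_bracket Z X) Y) = 0"
    using arg_cong[OF jacobi[OF X Y Z], of \<eta>] X Y Z by (simp add: one_form_rules[OF \<eta>])
  then have J: "\<eta> (lie_bracket (lie_bracket X Y) Z) p + \<eta> (lie_bracket (lie_bracket Y Z) X) p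
     + \<eta> (lie_bracket (lie_bracket Z X) Y) p = 0" for p
    by (metis plus_fun_apply zero_fun_apply)
  show ?thesis
  proof
    fix p show "(X (ext_deriv \<eta> Y Z) + Y (ext_deriv \<eta> Z X) + Z (ext_deriv \<eta> X Y)) p =
      (ext_deriv \<eta> (lie_bracket X Y) Z + ext_deriv \<eta> (lie_bracket Y Z) X + ext_deriv \<eta> (lie_bracket Z X) Y) p"
      using J[of p] by (simp add: app X Y Z) (simp add: e br field_simps, linarith?)
  qed
qed

end

section \<open>Tangent spaces\<close>

context manifold begin

text \<open>A smooth function on a coordinate ball that vanishes off a compact subset \<open>K\<close> extends by zero
  to the manifold. Seen in another chart it is a composition with a transition map near the points
  of the coordinate ball. All other points have a neighbourhood that avoids the preimage of \<open>K\<close>: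
  this preimage is compact and therefore closed, because the manifold is Hausdorff.\<close>
lemma smooth_funs_zero_extend:
  assumes Uc: "(U, c) \<in> A" and B: "open B" "B \<subseteq> c ` U" and K: "compact K" "K \<subseteq> B"
    and u: "smooth_on B u" and u0: "\<And>x. x \<in> B \<Longrightarrow> x \<notin> K \<Longrightarrow> u x = 0"
  shows "(\<lambda>q. if q \<in> U \<and> c q \<in> B then u (c q) else 0) \<in> F" (is "?f \<in> F")
  unfolding smooth_funs_def
proof (clarify, rule smooth_on_local)
  fix W d assume Wd: "(W, d) \<in> A"
  let ?ci = "the_inv_into U c" and ?di = "the_inv_into W d"
  note U = smooth_manifoldD[OF manifold Uc] and W = smooth_manifoldD[OF manifold Wd]
  show "open (d ` W)" by (rule W)
  have trans: "smooth_on (d ` (W \<inter> U)) (c \<circ> ?di)"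
    using manifold Uc Wd unfolding smooth_manifold_def by blast
  have op: "open (d ` S)" if "open S" "S \<subseteq> W" for S
  proof -
    have "openin (top_of_set W) S" using that W(1) by (simp add: openin_open_eq)
    from homeomorphism_imp_open_map[OF W(3) this] show ?thesis using W(2) by (simp add: openin_open_eq)
  qed
  have di: "?di (d q) = q" if "q \<in> W" for q
    using the_inv_into_f_f[OF W(4) that] .
  have ci: "?ci (c q) = q" if "q \<in> U" for q
    using the_inv_into_f_f[OF U(4) that] .
  have cont_c: "continuous_on U c" and cont_ci: "continuous_on (c ` U) ?ci"
    using U(3) by (auto simp: homeomorphism_def)
  fix x assume "x \<in> d ` W"
  then obtain q where q: "q \<in> W" "x = d q" by auto
  show "\<exists>N. open N \<and> x \<in> N \<and> smooth_on N (?f \<circ> ?di)"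
  proof (cases "q \<in> U \<and> c q \<in> B")
    case True
    let ?S = "W \<inter> (U \<inter> c -` B)"
    have S: "open ?S"
      using continuous_open_preimage[OF cont_c U(1) B(1)] W(1) by auto
    have "open (d ` ?S)" by (rule op[OF S]) auto
    moreover have "x \<in> d ` ?S" using True q by auto
    moreover have "smooth_on (d ` ?S) (?f \<circ> ?di)"
    proof (rule smooth_on_cong[OF op[OF S]])
      show "smooth_on (d ` ?S) (\<lambda>y. u ((c \<circ> ?di) y))"
        by (rule smooth_on_compose[OF u smooth_on_subset[OF trans] B(1) op[OF S]]) (auto simp: di)
    qed (auto simp: di)
    ultimately show ?thesis by blast
  next
    case False
    let ?S = "W - ?ci ` K"
    have "compact (?ci ` K)"
      using compact_continuous_image[OF continuous_on_subset[OF cont_ci] K(1)] K(2) B(2) by auto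
    then have S: "open ?S" using W(1) compact_imp_closed by auto
    have nK: "r \<in> U \<and> c r \<in> B" if "r \<in> ?ci ` K" for r
    proof -
      from that obtain k where "k \<in> K" "r = ?ci k" by auto
      moreover then obtain s where "s \<in> U" "k = c s" using K(2) B(2) by auto
      ultimately show ?thesis using ci K(2) by auto
    qed
    have "open (d ` ?S)" by (rule op[OF S]) auto
    moreover have "x \<in> d ` ?S" using False q nK by auto
    moreover have "smooth_on (d ` ?S) (?f \<circ> ?di)"
    proof (rule smooth_on_cong[OF op[OF S] _ smooth_on_const[of _ 0]])
      fix y assume "y \<in> d ` ?S"
      then obtain r where r: "r \<in> W" "r \<notin> ?ci ` K" "y = d r" by auto
      have "u (c r) = 0" if "r \<in> U" "c r \<in> B"
        using u0[OF that(2)] r(2) ci[OF that(1)] by (metis imageI)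
      then show "0 = (?f \<circ> ?di) y" using r di by simp
    qed auto
    ultimately show ?thesis by blast
  qed
qed

lemma vf_app_sum:
  assumes X: "X \<in> V" and "\<And>i. i \<in> I \<Longrightarrow> f i \<in> F"
  shows "X (\<lambda>q. \<Sum>i\<in>I. f i q) = (\<lambda>q. \<Sum>i\<in>I. X (f i) q) \<and> (\<lambda>q. \<Sum>i\<in>I. f i q) \<in> F"
  using assms(2)
proof (induction I rule: infinite_finite_induct)
  case (insert i I)
  have "(\<lambda>q. \<Sum>j\<in>insert i I. f j q) = f i + (\<lambda>q. \<Sum>j\<in>I. f j q)"
    using insert by (simp add: fun_eq_iff)
  then show ?case using insert by (simp add: vf_app_add[OF X])
qed (simp_all add: vf_app_const[OF X] fun_eq_iff zero_fun_def)

end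

text \<open>The factor \<open>2\<close> leaves room: the bump function of radius \<open>r\<close> has compact support inside the
  coordinate ball of radius \<open>2 r\<close>.\<close>
locale chart_at = manifold A
  for A :: "('a::{t2_space, second_countable_topology}, 'e::euclidean_space) atlas" +
  fixes U :: "'a set" and c :: "'a \<Rightarrow> 'e" and p :: 'a and r :: real
  assumes Uc: "(U, c) \<in> A" and p: "p \<in> U" and r: "r > 0" and ball: "ball (c p) (2 * r) \<subseteq> c ` U"
begin

abbreviation "ci \<equiv> the_inv_into U c"
abbreviation "B \<equiv> ball (c p) (2 * r)"
abbreviation "\<beta> \<equiv> bump (c p) r"

lemma ci [simp]: "q \<in> U \<Longrightarrow> ci (c q) = q"
  using the_inv_into_f_f[OF smooth_manifoldD(4)[OF manifold Uc]] .

definition cutoff :: "('e \<Rightarrow> real) \<Rightarrow> 'a \<Rightarrow> real" where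
  "cutoff u = (\<lambda>q. if q \<in> U \<and> c q \<in> B then \<beta> (c q) * u (c q) else 0)"

lemma cutoff_smooth: "smooth_on B u \<Longrightarrow> cutoff u \<in> F"
  unfolding cutoff_def
proof (rule smooth_funs_zero_extend[OF Uc _ ball, where K = "cball (c p) r"])
  show "smooth_on B u \<Longrightarrow> smooth_on B (\<lambda>x. \<beta> x * u x)"
    by (intro smooth_on_mult open_ball smooth_on_subset[OF bump_smooth]) auto
  show "cball (c p) r \<subseteq> B" using r by auto
  fix x assume "x \<notin> cball (c p) r"
  then show "\<beta> x * u x = 0" using bump_0[of r x "c p"] r by (simp add: dist_norm norm_minus_commute)
qed auto

text \<open>The cut-offs \<open>b\<close> of the constant \<open>1\<close> and \<open>co i\<close> of the coordinates. Wherever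
  \<open>b > 0\<close>, the \<open>i\<close>-th coordinate is the quotient \<open>co i / b\<close>.\<close>
definition b :: "'a \<Rightarrow> real" where "b = cutoff (\<lambda>x. 1)"
definition co :: "'e \<Rightarrow> 'a \<Rightarrow> real" where "co i = cutoff (\<lambda>x. x \<bullet> i)"

lemma b_smooth [simp, intro]: "b \<in> F"
  unfolding b_def by (intro cutoff_smooth smooth_on_const)

lemma co_smooth [simp, intro]: "co i \<in> F"
  unfolding co_def
  by (intro cutoff_smooth smooth_on_bounded_linear[OF bounded_linear_inner_left open_ball smooth_on_id])

lemma cutoff_b: "cutoff u q = b q * u (c q)"
  by (simp add: cutoff_def b_def)

lemma b_p: "b p > 0"
  using bump_pos[of r "c p" "c p"] r p by (simp add: b_def cutoff_def)

lemma b_neq: "b q \<noteq> 0 \<Longrightarrow> q \<in> U \<and> c q \<in> B"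
  by (auto simp: b_def cutoff_def split: if_splits)

lemma smooth_on_chart: "f \<in> F \<Longrightarrow> smooth_on B (f \<circ> ci)"
  using Uc smooth_on_subset[OF _ ball] unfolding smooth_funs_def by blast

text \<open>The coordinate field \<open>\<partial>\<^sub>i\<close> multiplied by the bump function.\<close>
definition E :: "'e \<Rightarrow> 'a vfield" where
  "E i f = (if f \<in> F then cutoff (\<lambda>x. frechet_derivative (f \<circ> ci) (at x) i) else 0)"

lemma chart_deriv:
  "f \<in> F \<Longrightarrow> x \<in> B \<Longrightarrow> (f \<circ> ci has_derivative frechet_derivative (f \<circ> ci) (at x)) (at x)"
  using smooth_on_has_derivative[OF smooth_on_chart open_ball] .

lemma E_vf [simp, intro]: "E i \<in> V"
proof (rule vfI)
  fix f assume f: "f \<in> F"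
  show "E i f \<in> F" using f by (simp add: E_def cutoff_smooth smooth_on_frechet smooth_on_chart)
next
  fix f h assume f: "f \<in> F" "h \<in> F"
  have "frechet_derivative ((f + h) \<circ> ci) (at x) i = frechet_derivative (f \<circ> ci) (at x) i + frechet_derivative (h \<circ> ci) (at x) i"
    if "x \<in> B" for x
    using frechet_derivative_at[OF has_derivative_add[OF chart_deriv[OF f(1) that] chart_deriv[OF f(2) that]]]
    by (simp add: o_def fun_eq_iff)
  then show "E i (f + h) = E i f + E i h"
    using f by (auto simp: E_def cutoff_def fun_eq_iff algebra_simps)
next
  fix k f assume f: "f \<in> F"
  have "frechet_derivative ((\<lambda>p. k * f p) \<circ> ci) (at x) i = k * frechet_derivative (f \<circ> ci) (at x) i"
    if "x \<in> B" for x
    using frechet_derivative_at[OF has_derivative_mult_right[OF chart_deriv[OF f that], of k]]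
    by (simp add: o_def fun_eq_iff)
  then show "E i (\<lambda>p. k * f p) = (\<lambda>p. k * E i f p)"
    using f by (auto simp: E_def cutoff_def fun_eq_iff)
next
  fix f h assume f: "f \<in> F" "h \<in> F"
  have "frechet_derivative ((f * h) \<circ> ci) (at x) i = f (ci x) * frechet_derivative (h \<circ> ci) (at x) i + frechet_derivative (f \<circ> ci) (at x) i * h (ci x)"
    if "x \<in> B" for x
    using frechet_derivative_at[OF has_derivative_mult[OF chart_deriv[OF f(1) that] chart_deriv[OF f(2) that]]]
    by (simp add: o_def fun_eq_iff)
  then show "E i (f * h) = f * E i h + h * E i f"
    using f by (auto simp: E_def cutoff_def fun_eq_iff algebra_simps)
qed (simp add: E_def)

text \<open>By the quotient rule this is \<open>b\<^sup>2\<close> times the derivative of the coordinate \<open>co i / b\<close>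
  along \<open>X\<close>, but it is smooth on the whole manifold.\<close>
definition frame_coeff :: "'a vfield \<Rightarrow> 'e \<Rightarrow> 'a \<Rightarrow> real" where
  "frame_coeff X i = b * X (co i) - co i * X b"

lemma frame_coeff_smooth [simp, intro]: "X \<in> V \<Longrightarrow> frame_coeff X i \<in> F"
  by (simp add: frame_coeff_def vf_app)

text \<open>The expansion \<open>X = \<Sum>\<^sub>i X(x\<^sub>i) \<partial>\<^sub>i\<close>, multiplied by \<open>b\<^sup>3\<close> to become global. At a point \<open>q\<close> with
  \<open>b q \<noteq> 0\<close> Hadamard's lemma writes \<open>b\<^sup>2 (f - f q)\<close> as a sum of products of globally smooth functions
  one factor of which vanishes at \<open>q\<close>, and the Leibniz rule for \<open>X\<close> does the rest.\<close>
lemma frame: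
  assumes X: "X \<in> V"
  shows "b q ^ 3 * X f q = (\<Sum>i\<in>Basis. frame_coeff X i q * E i f q)"
proof (cases "f \<in> F \<and> b q \<noteq> 0")
  case False
  then have "E i f q = 0" for i by (auto simp: E_def cutoff_b)
  then show ?thesis
    using False vf_nonsmooth[OF X, of f] by auto
next
  case True
  then have f: "f \<in> F" and q: "q \<in> U" "c q \<in> B" using b_neq by auto
  obtain G where G: "\<And>i. smooth_on B (G i)" "\<And>i. G i (c q) = frechet_derivative (f \<circ> ci) (at (c q)) i"
    "\<And>y. y \<in> B \<Longrightarrow> (f \<circ> ci) y = (f \<circ> ci) (c q) + (\<Sum>i\<in>Basis. ((y - c q) \<bullet> i) * G i y)"
    by (rule hadamard[OF open_ball convex_ball q(2) smooth_on_chart[OF f]], rule that; assumption)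
  define z where "z i = co i - (\<lambda>q'. (c q \<bullet> i)) * b" for i
  have z [simp]: "z i \<in> F" for i unfolding z_def by auto
  have zq [simp]: "z i q = 0" for i by (simp add: z_def co_def cutoff_b)
  have Gs [simp]: "cutoff (G i) \<in> F" for i by (rule cutoff_smooth[OF G(1)])
  have EG: "cutoff (G i) q = E i f q" for i using f by (simp add: E_def cutoff_b G(2))
  have eq: "b * b * (f - (\<lambda>q'. f q)) = (\<lambda>q'. \<Sum>i\<in>Basis. (cutoff (G i) * z i) q')"
  proof
    fix q' show "(b * b * (f - (\<lambda>q'. f q))) q' = (\<Sum>i\<in>Basis. (cutoff (G i) * z i) q')"
    proof (cases "b q' = 0")
      case True
      then show ?thesis by (simp add: cutoff_b)
    next
      case False
      then have "q' \<in> U" "c q' \<in> B" using b_neq by auto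
      then show ?thesis
        using G(3)[of "c q'"] q
        by (simp add: cutoff_b z_def co_def sum_distrib_left inner_diff_left algebra_simps)
    qed
  qed
  have "X (b * b * (f - (\<lambda>q'. f q))) q = b q * b q * X f q"
    using f by (simp add: vf_app_mult[OF X] vf_app_diff[OF X] vf_app_const[OF X])
  moreover have "X (\<lambda>q'. \<Sum>i\<in>Basis. (cutoff (G i) * z i) q') q = (\<Sum>i\<in>Basis. E i f q * X (z i) q)"
    using vf_app_sum[OF X, of Basis "\<lambda>i. cutoff (G i) * z i"]
    by (simp add: vf_app_mult[OF X] EG)
  moreover have "X (z i) q = X (co i) q - (c q \<bullet> i) * X b q" for i
    unfolding z_def by (simp add: vf_app_diff[OF X] vf_app_mult[OF X] vf_app_const[OF X])
  ultimately have "b q * b q * X f q = (\<Sum>i\<in>Basis. E i f q * (X (co i) q - (c q \<bullet> i) * X b q))"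
    by (simp add: eq)
  then have "b q * (b q * b q * X f q) = (\<Sum>i\<in>Basis. b q * (E i f q * (X (co i) q - (c q \<bullet> i) * X b q)))"
    by (simp add: sum_distrib_left)
  then show ?thesis
    by (simp add: frame_coeff_def co_def cutoff_b power3_eq_cube algebra_simps)
qed

text \<open>At the centre \<open>p\<close> the frame is dual, up to the factor \<open>b\<^sup>2\<close>, to the cut-off centred
  coordinates; hence it is linearly independent there.\<close>
lemma E_dual:
  assumes "i \<in> Basis" "j \<in> Basis"
  shows "E i (cutoff (\<lambda>x. (x - c p) \<bullet> j)) p = (if i = j then b p ^ 2 else 0)"
proof -
  let ?w = "\<lambda>x. (x - c p) \<bullet> j"
  have "smooth_on B ?w"
    using smooth_on_add[OF open_ball smooth_on_bounded_linear[OF bounded_linear_inner_left open_ball smooth_on_id] smooth_on_const, of _ _ j "- (c p \<bullet> j)"]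
    by (simp add: inner_diff_left)
  then have w: "cutoff ?w \<in> F" by (rule cutoff_smooth)
  have cp: "c p \<in> B" using r by simp
  have "(\<beta> has_derivative frechet_derivative \<beta> (at (c p))) (at (c p))"
    using smooth_on_has_derivative[OF bump_smooth open_UNIV] by simp
  moreover have "(?w has_derivative (\<lambda>v. v \<bullet> j)) (at (c p))"
    by (auto intro!: derivative_eq_intros)
  ultimately have "((\<lambda>x. \<beta> x * ?w x) has_derivative (\<lambda>v. \<beta> (c p) * (v \<bullet> j) + frechet_derivative \<beta> (at (c p)) v * ?w (c p))) (at (c p))"
    by (rule has_derivative_mult)
  then have *: "(cutoff ?w \<circ> ci has_derivative (\<lambda>v. \<beta> (c p) * (v \<bullet> j) + frechet_derivative \<beta> (at (c p)) v * ?w (c p))) (at (c p))"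
  proof (rule has_derivative_transform_within_open[OF _ open_ball cp])
    fix x assume "x \<in> B"
    moreover then obtain s where "s \<in> U" "x = c s" using ball by auto
    ultimately show "\<beta> x * ?w x = (cutoff ?w \<circ> ci) x" by (simp add: cutoff_def)
  qed
  have "frechet_derivative (cutoff ?w \<circ> ci) (at (c p)) i = \<beta> (c p) * (i \<bullet> j)"
    by (simp add: frechet_derivative_at[OF *, symmetric])
  then have "E i (cutoff ?w) p = b p * (\<beta> (c p) * (i \<bullet> j))" using w by (simp add: E_def cutoff_b)
  moreover have "\<beta> (c p) = b p" using p cp by (simp add: b_def cutoff_def)
  ultimately show ?thesis using assms by (simp add: inner_Basis power2_eq_square)
qed

end

text \<open>Linear algebra in one tangent space: \<open>\<Phi>\<close> is injective on \<open>ker e\<close> and anticommutes with \<open>\<Psi>\<close>, so it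
  maps each of the two eigenspaces of \<open>\<Psi>\<close> into the other one and their dimensions agree. They span
  \<open>ker e\<close>, which has dimension \<open>2 n\<close>.\<close>
lemma para_eigenspace_dims:
  fixes \<Psi> \<Phi> :: "'e::euclidean_space \<Rightarrow> 'e" and e :: "'e \<Rightarrow> real"
  assumes lin: "linear \<Psi>" "linear \<Phi>" "linear e" and z: "e z = 1"
    and \<Psi>: "\<And>x. \<Psi> (\<Psi> x) = x - e x *\<^sub>R z" "\<And>x. e (\<Psi> x) = 0"
    and \<Phi>: "\<And>x. \<Phi> (\<Phi> x) = - x + e x *\<^sub>R z" "\<And>x. e (\<Phi> x) = 0"
    and anti: "\<And>x. \<Phi> (\<Psi> x) = - \<Psi> (\<Phi> x)" and dim: "DIM('e) = 2 * n + 1"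
    and s: "s = 1 \<or> s = -1"
  shows "dim {x. e x = 0 \<and> \<Psi> x = s *\<^sub>R x} = n"
proof -
  let ?S = "\<lambda>s. {x. e x = 0 \<and> \<Psi> x = s *\<^sub>R x}" and ?K = "{x. e x = 0}"
  note simps = linear_add[OF lin(1)] linear_add[OF lin(2)] linear_add[OF lin(3)]
    linear_scale[OF lin(1)] linear_scale[OF lin(2)] linear_scale[OF lin(3)]
    linear_neg[OF lin(1)] linear_neg[OF lin(2)] linear_neg[OF lin(3)]
    linear_diff[OF lin(1)] linear_diff[OF lin(2)] linear_diff[OF lin(3)]
    linear_0[OF lin(1)] linear_0[OF lin(2)] linear_0[OF lin(3)]
  have sub: "subspace (?S s)" for s
    by (auto simp: subspace_def simps algebra_simps)
  have subK: "subspace ?K"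
    by (auto simp: subspace_def simps)
  have le: "dim (?S s) \<le> dim (?S (- s))" for s
  proof -
    have "inj_on \<Phi> (span (?S s))"
      unfolding span_eq_iff[THEN iffD2, OF sub] linear_inj_on_iff_eq_0[OF lin(2) sub]
    proof (intro ballI impI)
      fix x assume "x \<in> ?S s" "\<Phi> x = 0"
      then show "x = 0" using \<Phi>(1)[of x] by (simp add: simps)
    qed
    then have "dim (\<Phi> ` ?S s) = dim (?S s)" by (rule dim_image_eq[OF lin(2)])
    moreover have "\<Phi> ` ?S s \<subseteq> ?S (- s)"
    proof
      fix y assume "y \<in> \<Phi> ` ?S s"
      then obtain x where x: "\<Psi> x = s *\<^sub>R x" "y = \<Phi> x" by auto
      have "- \<Psi> y = s *\<^sub>R y" using anti[of x] x by (simp add: simps)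
      then have "\<Psi> y = - s *\<^sub>R y" by (metis add.inverse_inverse scaleR_left.minus)
      then show "y \<in> ?S (- s)" using x \<Phi>(2) by simp
    qed
    ultimately show ?thesis using dim_subset[of "\<Phi> ` ?S s" "?S (- s)"] by (simp only:)
  qed
  have eq: "dim (?S 1) = dim (?S (- 1))"
    using le[of 1] le[of "-1"] by (intro antisym) (simp_all only: minus_minus)
  have "?K = {x + y | x y. x \<in> ?S 1 \<and> y \<in> ?S (- 1)}"
  proof (intro equalityI subsetI)
    fix x assume x: "x \<in> ?K"
    have "x = (1/2) *\<^sub>R (x + \<Psi> x) + (1/2) *\<^sub>R (x - \<Psi> x)"
      by (simp add: scaleR_add_right scaleR_diff_right) (simp flip: scaleR_add_left)
    moreover have "(1/2) *\<^sub>R (x + \<Psi> x) \<in> ?S 1" "(1/2) *\<^sub>R (x - \<Psi> x) \<in> ?S (- 1)"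
      using x by (simp_all add: simps \<Psi> algebra_simps)
    ultimately show "x \<in> {x + y | x y. x \<in> ?S 1 \<and> y \<in> ?S (- 1)}" by blast
  qed (auto simp: simps)
  moreover have "?S 1 \<inter> ?S (- 1) = {0}"
  proof (intro equalityI subsetI)
    fix x assume "x \<in> ?S 1 \<inter> ?S (- 1)"
    then have "x = - x" by auto
    from arg_cong[OF this, of "\<lambda>y. x + y"] have "2 *\<^sub>R x = 0" by (simp only: scaleR_2 add.right_inverse)
    then show "x \<in> {0}" by simp
  qed (auto simp: simps)
  ultimately have K: "dim ?K = dim (?S 1) + dim (?S (- 1))"
    using dim_sums_Int[OF sub sub, of 1 "-1"] by simp
  have "(UNIV :: 'e set) = {x + y | x y. x \<in> ?K \<and> y \<in> span {z}}"
  proof (intro equalityI subsetI)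
    fix x :: 'e
    have "x = (x - e x *\<^sub>R z) + e x *\<^sub>R z" by simp
    moreover have "x - e x *\<^sub>R z \<in> ?K" using z by (simp add: simps)
    moreover have "e x *\<^sub>R z \<in> span {z}" by (simp add: span_base span_scale)
    ultimately show "x \<in> {x + y | x y. x \<in> ?K \<and> y \<in> span {z}}" by blast
  qed simp
  moreover have "?K \<inter> span {z} = {0}"
    using z by (auto simp: span_singleton simps)
  moreover have "dim (span {z}) = 1"
  proof -
    have "z \<noteq> 0" using z simps(15) by auto
    then show ?thesis by (simp add: dim_singleton)
  qed
  ultimately have "DIM('e) = dim ?K + 1"
    using dim_sums_Int[OF subK subspace_span, of "{z}"] by simp
  then show ?thesis using K eq dim s by auto
qed

context manifold begin

lemma vf_sum:
  assumes "\<And>i. i \<in> I \<Longrightarrow> f i \<in> F \<and> X i \<in> V"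
  shows "(\<lambda>k q. \<Sum>i\<in>I. f i q * X i k q) \<in> V \<and>
    (\<forall>\<omega>. one_form A \<omega> \<longrightarrow> \<omega> (\<lambda>k q. \<Sum>i\<in>I. f i q * X i k q) = (\<lambda>q. \<Sum>i\<in>I. f i q * \<omega> (X i) q))"
  using assms
proof (induction I rule: infinite_finite_induct)
  case (insert i I)
  have "(\<lambda>k q. \<Sum>j\<in>insert i I. f j q * X j k q) = f i \<odot> X i + (\<lambda>k q. \<Sum>j\<in>I. f j q * X j k q)"
    using insert by (simp add: fun_eq_iff)
  then show ?case using insert by (auto simp: one_form_rules)
next
  case (infinite I)
  then show ?case using vf_zero one_form_0 by (auto simp: zero_fun_def)
next
  case empty
  then show ?case using vf_zero one_form_0 by (auto simp: zero_fun_def)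
qed

lemma chart_at_exists: "\<exists>U c r. chart_at A U c p r"
proof -
  have "p \<in> (\<Union>(U, c)\<in>A. U)" using manifold by (simp add: smooth_manifold_def)
  then obtain U c where Uc: "(U, c) \<in> A" "p \<in> U" by auto
  have "open (c ` U)" using smooth_manifoldD[OF manifold Uc(1)] by simp
  then obtain e where "e > 0" "ball (c p) e \<subseteq> c ` U" using Uc(2) by (meson imageI open_contains_ball)
  then have "chart_at A U c p (e / 2)"
    by unfold_locales (use Uc in auto)
  then show ?thesis by blast
qed

end

context chart_at begin

text \<open>Tensoriality at a point: if \<open>X\<close> vanishes at \<open>p\<close>, so do all its frame coefficients, and \<open>\<omega>\<close> can be
  moved past them by linearity over smooth functions.\<close>
lemma one_form_at_p:
  assumes \<omega>: "one_form A \<omega>" and X: "X \<in> V" "vec_at X p = 0"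
  shows "\<omega> X p = 0"
proof -
  have "(b * b * b) \<odot> X = (\<lambda>k q. \<Sum>i\<in>Basis. frame_coeff X i q * E i k q)"
    by (simp add: fun_eq_iff frame[OF X(1), symmetric] power3_eq_cube)
  then have "\<omega> ((b * b * b) \<odot> X) = (\<lambda>q. \<Sum>i\<in>Basis. frame_coeff X i q * \<omega> (E i) q)"
    using vf_sum[of Basis "frame_coeff X" E] \<omega> X(1) by auto
  moreover have "\<omega> ((b * b * b) \<odot> X) = b * b * b * \<omega> X"
    using X(1) by (simp add: one_form_fmul[OF \<omega>])
  moreover have "frame_coeff X i p = 0" for i
    using X(2) by (simp add: frame_coeff_def vec_at_def fun_eq_iff)
  ultimately have "(b * b * b * \<omega> X) p = 0" by simp
  then show ?thesis using b_p by simp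
qed

text \<open>The identification of the model space with the tangent space at \<open>p\<close> by means of the frame, and
  a vector field \<open>field_of x\<close> that represents the tangent vector \<open>T_of x\<close> and depends linearly on \<open>x\<close>.\<close>
definition T_of :: "'e \<Rightarrow> ('a \<Rightarrow> real) \<Rightarrow> real" where
  "T_of x f = (\<Sum>i\<in>Basis. (x \<bullet> i) * E i f p)"

definition field_of :: "'e \<Rightarrow> 'a vfield" where
  "field_of x = (\<lambda>k q. \<Sum>i\<in>Basis. (\<lambda>q. x \<bullet> i) q * E i k q)"

lemma field_of_vf [simp, intro]: "field_of x \<in> V"
  unfolding field_of_def using vf_sum[of Basis "\<lambda>i q. x \<bullet> i" E] by auto

lemma vec_at_field_of: "vec_at (field_of x) p = T_of x"
  by (simp add: vec_at_def field_of_def T_of_def fun_eq_iff)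

lemma field_of_add: "field_of (x + y) = field_of x + field_of y"
  and field_of_scale: "field_of (k *\<^sub>R x) = k \<odot>\<^sub>R field_of x"
  by (simp_all add: field_of_def fun_eq_iff inner_add_left sum.distrib algebra_simps sum_distrib_left)

lemma T_of_add: "T_of (x + y) = T_of x + T_of y"
  and T_of_scale: "T_of (k *\<^sub>R x) = fscale k (T_of x)"
  by (simp_all add: T_of_def fscale_def fun_eq_iff inner_add_left sum.distrib algebra_simps sum_distrib_left)

lemma T_of_eq_0: "T_of x = 0 \<Longrightarrow> x = 0"
proof (rule euclidean_eqI)
  fix j :: 'e assume T: "T_of x = 0" and j: "j \<in> Basis"
  have "T_of x (cutoff (\<lambda>x. (x - c p) \<bullet> j)) = (\<Sum>i\<in>Basis. if i = j then (x \<bullet> i) * b p ^ 2 else 0)"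
    unfolding T_of_def by (rule sum.cong) (use E_dual[OF _ j] in auto)
  then have "(x \<bullet> j) * b p ^ 2 = 0" using T j by simp
  then show "x \<bullet> j = 0 \<bullet> j" using b_p by simp
qed

lemma T_of_inj: "T_of x = T_of y \<Longrightarrow> x = y"
  using T_of_eq_0[of "x - y"] T_of_add[of "x - y" y] by simp

lemma T_of_surj:
  assumes X: "X \<in> V" obtains x where "vec_at X p = T_of x"
proof
  show "vec_at X p = T_of (\<Sum>i\<in>Basis. (frame_coeff X i p / b p ^ 3) *\<^sub>R i)"
  proof
    fix f
    have "b p ^ 3 * X f p = (\<Sum>i\<in>Basis. frame_coeff X i p * E i f p)" by (rule frame[OF X])
    then have "X f p = (\<Sum>i\<in>Basis. frame_coeff X i p * E i f p) / b p ^ 3"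
      using b_p by (simp add: field_simps)
    then show "vec_at X p f = T_of (\<Sum>i\<in>Basis. (frame_coeff X i p / b p ^ 3) *\<^sub>R i) f"
      by (simp add: vec_at_def T_of_def sum_divide_distrib)
  qed
qed

text \<open>The map \<open>T_of\<close> is linear and injective, so it carries bases to bases. This reduces dimensions in
  the space of functionals to dimensions in the Euclidean model space.\<close>
lemma fdim_T_of:
  assumes S: "subspace S"
  shows "fdim (T_of ` S) = dim S"
proof -
  interpret VP: vector_space_pair "scaleR :: real \<Rightarrow> 'e \<Rightarrow> 'e" "fscale :: real \<Rightarrow> (('a \<Rightarrow> real) \<Rightarrow> real) \<Rightarrow> _"
    ..
  have lin: "Vector_Spaces.linear scaleR fscale T_of"
    unfolding Vector_Spaces.linear_iff by (auto simp: T_of_add T_of_scale real_vector.vector_space_axioms fun_space.vector_space_axioms)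
  obtain B where B: "B \<subseteq> S" "independent B" "S \<subseteq> span B" "card B = dim S"
    using basis_exists[of S] by blast
  have inj: "inj T_of" using T_of_inj by (auto simp: inj_def)
  have "fun_space.dim (T_of ` S) = dim S"
  proof (rule fun_space.dim_unique)
    show "T_of ` B \<subseteq> T_of ` S" using B by auto
    show "fun_space.independent (T_of ` B)"
      using VP.linear_independent_injective_image[OF lin] B(2) inj_on_subset[OF inj subset_UNIV] unfolding dependent_raw_def by blast
    show "T_of ` S \<subseteq> fun_space.span (T_of ` B)"
      using VP.linear_span_image[OF lin, of B] B(3) unfolding span_raw_def by blast
    show "card (T_of ` B) = dim S"
      using B(4) card_image[OF inj_on_subset[OF inj subset_UNIV], of B] by simp
  qed
  then show ?thesis by (simp add: fdim_def)
qed

end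

context manifold begin

lemma one_form_at:
  assumes "one_form A \<omega>" "X \<in> V" "vec_at X p = 0"
  shows "\<omega> X p = 0"
proof -
  obtain U c r where "chart_at A U c p r" using chart_at_exists by blast
  then interpret chart_at A U c p r .
  show ?thesis by (rule one_form_at_p[OF assms])
qed

text \<open>For a fixed smooth function \<open>f\<close> the assignment \<open>X \<mapsto> (\<psi> X) f\<close> is a one-form.\<close>
lemma tensor_at:
  assumes \<psi>: "tensor11 A \<psi>" and X: "X \<in> V" "vec_at X p = 0"
  shows "vec_at (\<psi> X) p = 0"
proof
  fix f
  note [simp] = tensor11_rules[OF \<psi>]
  show "vec_at (\<psi> X) p f = 0 f"
  proof (cases "f \<in> F")
    case True
    have "one_form A (\<lambda>X. \<psi> X f)"
      unfolding one_form_def using True by (auto intro: vf_app)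
    from one_form_at[OF this X] show ?thesis by (simp add: vec_at_def)
  next
    case False
    then show ?thesis using vf_nonsmooth[of "\<psi> X" f] X by (simp add: vec_at_def)
  qed
qed

lemma one_form_at_cong:
  "one_form A \<omega> \<Longrightarrow> X \<in> V \<Longrightarrow> Y \<in> V \<Longrightarrow> vec_at X p = vec_at Y p \<Longrightarrow> \<omega> X p = \<omega> Y p"
  using one_form_at[of \<omega> "X - Y" p] one_form_diff[of \<omega> X Y] by (simp add: vec_at_def fun_eq_iff)

lemma tensor_at_cong:
  "tensor11 A \<psi> \<Longrightarrow> X \<in> V \<Longrightarrow> Y \<in> V \<Longrightarrow> vec_at X p = vec_at Y p \<Longrightarrow> vec_at (\<psi> X) p = vec_at (\<psi> Y) p"
  using tensor_at[of \<psi> "X - Y" p] tensor11_diff[of \<psi> X Y] by (simp add: vec_at_def fun_eq_iff)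

text \<open>Transport \<open>\<psi>\<close>, \<open>\<phi>\<close>, \<open>\<eta>\<close> and \<open>\<xi>\<close> to the model space, where the preceding linear algebra applies.\<close>
lemma fdim_eigenspace:
  assumes dim: "DIM('e) = 2 * n + 1" and \<psi>: "tensor11 A \<psi>" and \<phi>: "tensor11 A \<phi>" and \<eta>: "one_form A \<eta>"
    and \<xi>: "\<xi> \<in> V" "\<eta> \<xi> = 1"
    and psi: "\<And>X. X \<in> V \<Longrightarrow> \<psi> (\<psi> X) = X - \<eta> X \<odot> \<xi>" "\<And>X. X \<in> V \<Longrightarrow> \<eta> (\<psi> X) = 0"
    and phi: "\<And>X. X \<in> V \<Longrightarrow> \<phi> (\<phi> X) = - X + \<eta> X \<odot> \<xi>" "\<And>X. X \<in> V \<Longrightarrow> \<eta> (\<phi> X) = 0"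
    and anti: "\<And>X. X \<in> V \<Longrightarrow> \<phi> (\<psi> X) = - \<psi> (\<phi> X)"
    and s: "s = 1 \<or> s = -1"
  shows "fdim (eigenspace_at A \<psi> \<eta> s p) = n"
proof -
  obtain U c r where "chart_at A U c p r" using chart_at_exists by blast
  then interpret chart_at A U c p r .
  note [simp] = tensor11_rules[OF \<psi>] tensor11_rules[OF \<phi>] one_form_rules[OF \<eta>] \<xi>
  \<comment> \<open>The endomorphism of the model space that a tensor field \<open>\<theta>\<close> induces at \<open>p\<close>.\<close>
  define tens where "tens \<theta> x = (SOME y. vec_at (\<theta> (field_of x)) p = T_of y)" for \<theta> x
  have tens: "vec_at (\<theta> (field_of x)) p = T_of (tens \<theta> x)" if "tensor11 A \<theta>" for \<theta> x
  proof -
    have "\<exists>y. vec_at (\<theta> (field_of x)) p = T_of y"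
      using T_of_surj[OF tensor11_vf[OF that field_of_vf]] by metis
    then show ?thesis unfolding tens_def by (rule someI_ex)
  qed
  have tens_tens: "vec_at (\<theta> (\<rho> (field_of x))) p = T_of (tens \<theta> (tens \<rho> x))" if "tensor11 A \<theta>" "tensor11 A \<rho>" for \<theta> \<rho> x
    unfolding tens[OF that(1), symmetric]
    by (rule tensor_at_cong[OF that(1)]) (simp_all add: tensor11_vf[OF that(2)] tens[OF that(2)] vec_at_field_of)
  have lin: "linear (tens \<theta>)" if th: "tensor11 A \<theta>" for \<theta>
  proof (rule linearI; rule T_of_inj)
    fix x y k
    show "T_of (tens \<theta> (x + y)) = T_of (tens \<theta> x + tens \<theta> y)"
      unfolding T_of_add tens[OF th, symmetric] field_of_add
      by (simp add: tensor11_add[OF th] vec_at_def fun_eq_iff)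
    show "T_of (tens \<theta> (k *\<^sub>R x)) = T_of (k *\<^sub>R tens \<theta> x)"
      unfolding T_of_scale tens[OF th, symmetric] field_of_scale
      by (simp add: tensor11_cmul[OF th] vec_at_def fscale_def fun_eq_iff)
  qed
  let ?e = "\<lambda>x. \<eta> (field_of x) p"
  have eta: "\<eta> X p = ?e x" if "X \<in> V" "vec_at X p = T_of x" for X x
    by (rule one_form_at_cong[OF \<eta> that(1)]) (simp_all add: vec_at_field_of that(2))
  obtain z where z: "vec_at \<xi> p = T_of z" using T_of_surj[OF \<xi>(1)] by blast
  have vadd: "vec_at (X + Y) p = vec_at X p + vec_at Y p" "vec_at (X - Y) p = vec_at X p - vec_at Y p"
    "vec_at (- X) p = - vec_at X p" "vec_at (f \<odot> X) p = fscale (f p) (vec_at X p)" for X Y f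
    by (auto simp: vec_at_def fscale_def fun_eq_iff)
  have T_diff: "T_of (x - y) = T_of x - T_of y" "T_of (- x) = - T_of x" for x y
    using T_of_add[of "x - y" y] T_of_scale[of "-1" x] by (simp_all add: fscale_def fun_eq_iff)
  have sp: "dim {x. ?e x = 0 \<and> tens \<psi> x = s *\<^sub>R x} = n"
  proof (rule para_eigenspace_dims[where z = z])
    show "linear (tens \<psi>)" "linear (tens \<phi>)" using lin \<psi> \<phi> by auto
    show "linear ?e" by (rule linearI) (simp_all add: field_of_add field_of_scale)
    show "?e z = 1" using eta[OF \<xi>(1) z] \<xi>(2) by simp
    show "tens \<psi> (tens \<psi> x) = x - ?e x *\<^sub>R z" for x
      by (rule T_of_inj) (simp add: tens_tens[OF \<psi> \<psi>, symmetric] psi(1) vadd T_diff T_of_scale vec_at_field_of z)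
    show "tens \<phi> (tens \<phi> x) = - x + ?e x *\<^sub>R z" for x
      by (rule T_of_inj) (simp only: tens_tens[OF \<phi> \<phi>, symmetric] phi(1)[OF field_of_vf] vadd T_diff T_of_add T_of_scale vec_at_field_of z)
    show "tens \<phi> (tens \<psi> x) = - tens \<psi> (tens \<phi> x)" for x
      by (rule T_of_inj) (simp only: tens_tens[OF \<phi> \<psi>, symmetric] tens_tens[OF \<psi> \<phi>, symmetric] T_diff anti[OF field_of_vf] vadd)
    show "?e (tens \<psi> x) = 0" "?e (tens \<phi> x) = 0" for x
      using eta[of "\<psi> (field_of x)" "tens \<psi> x"] eta[of "\<phi> (field_of x)" "tens \<phi> x"]
      by (simp_all add: tens \<psi> \<phi> psi(2) phi(2))
  qed (use dim s in auto)
  have sub: "subspace {x. ?e x = 0 \<and> tens \<psi> x = s *\<^sub>R x}"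
    by (auto simp: subspace_def linear_0[OF lin[OF \<psi>]] linear_add[OF lin[OF \<psi>]] linear_scale[OF lin[OF \<psi>]]
      field_of_add field_of_scale algebra_simps) (simp add: field_of_def one_form_0[OF \<eta>, unfolded zero_fun_def])
  have "eigenspace_at A \<psi> \<eta> s p = T_of ` {x. ?e x = 0 \<and> tens \<psi> x = s *\<^sub>R x}"
  proof (intro equalityI subsetI)
    fix v assume "v \<in> eigenspace_at A \<psi> \<eta> s p"
    then obtain X where X: "v = vec_at X p" "X \<in> V" "\<eta> X p = 0" "vec_at (\<psi> X) p = fscale s (vec_at X p)"
      by (auto simp: eigenspace_at_def)
    obtain x where x: "vec_at X p = T_of x" using T_of_surj[OF X(2)] by blast
    have "vec_at (\<psi> X) p = vec_at (\<psi> (field_of x)) p"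
      by (rule tensor_at_cong[OF \<psi> X(2)]) (simp_all add: x vec_at_field_of)
    then have "T_of (tens \<psi> x) = T_of (s *\<^sub>R x)" using X(4) x by (simp add: tens[OF \<psi>] T_of_scale)
    then have "tens \<psi> x = s *\<^sub>R x" by (rule T_of_inj)
    then show "v \<in> T_of ` {x. ?e x = 0 \<and> tens \<psi> x = s *\<^sub>R x}"
      using X(1,3) eta[OF X(2) x] x by auto
  next
    fix v assume "v \<in> T_of ` {x. ?e x = 0 \<and> tens \<psi> x = s *\<^sub>R x}"
    then obtain x where "v = T_of x" "?e x = 0" "tens \<psi> x = s *\<^sub>R x" by auto
    then have "v = vec_at (field_of x) p" "\<eta> (field_of x) p = 0"
      "vec_at (\<psi> (field_of x)) p = fscale s (vec_at (field_of x) p)"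
      by (simp_all add: vec_at_field_of tens[OF \<psi>] T_of_scale)
    then show "v \<in> eigenspace_at A \<psi> \<eta> s p"
      unfolding eigenspace_at_def using field_of_vf by blast
  qed
  then show ?thesis using fdim_T_of[OF sub] sp by simp
qed

end

section \<open>Contact metric structures\<close>

text \<open>A Levi-Civita connection \<open>D\<close> is a parameter because the nullity condition provides one.\<close>
locale contact = manifold A
  for A :: "('a::{t2_space, second_countable_topology}, 'e::euclidean_space) atlas" +
  fixes n :: nat and \<phi> :: "'a vfield \<Rightarrow> 'a vfield" and \<xi> :: "'a vfield"
    and \<eta> :: "'a vfield \<Rightarrow> 'a \<Rightarrow> real" and g :: "'a vfield \<Rightarrow> 'a vfield \<Rightarrow> 'a \<Rightarrow> real"
    and D :: "'a vfield \<Rightarrow> 'a vfield \<Rightarrow> 'a vfield"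
  assumes contact: "contact_metric A n \<phi> \<xi> \<eta> g" and lc: "levi_civita A g D"
begin

lemma phi_tensor11: "tensor11 A \<phi>" and xi_vector_field [simp, intro]: "\<xi> \<in> V" and eta_one_form: "one_form A \<eta>"
  and phi_phi: "X \<in> V \<Longrightarrow> \<phi> (\<phi> X) = - X + \<eta> X \<odot> \<xi>"
  and eta_xi [simp]: "\<eta> \<xi> = 1"
  and g_phi_phi: "X \<in> V \<Longrightarrow> Y \<in> V \<Longrightarrow> g (\<phi> X) (\<phi> Y) = g X Y - \<eta> X * \<eta> Y"
  and deta: "X \<in> V \<Longrightarrow> Y \<in> V \<Longrightarrow> ext_deriv \<eta> X Y = g X (\<phi> Y)"
  and g_one_form: "X \<in> V \<Longrightarrow> one_form A (g X)"
  and g_sym: "X \<in> V \<Longrightarrow> Y \<in> V \<Longrightarrow> g X Y = g Y X"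
  and g_pos: "X \<in> V \<Longrightarrow> vec_at X p \<noteq> 0 \<Longrightarrow> g X X p > 0"
  using contact by (auto simp: contact_metric_def riemannian_metric_def symmetric_tensor02_def)

lemmas phi_rules [simp] = tensor11_rules[OF phi_tensor11]
lemmas eta_rules [simp] = one_form_rules[OF eta_one_form]
lemmas g_right [simp] = one_form_rules[OF g_one_form]

lemma g_left [simp]:
  "Z \<in> V \<Longrightarrow> X \<in> V \<Longrightarrow> Y \<in> V \<Longrightarrow> g (X + Y) Z = g X Z + g Y Z"
  "Z \<in> V \<Longrightarrow> f \<in> F \<Longrightarrow> X \<in> V \<Longrightarrow> g (f \<odot> X) Z = f * g X Z"
  "Z \<in> V \<Longrightarrow> X \<in> V \<Longrightarrow> g (c \<odot>\<^sub>R X) Z = (\<lambda>p. c) * g X Z"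
  "Z \<in> V \<Longrightarrow> X \<in> V \<Longrightarrow> g (- X) Z = - g X Z"
  "Z \<in> V \<Longrightarrow> X \<in> V \<Longrightarrow> Y \<in> V \<Longrightarrow> g (X - Y) Z = g X Z - g Y Z"
  "Z \<in> V \<Longrightarrow> g 0 Z = 0"
  by (simp_all add: g_sym[of _ Z])

lemma vf_eq_0I: "X \<in> V \<Longrightarrow> g X X = 0 \<Longrightarrow> X = 0"
proof (intro ext, goal_cases)
  case (1 k p)
  then have "vec_at X p = 0" using g_pos[of X p] by (auto simp: fun_eq_iff)
  then show ?case by (simp add: vec_at_def fun_eq_iff)
qed

text \<open>Equations between vector fields are tested against the metric; this turns tensor identities
  into scalar ones.\<close>
lemma vf_eqI:
  assumes "X \<in> V" "Y \<in> V" "\<And>Z. Z \<in> V \<Longrightarrow> g X Z = g Y Z"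
  shows "X = Y"
proof -
  have "X - Y = 0" by (rule vf_eq_0I) (use assms in simp_all)
  then show ?thesis by simp
qed

lemma D_aff: "affine_connection A D"
  and D_torsion: "X \<in> V \<Longrightarrow> Y \<in> V \<Longrightarrow> D X Y - D Y X = lie_bracket X Y"
  and D_metric: "X \<in> V \<Longrightarrow> Y \<in> V \<Longrightarrow> Z \<in> V \<Longrightarrow> X (g Y Z) = g (D X Y) Z + g Y (D X Z)"
  using lc by (auto simp: levi_civita_def)

lemma D_tensor11: "Y \<in> V \<Longrightarrow> tensor11 A (\<lambda>X. D X Y)"
  using D_aff by (simp add: affine_connection_def)

lemmas D_left [simp] = tensor11_rules[OF D_tensor11]

lemma D_right [simp]:
  assumes "X \<in> V"
  shows "Y \<in> V \<Longrightarrow> Z \<in> V \<Longrightarrow> D X (Y + Z) = D X Y + D X Z"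
    and "f \<in> F \<Longrightarrow> Y \<in> V \<Longrightarrow> D X (f \<odot> Y) = X f \<odot> Y + f \<odot> D X Y"
    and "Y \<in> V \<Longrightarrow> D X (c \<odot>\<^sub>R Y) = c \<odot>\<^sub>R D X Y"
    and "Y \<in> V \<Longrightarrow> D X (- Y) = - D X Y"
    and "Y \<in> V \<Longrightarrow> Z \<in> V \<Longrightarrow> D X (Y - Z) = D X Y - D X Z"
    and "D X 0 = 0"
proof -
  show add: "Y \<in> V \<Longrightarrow> Z \<in> V \<Longrightarrow> D X (Y + Z) = D X Y + D X Z" for Y Z
    using D_aff assms by (simp add: affine_connection_def)
  show f: "f \<in> F \<Longrightarrow> Y \<in> V \<Longrightarrow> D X (f \<odot> Y) = X f \<odot> Y + f \<odot> D X Y" for f Y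
    using D_aff assms by (simp add: affine_connection_def)
  show c: "D X (c \<odot>\<^sub>R Y) = c \<odot>\<^sub>R D X Y" if "Y \<in> V" for c Y
    using that assms by (simp add: cmul_eq_fmul f vf_app_const) (simp add: fun_eq_iff)
  show neg: "D X (- Y) = - D X Y" if "Y \<in> V" for Y
    using c[OF that, of "-1"] by (simp add: cmul_m1)
  show "D X (Y - Z) = D X Y - D X Z" if "Y \<in> V" "Z \<in> V" for Y Z
    using add[of Y "- Z"] neg[of Z] that by simp
  show "D X 0 = 0" using add[of 0 0] by simp
qed

text \<open>Skewness of \<open>\<phi>\<close> is skewness of \<open>d \<eta>\<close>. It gives \<open>g(\<xi>, \<phi> \<xi>) = 0\<close>, hence \<open>\<eta>(\<phi> \<xi>) = 0\<close> as \<open>\<phi>\<^sup>2 \<xi> = 0\<close>, and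
  then \<open>\<phi> \<xi> = - \<phi>\<^sup>2 (\<phi> \<xi>) = 0\<close>. Reading \<open>\<phi>\<^sup>3 X\<close> both as \<open>\<phi>\<^sup>2 (\<phi> X)\<close> and as \<open>\<phi> (\<phi>\<^sup>2 X)\<close> yields \<open>\<eta>(\<phi> X) = 0\<close>.\<close>
lemma eta_phi [simp]: "X \<in> V \<Longrightarrow> \<eta> (\<phi> X) = 0" and phi_xi [simp]: "\<phi> \<xi> = 0"
  and g_xi: "X \<in> V \<Longrightarrow> g X \<xi> = \<eta> X" and g_xi' [simp]: "X \<in> V \<Longrightarrow> g \<xi> X = \<eta> X"
  and phi_skew: "X \<in> V \<Longrightarrow> Y \<in> V \<Longrightarrow> g (\<phi> X) Y = - g X (\<phi> Y)"
proof -
  have skew: "g X (\<phi> Y) = - g Y (\<phi> X)" if "X \<in> V" "Y \<in> V" for X Y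
    using that arg_cong[OF bracket_swap[of X Y], of \<eta>]
    by (simp add: deta[symmetric] ext_deriv_def fun_eq_iff field_simps)
  show ps: "g (\<phi> X) Y = - g X (\<phi> Y)" if "X \<in> V" "Y \<in> V" for X Y
    using skew[OF that] that by (simp add: g_sym)
  have p0: "\<phi> (\<phi> \<xi>) = 0" using phi_phi[of \<xi>] by (simp add: fun_eq_iff)
  have "g \<xi> (\<phi> \<xi>) = 0" using skew[of \<xi> \<xi>] by (simp add: fun_eq_iff)
  moreover have "g (\<phi> \<xi>) (\<phi> (\<phi> \<xi>)) = g \<xi> (\<phi> \<xi>) - \<eta> \<xi> * \<eta> (\<phi> \<xi>)" by (rule g_phi_phi) auto
  ultimately have e0: "\<eta> (\<phi> \<xi>) = 0" by (simp add: p0)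
  have "\<phi> (\<phi> (\<phi> \<xi>)) = - \<phi> \<xi>" using phi_phi[of "\<phi> \<xi>"] by (simp add: e0 fun_eq_iff)
  then show px: "\<phi> \<xi> = 0" by (simp add: p0)
  show "\<eta> (\<phi> X) = 0" if "X \<in> V" for X
  proof -
    have "\<phi> (\<phi> (\<phi> X)) = - \<phi> X + \<eta> (\<phi> X) \<odot> \<xi>" using phi_phi[of "\<phi> X"] that by simp
    moreover have "\<phi> (\<phi> (\<phi> X)) = - \<phi> X" using that px by (simp add: phi_phi[OF that])
    ultimately have "\<eta> (\<phi> X) \<odot> \<xi> = 0" by simp
    then have "\<eta> (\<eta> (\<phi> X) \<odot> \<xi>) = 0" by simp
    then show ?thesis using that by simp
  qed
  show gx: "g X \<xi> = \<eta> X" if "X \<in> V" for X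
    using g_phi_phi[of X \<xi>] that by (simp add: px)
  show "g \<xi> X = \<eta> X" if "X \<in> V" for X
    using gx[OF that] that by (simp add: g_sym)
qed

text \<open>The covariant derivative \<open>(D\<^sub>X \<psi>) Y\<close>; it is tensorial in both arguments.\<close>
definition nab :: "('a vfield \<Rightarrow> 'a vfield) \<Rightarrow> 'a vfield \<Rightarrow> 'a vfield \<Rightarrow> 'a vfield" where
  "nab \<psi> X Y = D X (\<psi> Y) - \<psi> (D X Y)"

lemma nab_vf [simp]: "tensor11 A \<psi> \<Longrightarrow> X \<in> V \<Longrightarrow> Y \<in> V \<Longrightarrow> nab \<psi> X Y \<in> V"
  by (simp add: nab_def tensor11_vf)

lemma
  assumes \<psi>: "tensor11 A \<psi>"
  shows nab_tensor11: "X \<in> V \<Longrightarrow> tensor11 A (nab \<psi> X)"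
    and nab_left_tensor11: "Y \<in> V \<Longrightarrow> tensor11 A (\<lambda>X. nab \<psi> X Y)"
proof -
  note [simp] = tensor11_rules[OF \<psi>]
  show "tensor11 A (nab \<psi> X)" if X: "X \<in> V"
    by (rule tensor11I; simp add: nab_def X vf_app[OF X]) (simp_all add: fun_eq_iff algebra_simps)
  show "tensor11 A (\<lambda>X. nab \<psi> X Y)" if "Y \<in> V"
    by (rule tensor11I; simp add: nab_def that) (simp_all add: fun_eq_iff algebra_simps)
qed

text \<open>Covariant differentiation respects adjoints because \<open>D\<close> is metric.\<close>
lemma nab_adjoint:
  assumes \<psi>: "tensor11 A \<psi>" and \<theta>: "tensor11 A \<theta>"
    and adj: "\<And>Y Z. Y \<in> V \<Longrightarrow> Z \<in> V \<Longrightarrow> g (\<psi> Y) Z = g Y (\<theta> Z)"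
    and X: "X \<in> V" and Y: "Y \<in> V" and Z: "Z \<in> V"
  shows "g (nab \<psi> X Y) Z = g Y (nab \<theta> X Z)"
proof -
  note r [simp] = tensor11_vf[OF \<psi>] tensor11_vf[OF \<theta>] X Y Z
  have "X (g (\<psi> Y) Z) = X (g Y (\<theta> Z))" by (simp add: adj)
  then have "g (D X (\<psi> Y)) Z + g (\<psi> Y) (D X Z) = g (D X Y) (\<theta> Z) + g Y (D X (\<theta> Z))"
    by (simp add: D_metric[OF X])
  then have "g (D X (\<psi> Y)) Z + g Y (\<theta> (D X Z)) = g (\<psi> (D X Y)) Z + g Y (D X (\<theta> Z))"
    by (simp add: adj)
  then show ?thesis by (simp add: nab_def algebra_simps)
qed

lemma tensor11_uminus: "tensor11 A \<psi> \<Longrightarrow> tensor11 A (\<lambda>X. - \<psi> X)"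
  by (rule tensor11I; simp add: tensor11_rules[of \<psi>]) (simp add: fun_eq_iff)

lemma nab_phi_skew: "X \<in> V \<Longrightarrow> Y \<in> V \<Longrightarrow> Z \<in> V \<Longrightarrow> g (nab \<phi> X Y) Z = - g Y (nab \<phi> X Z)"
  using nab_adjoint[OF phi_tensor11 tensor11_uminus[OF phi_tensor11], of X Y Z]
  by (simp add: phi_skew nab_def algebra_simps)

lemma app_eta: "X \<in> V \<Longrightarrow> Y \<in> V \<Longrightarrow> X (\<eta> Y) = \<eta> (D X Y) + g Y (D X \<xi>)"
  using D_metric[of X Y \<xi>] by (simp add: g_xi)

lemma eta_Dxi [simp]: "X \<in> V \<Longrightarrow> \<eta> (D X \<xi>) = 0"
  using app_eta[of X \<xi>] by (simp add: vf_app_1 g_xi fun_eq_iff)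

text \<open>As \<open>\<eta>\<close> is the metric dual of \<open>\<xi>\<close>, \<open>d \<eta>\<close> is the skew part of \<open>D \<xi>\<close>.\<close>
lemma dual_Dxi: "X \<in> V \<Longrightarrow> Y \<in> V \<Longrightarrow> (\<lambda>p. 2) * g X (\<phi> Y) = g (D X \<xi>) Y - g (D Y \<xi>) X"
  using deta[of X Y] app_eta[of X Y] app_eta[of Y X] D_torsion[of X Y, symmetric]
  by (simp add: ext_deriv_def fun_eq_iff g_sym algebra_simps)

lemma D_xi_xi [simp]: "D \<xi> \<xi> = 0"
proof (rule vf_eqI)
  fix Z assume "Z \<in> V"
  then show "g (D \<xi> \<xi>) Z = g 0 Z"
    using dual_Dxi[of \<xi> Z] by (simp add: g_xi)
qed auto

text \<open>The fundamental two-form \<open>g(X, \<phi> Y) = d \<eta>(X, Y)\<close> is closed, and for a torsion-free connection the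
  exterior derivative of a two-form is the cyclic sum of its covariant derivative.\<close>
lemma nab_phi_cyclic:
  assumes [simp]: "X \<in> V" "Y \<in> V" "Z \<in> V"
  shows "g (nab \<phi> X Y) Z + g (nab \<phi> Y Z) X + g (nab \<phi> Z X) Y = 0"
proof -
  have e: "X (g Y (\<phi> Z)) = g (D X Y) (\<phi> Z) + g (D X Z) (- \<phi> Y) - g (nab \<phi> X Y) Z"
    if [simp]: "X \<in> V" "Y \<in> V" "Z \<in> V" for X Y Z
  proof -
    have "g (nab \<phi> X Y) Z = - g Y (nab \<phi> X Z)" by (simp add: nab_phi_skew)
    moreover have "g (D X Z) (\<phi> Y) = - g Y (\<phi> (D X Z))"
      using phi_skew[of "D X Z" Y] by (simp add: g_sym)
    ultimately show ?thesis by (simp add: D_metric[OF that(1)]) (simp add: nab_def algebra_simps)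
  qed
  have b: "g (lie_bracket X Y) (\<phi> Z) = g (D X Y) (\<phi> Z) - g (D Y X) (\<phi> Z)"
    if "X \<in> V" "Y \<in> V" "Z \<in> V" for X Y Z
    using that by (simp add: D_torsion[symmetric])
  have "X (g Y (\<phi> Z)) + Y (g Z (\<phi> X)) + Z (g X (\<phi> Y)) =
    g (lie_bracket X Y) (\<phi> Z) + g (lie_bracket Y Z) (\<phi> X) + g (lie_bracket Z X) (\<phi> Y)"
    using ext_deriv_closed[OF eta_one_form, of X Y Z] by (simp add: deta)
  then show ?thesis
    by (simp add: e[OF assms] e[OF assms(2,3,1)] e[OF assms(3,1,2)] b fun_eq_iff algebra_simps)
qed

text \<open>The derivative of \<open>\<phi>\<^sup>2 = - I + \<eta> \<otimes> \<xi>\<close>: on the horizontal part \<open>D\<^sub>X \<phi>\<close> anticommutes with \<open>\<phi>\<close>.\<close>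
lemma nab_phi_phi:
  "X \<in> V \<Longrightarrow> Y \<in> V \<Longrightarrow> nab \<phi> X (\<phi> Y) + \<phi> (nab \<phi> X Y) = g Y (D X \<xi>) \<odot> \<xi> + \<eta> Y \<odot> D X \<xi>"
  by (simp add: nab_def phi_phi app_eta) (simp add: fun_eq_iff algebra_simps)

lemma nab_phi_xi: "X \<in> V \<Longrightarrow> nab \<phi> X \<xi> = - \<phi> (D X \<xi>)"
  by (simp add: nab_def)

abbreviation h :: "'a vfield \<Rightarrow> 'a vfield" where "h \<equiv> half_lie \<xi> \<phi>"

lemma h_tensor11: "tensor11 A h"
  by (rule half_lie_tensor11[OF xi_vector_field phi_tensor11])

lemmas h_rules [simp] = tensor11_rules[OF h_tensor11]

lemma
  (* The skew part of X \<mapsto> D\<^sub>X \<xi> is - \<phi> by dual_Dxi; let - s be the symmetric part. Closedness of the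
     fundamental form evaluates D\<^sub>\<xi> \<phi> = s \<phi> + \<phi> s. As D\<^sub>\<xi> \<phi> anticommutes with \<phi>, this forces \<phi> s \<phi> = s,
     that is s \<phi> = - \<phi> s; hence D\<^sub>\<xi> \<phi> = 0, and the Lie derivative defining h reduces to - \<phi> s. *)
  shows nab_phi_xi_dir [simp]: "X \<in> V \<Longrightarrow> nab \<phi> \<xi> X = 0"
    and D_xi: "X \<in> V \<Longrightarrow> D X \<xi> = - \<phi> X - \<phi> (h X)"
    and h_sym: "X \<in> V \<Longrightarrow> Y \<in> V \<Longrightarrow> g (h X) Y = g X (h Y)"
    and h_phi: "X \<in> V \<Longrightarrow> h (\<phi> X) = - \<phi> (h X)"
    and h_xi [simp]: "h \<xi> = 0"
    and eta_h [simp]: "X \<in> V \<Longrightarrow> \<eta> (h X) = 0"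
proof -
  define s where "s X = - \<phi> X - D X \<xi>" for X
  have s_t11: "tensor11 A s"
    by (rule tensor11I) (simp_all add: s_def, simp_all add: fun_eq_iff algebra_simps)
  note [simp] = tensor11_rules[OF s_t11]
  have A: "D X \<xi> = - \<phi> X - s X" for X by (simp add: s_def)
  have s_sym: "g (s X) Y = g X (s Y)" if [simp]: "X \<in> V" "Y \<in> V" for X Y
    using dual_Dxi[of X Y] phi_skew[of X Y] phi_skew[of Y X] g_sym[of X "\<phi> Y"] g_sym[of X "D Y \<xi>"]
    by (simp add: s_def fun_eq_iff algebra_simps)
  have s_xi [simp]: "s \<xi> = 0" by (simp add: s_def)
  have eta_s [simp]: "\<eta> (s X) = 0" if [simp]: "X \<in> V" for X by (simp add: s_def)
  have T: "nab \<phi> \<xi> X = s (\<phi> X) + \<phi> (s X)" if X[simp]: "X \<in> V" for X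
  proof (rule vf_eqI)
    fix Z assume Z[simp]: "Z \<in> V"
    have "g (nab \<phi> \<xi> X) Z + g (nab \<phi> X Z) \<xi> + g (nab \<phi> Z \<xi>) X = 0"
      by (rule nab_phi_cyclic) auto
    moreover have "g (nab \<phi> X Z) \<xi> = g Z (\<phi> (D X \<xi>))"
      by (simp add: nab_phi_skew nab_phi_xi phi_tensor11)
    ultimately have e: "g (nab \<phi> \<xi> X) Z = g X (\<phi> (D Z \<xi>)) - g Z (\<phi> (D X \<xi>))"
      by (simp add: nab_phi_xi g_sym[of X] fun_eq_iff algebra_simps)
    have "g X (\<phi> (s Z)) = - g (s (\<phi> X)) Z" using phi_skew[of X "s Z"] by (simp add: s_sym)
    moreover have "g Z (\<phi> (s X)) = g (\<phi> (s X)) Z" by (simp add: g_sym)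
    ultimately show "g (nab \<phi> \<xi> X) Z = g (s (\<phi> X) + \<phi> (s X)) Z"
      by (simp add: e A phi_phi g_xi g_sym[of X Z] fun_eq_iff algebra_simps)
  qed (auto simp: phi_tensor11)
  have psp: "\<phi> (s (\<phi> X)) = s X" if [simp]: "X \<in> V" for X
  proof -
    have "nab \<phi> \<xi> (\<phi> X) + \<phi> (nab \<phi> \<xi> X) = 0" using nab_phi_phi[of \<xi> X] by simp
    then show ?thesis by (simp add: T phi_phi) (simp add: fun_eq_iff algebra_simps)
  qed
  have anti: "s (\<phi> X) = - \<phi> (s X)" if [simp]: "X \<in> V" for X
  proof -
    have "- s (\<phi> X) = \<phi> (s X)" using arg_cong[OF psp[of X], of \<phi>] by (simp add: phi_phi)
    then show ?thesis by (metis minus_minus)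
  qed
  show T0: "nab \<phi> \<xi> X = 0" if "X \<in> V" for X using that by (simp add: T anti)
  have h: "h X = - \<phi> (s X)" if [simp]: "X \<in> V" for X
  proof -
    have "h X = (1/2) \<odot>\<^sub>R (nab \<phi> \<xi> X - D (\<phi> X) \<xi> + \<phi> (D X \<xi>))"
      unfolding half_lie_def lie_deriv11_def nab_def by (simp add: D_torsion[symmetric] algebra_simps)
    then show ?thesis by (simp add: T0 A anti) (simp add: fun_eq_iff)
  qed
  show "D X \<xi> = - \<phi> X - \<phi> (h X)" if [simp]: "X \<in> V" for X
    by (simp add: A h phi_phi)
  show "g (h X) Y = g X (h Y)" if [simp]: "X \<in> V" "Y \<in> V" for X Y
    using phi_skew[of "s X" Y] s_sym[of X "\<phi> Y"] by (simp add: h anti)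
  show "h (\<phi> X) = - \<phi> (h X)" if [simp]: "X \<in> V" for X by (simp add: h anti)
  show "h \<xi> = 0" by (simp add: h)
  show "\<eta> (h X) = 0" if "X \<in> V" for X using that by (simp add: h)
qed

text \<open>Differentiate \<open>D\<^sub>Y \<xi> = - \<phi> Y - \<phi> h Y\<close> once more.\<close>
lemma curv_xi:
  assumes [simp]: "X \<in> V" "Y \<in> V"
  shows "curvature D X Y \<xi> = - nab \<phi> X Y + nab \<phi> Y X - nab (\<lambda>X. \<phi> (h X)) X Y + nab (\<lambda>X. \<phi> (h X)) Y X"
  by (simp add: curvature_def D_xi D_torsion[symmetric] nab_def)

lemma curv_xi_xi:
  assumes [simp]: "X \<in> V"
  shows "curvature D \<xi> X \<xi> = - \<phi> (nab h \<xi> X) + \<phi> (\<phi> X) + h (h X)"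
proof -
  have "D \<xi> (\<phi> X) = \<phi> (D \<xi> X)" using nab_phi_xi_dir[of X] by (simp add: nab_def)
  moreover have "D \<xi> (\<phi> (h X)) = \<phi> (D \<xi> (h X))" using nab_phi_xi_dir[of "h X"] by (simp add: nab_def)
  ultimately show ?thesis
    by (simp add: curvature_def D_xi D_torsion[symmetric] nab_def h_phi phi_phi)
qed

end

section \<open>The nullity condition\<close>

locale kappa_mu = contact A n \<phi> \<xi> \<eta> g D
  for A :: "('a::{t2_space, second_countable_topology}, 'e::euclidean_space) atlas"
    and n \<phi> \<xi> \<eta> g D +
  fixes \<kappa> \<mu> :: real
  assumes nullity: "X \<in> vector_fields A \<Longrightarrow> Y \<in> vector_fields A \<Longrightarrow>
    curvature D X Y \<xi> = \<kappa> \<odot>\<^sub>R (\<eta> Y \<odot> X - \<eta> X \<odot> Y) + \<mu> \<odot>\<^sub>R (\<eta> Y \<odot> half_lie \<xi> \<phi> X - \<eta> X \<odot> half_lie \<xi> \<phi> Y)"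
begin

text \<open>The nullity condition on the pair \<open>(\<xi>, X)\<close>, split into the part that commutes with \<open>\<phi>\<close> (the
  terms in \<open>\<phi>\<^sup>2\<close> and \<open>h\<^sup>2\<close>) and the part that anticommutes with it (the terms in \<open>h\<close> and \<open>D\<^sub>\<xi> h\<close>). The
  former gives \<open>h\<^sup>2\<close>, the latter \<open>D\<^sub>\<xi> h\<close>.\<close>
lemma h_h: "X \<in> V \<Longrightarrow> h (h X) = (1 - \<kappa>) \<odot>\<^sub>R (X - \<eta> X \<odot> \<xi>)"
  and nab_h_xi_dir: "X \<in> V \<Longrightarrow> nab h \<xi> X = - (\<mu> \<odot>\<^sub>R \<phi> (h X))"
proof -
  have R: "- \<phi> (nab h \<xi> X) + \<phi> (\<phi> X) + h (h X) = \<kappa> \<odot>\<^sub>R (\<phi> (\<phi> X)) - \<mu> \<odot>\<^sub>R (h X)" if [simp]: "X \<in> V" for X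
    using nullity[of \<xi> X] by (simp add: curv_xi_xi phi_phi) (simp add: fun_eq_iff algebra_simps)
  have eh: "\<eta> (nab h \<xi> X) = 0" if [simp]: "X \<in> V" for X
    using nab_adjoint[OF h_tensor11 h_tensor11 h_sym, of \<xi> X \<xi>] by (simp add: g_xi h_tensor11 nab_def)
  have anti: "nab h \<xi> (\<phi> X) = - \<phi> (nab h \<xi> X)" if [simp]: "X \<in> V" for X
    using nab_phi_xi_dir[of X] nab_phi_xi_dir[of "h X"]
    by (simp add: nab_def h_phi)
  have *: "h (h X) = (\<kappa> - 1) \<odot>\<^sub>R \<phi> (\<phi> X) \<and> \<phi> (nab h \<xi> X) = \<mu> \<odot>\<^sub>R h X" if [simp]: "X \<in> V" for X
  proof -
    \<comment> \<open>Conjugation of \<open>R\<close> with \<open>\<phi>\<close>. Adding the result to \<open>R\<close> and subtracting it separates the parts.\<close>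
    have "\<phi> (- \<phi> (nab h \<xi> (\<phi> X)) + \<phi> (\<phi> (\<phi> X)) + h (h (\<phi> X))) = \<phi> (\<kappa> \<odot>\<^sub>R (\<phi> (\<phi> (\<phi> X))) - \<mu> \<odot>\<^sub>R (h (\<phi> X)))"
      by (simp only: R[of "\<phi> X"] phi_rules that)
    then have "- \<phi> (nab h \<xi> X) - \<phi> (\<phi> X) - h (h X) = - (\<kappa> \<odot>\<^sub>R (\<phi> (\<phi> X))) - \<mu> \<odot>\<^sub>R (h X)"
      by (simp add: anti h_phi phi_phi h_tensor11 eh) (simp add: fun_eq_iff algebra_simps)
    note E1 = fun_cong[OF fun_cong[OF this]] and E2 = fun_cong[OF fun_cong[OF R[of X]]]
    show ?thesis
      by (intro conjI ext; use E1 E2 in \<open>simp add: algebra_simps\<close>; smt (verit) E1 E2)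
  qed
  show "h (h X) = (1 - \<kappa>) \<odot>\<^sub>R (X - \<eta> X \<odot> \<xi>)" if [simp]: "X \<in> V" for X
    using *[of X] by (simp add: phi_phi fun_eq_iff algebra_simps)
  show "nab h \<xi> X = - (\<mu> \<odot>\<^sub>R \<phi> (h X))" if [simp]: "X \<in> V" for X
  proof -
    have "- nab h \<xi> X = \<mu> \<odot>\<^sub>R \<phi> (h X)"
      using arg_cong[OF conjunct2[OF *[of X]], of \<phi>] by (simp add: phi_phi h_tensor11 eh)
    then show ?thesis by (metis minus_minus)
  qed
qed

end

context contact
begin

lemma g_nonneg: "X \<in> V \<Longrightarrow> g X X p \<ge> 0"
  using g_pos[of X p] one_form_at[OF g_one_form, of X X p] by (cases "vec_at X p = 0") auto

text \<open>For a torsion-free connection the brackets become covariant derivatives, and the terms in which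
  no derivative falls on \<open>\<psi>\<close> cancel.\<close>
lemma nijenhuis_nab:
  assumes \<psi>: "tensor11 A \<psi>" and [simp]: "X \<in> V" "Y \<in> V"
  shows "nijenhuis \<psi> X Y = nab \<psi> (\<psi> X) Y - nab \<psi> (\<psi> Y) X + \<psi> (nab \<psi> Y X) - \<psi> (nab \<psi> X Y)"
proof -
  note [simp] = tensor11_rules[OF \<psi>]
  show ?thesis
    by (simp add: nijenhuis_def nab_def D_torsion[symmetric])
qed

lemma sasakian_if_nab:
  assumes T: "\<And>X Y. X \<in> V \<Longrightarrow> Y \<in> V \<Longrightarrow> nab \<phi> X Y = g X Y \<odot> \<xi> - \<eta> Y \<odot> X"
  shows "sasakian A n \<phi> \<xi> \<eta> g"
proof -
  have "nijenhuis \<phi> X Y + 2 \<odot>\<^sub>R (ext_deriv \<eta> X Y \<odot> \<xi>) = 0" if [simp]: "X \<in> V" "Y \<in> V" for X Y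
    using phi_skew[of X Y] phi_skew[of Y X]
    by (simp add: nijenhuis_nab[OF phi_tensor11] T deta g_sym[of Y X])
      (simp add: fun_eq_iff g_sym[of Y "\<phi> X"] algebra_simps)
  then show ?thesis using contact by (simp add: sasakian_def)
qed

lemma sasakian_if_phi_0:
  assumes T: "\<And>X. X \<in> V \<Longrightarrow> \<phi> X = 0"
  shows "sasakian A n \<phi> \<xi> \<eta> g"
proof -
  have "nijenhuis \<phi> X Y + 2 \<odot>\<^sub>R (ext_deriv \<eta> X Y \<odot> \<xi>) = 0" if [simp]: "X \<in> V" "Y \<in> V" for X Y
    by (simp add: nijenhuis_def T deta) (simp add: lie_bracket_def fun_eq_iff)
  then show ?thesis using contact by (simp add: sasakian_def)
qed

end

context kappa_mu
begin

text \<open>For \<open>\<kappa> > 1\<close> one has \<open>|h \<phi> X|\<^sup>2 = (1 - \<kappa>) |\<phi> X|\<^sup>2\<close>, whose two sides have opposite signs unless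
  \<open>\<phi> X = 0\<close>. For \<open>\<kappa> = 1\<close> the tensor \<open>h\<close> vanishes, and closedness of the fundamental form turns the
  nullity condition into the formula for \<open>D \<phi>\<close> that characterises Sasakian structures.\<close>
lemma kappa_lt_1:
  assumes "\<not> sasakian A n \<phi> \<xi> \<eta> g"
  shows "\<kappa> < 1"
proof (rule ccontr)
  assume "\<not> \<kappa> < 1"
  then consider "\<kappa> > 1" | "\<kappa> = 1" by linarith
  then show False
  proof cases
    case 1
    have "\<phi> X = 0" if [simp]: "X \<in> V" for X
    proof (rule ext, rule ext, rule ccontr)
      fix k p assume "\<phi> X k p \<noteq> 0 k p"
      then have "vec_at (\<phi> X) p \<noteq> 0" by (auto simp: vec_at_def fun_eq_iff)
      then have pos: "g (\<phi> X) (\<phi> X) p > 0" using g_pos by simp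
      have "g (h (\<phi> X)) (h (\<phi> X)) p = (1 - \<kappa>) * g (\<phi> X) (\<phi> X) p"
        by (simp add: h_sym h_h)
      moreover have "(1 - \<kappa>) * g (\<phi> X) (\<phi> X) p < 0" using 1 pos by (simp add: mult_neg_pos)
      ultimately show False using g_nonneg[of "h (\<phi> X)" p] by simp
    qed
    then show False using sasakian_if_phi_0 assms by blast
  next
    case 2
    have h0: "h X = 0" if [simp]: "X \<in> V" for X
    proof (rule vf_eq_0I)
      show "g (h X) (h X) = 0" using 2 by (simp add: h_sym h_h fun_eq_iff)
    qed simp
    have "nab \<phi> Z X = g Z X \<odot> \<xi> - \<eta> X \<odot> Z" if [simp]: "Z \<in> V" "X \<in> V" for X Z
    proof (rule vf_eqI)
      fix Y assume [simp]: "Y \<in> V"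
      have "- nab \<phi> X Y + nab \<phi> Y X = \<eta> Y \<odot> X - \<eta> X \<odot> Y"
        using curv_xi[of X Y] nullity[of X Y] 2 by (simp add: h0 nab_def fun_eq_iff)
      then have "g (- nab \<phi> X Y + nab \<phi> Y X) Z = g (\<eta> Y \<odot> X - \<eta> X \<odot> Y) Z" by simp
      from fun_cong[OF this]
      have 1: "- g (nab \<phi> X Y) Z p + g (nab \<phi> Y X) Z p = \<eta> Y p * g X Z p - \<eta> X p * g Y Z p" for p
        by (simp add: phi_tensor11)
      have "g (nab \<phi> X Y) Z + g (nab \<phi> Y Z) X + g (nab \<phi> Z X) Y = 0"
        by (rule nab_phi_cyclic) auto
      from fun_cong[OF this]
      have 2: "g (nab \<phi> X Y) Z p + g (nab \<phi> Y Z) X p + g (nab \<phi> Z X) Y p = 0" for p by simp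
      have "g (nab \<phi> Y Z) X = - g (nab \<phi> Y X) Z"
        by (simp add: nab_phi_skew g_sym[of Z] phi_tensor11)
      then have 3: "g (nab \<phi> Y Z) X p = - g (nab \<phi> Y X) Z p" for p by simp
      have 4: "g X Z p = g Z X p" "g Y Z p = g Z Y p" for p by (simp_all add: g_sym)
      show "g (nab \<phi> Z X) Y = g (g Z X \<odot> \<xi> - \<eta> X \<odot> Z) Y"
      proof
        fix p show "g (nab \<phi> Z X) Y p = g (g Z X \<odot> \<xi> - \<eta> X \<odot> Z) Y p"
          using 1[of p] 2[of p] 3[of p] by (simp add: 4) (simp add: algebra_simps)
      qed
    qed (auto simp: phi_tensor11)
    then show False using sasakian_if_nab assms by blast
  qed
qed

end

section \<open>Covariant derivatives of the structure tensors\<close>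

locale nonsasakian_kappa_mu = kappa_mu A n \<phi> \<xi> \<eta> g D \<kappa> \<mu>
  for A :: "('a::{t2_space, second_countable_topology}, 'e::euclidean_space) atlas"
    and n \<phi> \<xi> \<eta> g D \<kappa> \<mu> +
  assumes kappa: "\<kappa> < 1"
begin

definition lam :: real where "lam = sqrt (1 - \<kappa>)"

lemma lam_pos [simp]: "lam > 0" and lam_neq [simp]: "lam \<noteq> 0" and lam2: "1 - \<kappa> = lam * lam"
  using kappa by (auto simp: lam_def)

abbreviation P :: "'a vfield \<Rightarrow> 'a vfield" where "P \<equiv> std1 \<kappa> \<phi> \<xi>"

lemma P_def: "P X = (1 / lam) \<odot>\<^sub>R \<phi> (h X)"
  by (simp add: std1_def lam_def)

lemma h_h_lam: "X \<in> V \<Longrightarrow> h (h X) = (lam * lam) \<odot>\<^sub>R (X - \<eta> X \<odot> \<xi>)"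
  by (simp add: h_h lam2)

lemma P_tensor11: "tensor11 A P"
  by (rule tensor11I) (simp_all add: P_def, simp_all add: fun_eq_iff algebra_simps)

lemmas P_rules [simp] = tensor11_rules[OF P_tensor11]

lemma P_xi [simp]: "P \<xi> = 0" and eta_P [simp]: "X \<in> V \<Longrightarrow> \<eta> (P X) = 0"
  and P_sym: "X \<in> V \<Longrightarrow> Y \<in> V \<Longrightarrow> g (P X) Y = g X (P Y)"
  and P_phi: "X \<in> V \<Longrightarrow> P (\<phi> X) = - \<phi> (P X)"
  and P_P: "X \<in> V \<Longrightarrow> P (P X) = X - \<eta> X \<odot> \<xi>"
  and phi_h: "X \<in> V \<Longrightarrow> \<phi> (h X) = lam \<odot>\<^sub>R P X"
proof -
  show "P \<xi> = 0" by (simp add: P_def)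
  show "\<eta> (P X) = 0" if "X \<in> V" for X using that by (simp add: P_def)
  show "g (P X) Y = g X (P Y)" if [simp]: "X \<in> V" "Y \<in> V" for X Y
  proof -
    have "g (\<phi> (h X)) Y = g X (\<phi> (h Y))"
      using phi_skew[of "h X" Y] h_sym[of X "\<phi> Y"] by (simp add: h_phi)
    then show ?thesis by (simp add: P_def)
  qed
  show "P (\<phi> X) = - \<phi> (P X)" if "X \<in> V" for X
    using that by (simp add: P_def h_phi) (simp add: fun_eq_iff)
  show "\<phi> (h X) = lam \<odot>\<^sub>R P X" if "X \<in> V" for X
    by (simp add: P_def fun_eq_iff)
  show "P (P X) = X - \<eta> X \<odot> \<xi>" if "X \<in> V" for X
    using that by (simp add: P_def h_phi phi_phi h_h_lam) (simp add: fun_eq_iff)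
qed

text \<open>The derivative of \<open>P\<^sup>2 = I - \<eta> \<otimes> \<xi>\<close>.\<close>
lemma nab_P_P:
  assumes [simp]: "X \<in> V" "Y \<in> V"
  shows "nab P X (P Y) + P (nab P X Y) = - (g Y (D X \<xi>) \<odot> \<xi>) - \<eta> Y \<odot> D X \<xi>"
  by (simp add: nab_def P_P app_eta[of X Y]) (simp add: fun_eq_iff algebra_simps)

lemma nab_P_sym: "X \<in> V \<Longrightarrow> Y \<in> V \<Longrightarrow> Z \<in> V \<Longrightarrow> g (nab P X Y) Z = g Y (nab P X Z)"
  by (rule nab_adjoint[OF P_tensor11 P_tensor11 P_sym])

text \<open>Global eigenfields of \<open>P\<close>. They suffice, because the spectral projections
  \<open>(I - \<eta> \<otimes> \<xi> \<plusminus> P) / 2\<close> are themselves tensor fields.\<close>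
definition eig :: "real \<Rightarrow> 'a vfield set" where
  "eig e = {X \<in> V. P X = e \<odot>\<^sub>R X}"

lemma eigD: "X \<in> eig e \<Longrightarrow> X \<in> V" "X \<in> eig e \<Longrightarrow> P X = e \<odot>\<^sub>R X"
  by (auto simp: eig_def)

lemma eig_eta: "X \<in> eig e \<Longrightarrow> e = 1 \<or> e = -1 \<Longrightarrow> \<eta> X = 0"
  using eta_P[of X] eigD[of X e] by (auto simp del: eta_P simp: fun_eq_iff)

lemma eig_phi: "X \<in> eig e \<Longrightarrow> \<phi> X \<in> eig (- e)"
  by (auto simp: eig_def P_phi) (simp add: fun_eq_iff)

lemma eig_decomp:
  assumes [simp]: "X \<in> V"
  obtains Xp Xm where "Xp \<in> eig 1" "Xm \<in> eig (-1)" "X = Xp + Xm + \<eta> X \<odot> \<xi>"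
proof
  let ?p = "(1/2) \<odot>\<^sub>R (X - \<eta> X \<odot> \<xi> + P X)" and ?m = "(1/2) \<odot>\<^sub>R (X - \<eta> X \<odot> \<xi> - P X)"
  show "?p \<in> eig 1" "?m \<in> eig (-1)"
    by (auto simp: eig_def P_P) (simp_all add: fun_eq_iff algebra_simps)
  show "X = ?p + ?m + \<eta> X \<odot> \<xi>" by (simp add: fun_eq_iff algebra_simps)
qed

text \<open>On the horizontal part \<open>D\<^sub>X P\<close> anticommutes with \<open>P\<close>, so it exchanges the eigenspaces.\<close>
lemma nab_P_eig:
  assumes X [simp]: "X \<in> V" and Y: "Y \<in> eig e" and Z: "Z \<in> eig e" and e: "e = 1 \<or> e = -1"
  shows "g (nab P X Y) Z = 0"
proof -
  note [simp] = eigD(1)[OF Y] eigD(1)[OF Z] eig_eta[OF Y e] eig_eta[OF Z e] nab_vf[OF P_tensor11]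
  have "nab P X (e \<odot>\<^sub>R Y) + P (nab P X Y) = - (g Y (D X \<xi>) \<odot> \<xi>)"
    using nab_P_P[of X Y] by (simp add: eigD(2)[OF Y])
  then have "g (nab P X (e \<odot>\<^sub>R Y) + P (nab P X Y)) Z = g (- (g Y (D X \<xi>) \<odot> \<xi>)) Z" by simp
  then have "(\<lambda>p. 2 * e) * g (nab P X Y) Z = 0"
    by (simp add: tensor11_rules[OF nab_tensor11[OF P_tensor11 X]] P_sym eigD(2)[OF Z] fun_eq_iff)
  then show ?thesis using e by (auto simp: fun_eq_iff)
qed

text \<open>For horizontal \<open>Y\<close>, \<open>Z\<close> the condition \<open>R(Y, Z) \<xi> = 0\<close> is a Codazzi equation for \<open>\<phi> + \<lambda> P\<close>;
  closedness of the fundamental form converts the skew-symmetrised derivative of \<open>\<phi>\<close> into \<open>D\<^sub>X \<phi>\<close>.\<close>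
lemma nab_phi_codazzi:
  assumes [simp]: "X \<in> V" "Y \<in> V" "Z \<in> V" "\<eta> Y = 0" "\<eta> Z = 0"
  shows "g (nab \<phi> X Y) Z = (\<lambda>p. lam) * (g (nab P Y Z) X - g (nab P Z Y) X)"
proof -
  note [simp] = nab_vf[OF P_tensor11] nab_vf[OF phi_tensor11]
  have lp: "nab (\<lambda>X. \<phi> (h X)) U W = lam \<odot>\<^sub>R nab P U W" if [simp]: "U \<in> V" "W \<in> V" for U W
    by (simp add: nab_def phi_h) (simp add: fun_eq_iff algebra_simps)
  have "- nab \<phi> Y Z + nab \<phi> Z Y - lam \<odot>\<^sub>R nab P Y Z + lam \<odot>\<^sub>R nab P Z Y = 0"
    using curv_xi[of Y Z] nullity[of Y Z] by (simp add: lp)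
  then have "g (- nab \<phi> Y Z + nab \<phi> Z Y - lam \<odot>\<^sub>R nab P Y Z + lam \<odot>\<^sub>R nab P Z Y) X = g 0 X"
    by simp
  from fun_cong[OF this]
  have 1: "- g (nab \<phi> Y Z) X p + g (nab \<phi> Z Y) X p - lam * g (nab P Y Z) X p + lam * g (nab P Z Y) X p = 0" for p
    by simp
  have "g (nab \<phi> X Y) Z + g (nab \<phi> Y Z) X + g (nab \<phi> Z X) Y = 0"
    by (rule nab_phi_cyclic) auto
  from fun_cong[OF this]
  have 2: "g (nab \<phi> X Y) Z p + g (nab \<phi> Y Z) X p + g (nab \<phi> Z X) Y p = 0" for p
    by simp
  have 3: "g (nab \<phi> Z X) Y p = - g (nab \<phi> Z Y) X p" for p
    by (simp add: nab_phi_skew g_sym[of X])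
  show ?thesis
  proof
    fix p show "g (nab \<phi> X Y) Z p = ((\<lambda>p. lam) * (g (nab P Y Z) X - g (nab P Z Y) X)) p"
      using 1[of p] 2[of p] 3[of p] by (simp add: algebra_simps)
  qed
qed

lemma nab_phi_anti:
  assumes [simp]: "X \<in> V" "Y \<in> V" "Z \<in> V" "\<eta> Y = 0" "\<eta> Z = 0"
  shows "g (nab \<phi> X (\<phi> Y)) Z = - g (\<phi> (nab \<phi> X Y)) Z"
proof -
  note [simp] = nab_vf[OF phi_tensor11]
  have "g (nab \<phi> X (\<phi> Y) + \<phi> (nab \<phi> X Y)) Z = 0"
    by (subst nab_phi_phi) simp_all
  then show ?thesis by (simp add: eq_neg_iff_add_eq_0)
qed

text \<open>The horizontal part of \<open>D \<phi>\<close> vanishes. If all three arguments lie in one eigenspace,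
  the Codazzi identity expresses the value by terms that vanish. As \<open>\<phi>\<close> exchanges the eigenspaces
  and anticommutes with \<open>D\<^sub>X \<phi>\<close>, the last two arguments can be moved to the other eigenspace. There remains
  \<open>g((D\<^sub>X \<phi>) Y, \<phi> W)\<close> for \<open>X\<close>, \<open>Y\<close>, \<open>W\<close> in one eigenspace: closedness makes it symmetric in \<open>X, Y\<close>, and it
  is skew in \<open>Y, W\<close>. Such a trilinear form is zero.\<close>
lemma nab_phi_eig:
  assumes e: "e = 1 \<or> e = -1" "e' = 1 \<or> e' = -1" "e'' = 1 \<or> e'' = -1"
    and X: "X \<in> eig e" and Y: "Y \<in> eig e'" and Z: "Z \<in> eig e''"
  shows "g (nab \<phi> X Y) Z = 0"
proof -
  have vf: "X \<in> V" "X \<in> V \<Longrightarrow> \<phi> X \<in> V" if "X \<in> eig e" for X e using eigD[OF that] by auto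
  have neg: "- e = 1 \<or> - e = -1" if "e = 1 \<or> e = -1" for e :: real using that by auto
  note nv = nab_vf[OF phi_tensor11]
  have same: "g (nab \<phi> X Y) Z = 0" if e: "e = 1 \<or> e = -1" and "X \<in> eig e" "Y \<in> eig e" "Z \<in> eig e" for e X Y Z
    using that nab_P_eig[OF _ _ _ e] by (simp add: nab_phi_codazzi vf eig_eta[OF _ e] fun_eq_iff)
  have opp: "g (nab \<phi> X Y) Z = 0" if e: "e = 1 \<or> e = -1" and "X \<in> eig e" "Y \<in> eig (-e)" "Z \<in> eig (-e)" for e X Y Z
  proof -
    note [simp] = vf[OF that(2)] vf[OF that(3)] vf[OF that(4)] eig_eta[OF that(3) neg[OF e]] eig_eta[OF that(4) neg[OF e]] nv
    have "\<phi> Y \<in> eig e" "\<phi> Z \<in> eig e" using eig_phi[OF that(3)] eig_phi[OF that(4)] by auto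
    then have "g (nab \<phi> X (\<phi> Y)) (\<phi> Z) = 0" using same[OF e that(2)] by simp
    then have "g (\<phi> (nab \<phi> X Y)) (\<phi> Z) = 0" by (simp add: nab_phi_anti)
    then show ?thesis by (simp add: g_phi_phi)
  qed
  have mix: "g (nab \<phi> X Y) (\<phi> W) = 0" if e: "e = 1 \<or> e = -1" and "X \<in> eig e" "Y \<in> eig e" "W \<in> eig e" for e X Y W
  proof -
    have s12: "g (nab \<phi> X Y) (\<phi> W) = g (nab \<phi> Y X) (\<phi> W)" if x: "X \<in> eig e" "Y \<in> eig e" "W \<in> eig e" for X Y W
    proof -
      note [simp] = vf[OF x(1)] vf[OF x(2)] vf[OF x(3)] nv
      have "g (nab \<phi> (\<phi> W) X) Y = 0"
        by (rule opp[OF neg[OF e] eig_phi[OF x(3)]]) (use x in simp_all)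
      moreover have "g (nab \<phi> X Y) (\<phi> W) + g (nab \<phi> Y (\<phi> W)) X + g (nab \<phi> (\<phi> W) X) Y = 0"
        by (rule nab_phi_cyclic) auto
      moreover have "g (nab \<phi> Y (\<phi> W)) X = - g (nab \<phi> Y X) (\<phi> W)"
        by (simp add: nab_phi_skew g_sym[of "\<phi> W"])
      ultimately show ?thesis by (simp add: fun_eq_iff algebra_simps)
    qed
    have s23: "g (nab \<phi> X Y) (\<phi> W) = - g (nab \<phi> X W) (\<phi> Y)" if x: "X \<in> eig e" "Y \<in> eig e" "W \<in> eig e" for X Y W
    proof -
      note [simp] = vf[OF x(1)] vf[OF x(2)] vf[OF x(3)] nv eig_eta[OF x(2) e] eig_eta[OF x(3) e]
      have "g (nab \<phi> X Y) (\<phi> W) = g (nab \<phi> X (\<phi> Y)) W"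
        using phi_skew[of "nab \<phi> X Y" W] by (simp add: nab_phi_anti)
      then show ?thesis by (simp add: nab_phi_skew g_sym[of "\<phi> Y"])
    qed
    note x = that(2-4)
    have "g (nab \<phi> X Y) (\<phi> W) = g (nab \<phi> Y X) (\<phi> W)" by (rule s12[OF x])
    also have "\<dots> = - g (nab \<phi> Y W) (\<phi> X)" by (rule s23[OF x(2,1,3)])
    also have "g (nab \<phi> Y W) (\<phi> X) = g (nab \<phi> W Y) (\<phi> X)" by (rule s12[OF x(2,3,1)])
    also have "\<dots> = - g (nab \<phi> W X) (\<phi> Y)" by (rule s23[OF x(3,2,1)])
    also have "g (nab \<phi> W X) (\<phi> Y) = g (nab \<phi> X W) (\<phi> Y)" by (rule s12[OF x(3,1,2)])
    also have "\<dots> = - g (nab \<phi> X Y) (\<phi> W)" by (rule s23[OF x(1,3,2)])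
    finally have "g (nab \<phi> X Y) (\<phi> W) p = - g (nab \<phi> X Y) (\<phi> W) p" for p
      by (metis minus_minus uminus_apply)
    then show ?thesis by (simp add: fun_eq_iff)
  qed
  have mix': "g (nab \<phi> X Y) Z = 0" if e: "e = 1 \<or> e = -1" and x: "X \<in> eig e" "Y \<in> eig e" "Z \<in> eig (-e)" for e X Y Z
  proof -
    note [simp] = vf[OF x(1)] vf[OF x(2)] vf[OF x(3)] nv eig_eta[OF x(3) neg[OF e]]
    have "\<phi> Z \<in> eig e" using eig_phi[OF x(3)] by simp
    then have "g (nab \<phi> X Y) (\<phi> (\<phi> Z)) = 0" using mix[OF e x(1,2)] by simp
    then show ?thesis by (simp add: phi_phi)
  qed
  note [simp] = vf[OF X] vf[OF Y] vf[OF Z] nv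
  consider "e' = e" "e'' = e" | "e' = - e" "e'' = - e" | "e' = e" "e'' = - e" | "e' = - e" "e'' = e"
    using e by auto
  then show ?thesis
  proof cases
    case 1 then show ?thesis using same[OF e(1) X] Y Z by simp
  next
    case 2 then show ?thesis using opp[OF e(1) X] Y Z by simp
  next
    case 3 then show ?thesis using mix'[OF e(1) X] Y Z by simp
  next
    case 4
    then have "g (nab \<phi> X Z) Y = 0" using mix'[OF e(1) X] Y Z by simp
    then show ?thesis by (simp add: nab_phi_skew g_sym[of Y])
  qed
qed

text \<open>With \<open>D \<phi>\<close> gone, the Codazzi identity makes \<open>g((D\<^sub>X P) Y, Z)\<close> totally symmetric on horizontal
  eigenfields. Two of the three arguments belong to the same eigenspace; put them last and
  use that \<open>D\<^sub>X P\<close> exchanges the eigenspaces.\<close>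
lemma nab_P_horizontal:
  assumes e: "e = 1 \<or> e = -1" "e' = 1 \<or> e' = -1" "e'' = 1 \<or> e'' = -1"
    and X: "X \<in> eig e" and Y: "Y \<in> eig e'" and Z: "Z \<in> eig e''"
  shows "g (nab P X Y) Z = 0"
proof -
  have sym12: "g (nab P X Y) Z = g (nab P Y X) Z"
    if e: "e = 1 \<or> e = -1" "e' = 1 \<or> e' = -1" "e'' = 1 \<or> e'' = -1"
      and x: "X \<in> eig e" "Y \<in> eig e'" "Z \<in> eig e''" for X Y Z e e' e''
    using nab_phi_codazzi[of Z X Y] nab_phi_eig[OF e(3,1,2) x(3,1,2)] eigD(1)[OF x(1)] eigD(1)[OF x(2)] eigD(1)[OF x(3)]
      eig_eta[OF x(1) e(1)] eig_eta[OF x(2) e(2)]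
    by (simp add: fun_eq_iff)
  note [simp] = eigD(1)[OF X] eigD(1)[OF Y] eigD(1)[OF Z] nab_vf[OF P_tensor11]
  consider "e' = e''" | "e = e'" "e'' = - e" | "e = e''" "e' = - e" using e by auto
  then show ?thesis
  proof cases
    case 1 then show ?thesis using nab_P_eig[OF eigD(1)[OF X] Y, of Z] e(2) Z by simp
  next
    case 2
    have "g (nab P X Y) Z = g (nab P X Z) Y" by (simp add: nab_P_sym g_sym[of Y])
    also have "\<dots> = g (nab P Z X) Y" by (rule sym12[OF e(1,3,2) X Z Y])
    also have "\<dots> = 0" using 2 nab_P_eig[of Z X e Y] e X Y by simp
    finally show ?thesis .
  next
    case 3
    have "g (nab P X Y) Z = g (nab P Y X) Z" by (rule sym12[OF e X Y Z])
    also have "\<dots> = 0" using 3 nab_P_eig[of Y X e Z] e X Z by simp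
    finally show ?thesis .
  qed
qed

abbreviation Q :: "'a vfield \<Rightarrow> 'a vfield" where "Q \<equiv> std2 \<kappa> \<phi> \<xi>"

lemma Q_def: "Q X = (1 / lam) \<odot>\<^sub>R h X"
  by (simp add: std2_def lam_def)

lemma Q_tensor11: "tensor11 A Q"
  by (rule tensor11I) (simp_all add: Q_def, simp_all add: fun_eq_iff algebra_simps)

lemmas Q_rules [simp] = tensor11_rules[OF Q_tensor11]

lemma h_Q: "h X = lam \<odot>\<^sub>R Q X"
  by (simp add: Q_def fun_eq_iff)

lemma Q_xi [simp]: "Q \<xi> = 0"
  by (simp add: Q_def)

text \<open>The multiplication table of the split quaternions \<open>\<phi>\<close>, \<open>P\<close>, \<open>Q\<close>.\<close>
lemma Q_ops [simp]:
  assumes "X \<in> V"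
  shows "\<eta> (Q X) = 0" "\<phi> (Q X) = P X" "Q (\<phi> X) = - P X" "\<phi> (P X) = - Q X" "P (\<phi> X) = Q X"
    "Q (P X) = - \<phi> X" "P (Q X) = \<phi> X" "Q (Q X) = X - \<eta> X \<odot> \<xi>"
  using assms
  by (simp_all add: Q_def P_def h_phi phi_phi h_h_lam) (simp_all add: fun_eq_iff)

lemma Q_sym: "X \<in> V \<Longrightarrow> Y \<in> V \<Longrightarrow> g (Q X) Y = g X (Q Y)"
  by (simp add: Q_def h_sym)

declare P_P [simp] phi_phi [simp]
lemmas g_adj = phi_skew P_sym Q_sym

lemma D_xi_PQ: "X \<in> V \<Longrightarrow> D X \<xi> = - \<phi> X - lam \<odot>\<^sub>R P X"
  by (simp add: D_xi h_Q)

lemma horizontal_zero: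
  assumes N: "\<And>X. X \<in> V \<Longrightarrow> tensor11 A (N X)" "\<And>Y. Y \<in> V \<Longrightarrow> tensor11 A (\<lambda>X. N X Y)"
    and eig: "\<And>e e' e'' X Y Z. e = 1 \<or> e = -1 \<Longrightarrow> e' = 1 \<or> e' = -1 \<Longrightarrow> e'' = 1 \<or> e'' = -1 \<Longrightarrow>
      X \<in> eig e \<Longrightarrow> Y \<in> eig e' \<Longrightarrow> Z \<in> eig e'' \<Longrightarrow> g (N X Y) Z = 0"
    and X: "X \<in> V" "\<eta> X = 0" and Y: "Y \<in> V" "\<eta> Y = 0" and Z: "Z \<in> V" "\<eta> Z = 0"
  shows "g (N X Y) Z = 0"
proof -
  obtain X1 X2 where x: "X1 \<in> eig 1" "X2 \<in> eig (-1)" "X = X1 + X2"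
    using eig_decomp[OF X(1)] X(2) by auto
  obtain Y1 Y2 where y: "Y1 \<in> eig 1" "Y2 \<in> eig (-1)" "Y = Y1 + Y2"
    using eig_decomp[OF Y(1)] Y(2) by auto
  obtain Z1 Z2 where z: "Z1 \<in> eig 1" "Z2 \<in> eig (-1)" "Z = Z1 + Z2"
    using eig_decomp[OF Z(1)] Z(2) by auto
  note [simp] = eigD(1)[OF x(1)] eigD(1)[OF x(2)] eigD(1)[OF y(1)] eigD(1)[OF y(2)] eigD(1)[OF z(1)] eigD(1)[OF z(2)]
    tensor11_rules[OF N(1)] tensor11_add[OF N(2)]
  have e: "g (N U W) T = 0" if "U \<in> {X1, X2}" "W \<in> {Y1, Y2}" "T \<in> {Z1, Z2}" for U W T
    using that eig x(1,2) y(1,2) z(1,2) by fastforce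
  show ?thesis unfolding x(3) y(3) z(3) by (simp add: e)
qed

text \<open>The horizontal part is zero, so only the terms in which \<open>Y\<close> or the test field \<open>Z\<close> is replaced by
  its component along \<open>\<xi>\<close> survive; they are given by \<open>(D\<^sub>X \<phi>) \<xi> = - \<phi> (D\<^sub>X \<xi>)\<close>. The direction \<open>X = \<xi>\<close>
  contributes nothing since \<open>D\<^sub>\<xi> \<phi> = 0\<close>.\<close>
lemma nab_phi:
  assumes [simp]: "X \<in> V" "Y \<in> V"
  shows "nab \<phi> X Y = g (X + lam \<odot>\<^sub>R Q X) Y \<odot> \<xi> - \<eta> Y \<odot> (X + lam \<odot>\<^sub>R Q X)"
proof (rule vf_eqI)
  fix Z assume [simp]: "Z \<in> V"
  note [simp] = tensor11_rules[OF nab_tensor11[OF phi_tensor11]]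
  note [simp] = tensor11_rules[OF nab_left_tensor11[OF phi_tensor11]]
  let ?h = "\<lambda>X. X - \<eta> X \<odot> \<xi>"
  have "g (nab \<phi> (?h X) (?h Y)) (?h Z) = 0"
    by (rule horizontal_zero[where N = "nab \<phi>"]) (simp_all add: nab_tensor11 nab_left_tensor11 phi_tensor11 nab_phi_eig)
  moreover have x: "nab \<phi> X \<xi> = \<eta> X \<odot> \<xi> - X - lam \<odot>\<^sub>R Q X"
    by (simp add: nab_phi_xi D_xi_PQ) (simp add: fun_eq_iff)
  moreover have "\<eta> (nab \<phi> X Y) = g X Y + (\<lambda>p. lam) * g X (Q Y) - \<eta> X * \<eta> Y"
    using nab_phi_skew[of X Y \<xi>] by (simp add: x g_xi Q_sym g_sym[of Y X] g_sym[of Y "Q X"])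
  ultimately show "g (nab \<phi> X Y) Z = g (g (X + lam \<odot>\<^sub>R Q X) Y \<odot> \<xi> - \<eta> Y \<odot> (X + lam \<odot>\<^sub>R Q X)) Z"
    by (simp add: x g_xi Q_sym g_sym[of Y X] g_sym[of Y "Q X"] fun_eq_iff algebra_simps)
qed (auto simp: phi_tensor11)

text \<open>The same decomposition, now with a contribution of the direction \<open>X = \<xi>\<close>: there
  \<open>D\<^sub>\<xi> P = \<mu> Q\<close>, from the formula for \<open>D\<^sub>\<xi> h\<close>.\<close>
lemma nab_P:
  assumes [simp]: "X \<in> V" "Y \<in> V"
  shows "nab P X Y = (\<mu> \<odot>\<^sub>R \<eta> X \<odot> Q Y) + \<eta> Y \<odot> (Q X + lam \<odot>\<^sub>R (X - \<eta> X \<odot> \<xi>))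
    + g (Q X + lam \<odot>\<^sub>R (X - \<eta> X \<odot> \<xi>)) Y \<odot> \<xi>"
proof (rule vf_eqI)
  fix Z assume [simp]: "Z \<in> V"
  note [simp] = tensor11_rules[OF nab_tensor11[OF P_tensor11]]
  note [simp] = tensor11_rules[OF nab_left_tensor11[OF P_tensor11]]
  let ?h = "\<lambda>X. X - \<eta> X \<odot> \<xi>"
  have "g (nab P (?h X) (?h Y)) (?h Z) = 0"
    by (rule horizontal_zero[where N = "nab P"]) (simp_all add: nab_tensor11 nab_left_tensor11 P_tensor11 nab_P_horizontal)
  moreover have x: "nab P W \<xi> = Q W + lam \<odot>\<^sub>R (W - \<eta> W \<odot> \<xi>)" if [simp]: "W \<in> V" for W
    by (simp add: nab_def D_xi_PQ)
  moreover have y: "nab P \<xi> W = \<mu> \<odot>\<^sub>R Q W" if [simp]: "W \<in> V" for W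
  proof -
    have "nab P \<xi> W = (1 / lam) \<odot>\<^sub>R (nab \<phi> \<xi> (h W) + \<phi> (nab h \<xi> W))"
      by (simp add: nab_def P_def) (simp add: fun_eq_iff algebra_simps)
    then show ?thesis by (simp add: nab_h_xi_dir h_Q) (simp add: fun_eq_iff)
  qed
  moreover have "\<eta> (nab P X Y) = (\<lambda>p. lam) * g X Y + g X (Q Y) - (\<lambda>p. lam) * \<eta> X * \<eta> Y"
    using nab_P_sym[of X Y \<xi>]
    by (simp add: x g_xi Q_sym g_sym[of Y X] g_sym[of Y "Q X"]) (simp add: fun_eq_iff algebra_simps)
  ultimately show "g (nab P X Y) Z = g ((\<mu> \<odot>\<^sub>R \<eta> X \<odot> Q Y) + \<eta> Y \<odot> (Q X + lam \<odot>\<^sub>R (X - \<eta> X \<odot> \<xi>))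
    + g (Q X + lam \<odot>\<^sub>R (X - \<eta> X \<odot> \<xi>)) Y \<odot> \<xi>) Z"
    by (simp add: x y g_xi Q_sym g_sym[of Y X] g_sym[of Y "Q X"] fun_eq_iff algebra_simps)
qed (auto simp: P_tensor11)

lemma nab_Q:
  assumes [simp]: "X \<in> V" "Y \<in> V"
  shows "nab Q X Y = - ((g X (P Y) - (\<lambda>p. lam) * g X (\<phi> Y)) \<odot> \<xi> + \<mu> \<odot>\<^sub>R \<eta> X \<odot> P Y
    + \<eta> Y \<odot> (P X + lam \<odot>\<^sub>R \<phi> X))"
proof -
  have Q: "Q W = - \<phi> (P W)" if "W \<in> V" for W using that by simp
  have "nab Q X Y = - nab \<phi> X (P Y) - \<phi> (nab P X Y)"
    by (simp add: nab_def Q del: Q_ops)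
  then show ?thesis
    by (simp add: nab_phi nab_P g_adj g_xi)
qed

lemma
  assumes [simp]: "X \<in> V" "Y \<in> V"
  shows D_phi: "D X (\<phi> Y) = \<phi> (D X Y) + nab \<phi> X Y"
    and D_P: "D X (P Y) = P (D X Y) + nab P X Y"
    and D_Q: "D X (Q Y) = Q (D X Y) + nab Q X Y"
  by (simp_all add: nab_def)

abbreviation "a \<equiv> 1 - \<mu> / 2"

end

section \<open>Levi-Civita connections of other metrics\<close>

context manifold begin

text \<open>The difference of two Levi-Civita connections is symmetric (no torsion) and skew with respect to
  \<open>g\<close> (metric), so the associated trilinear form vanishes.\<close>
lemma levi_civita_unique:
  assumes g: "semi_riemannian_metric A g" and D: "levi_civita A g D" and D': "levi_civita A g D'"
    and X: "X \<in> V" and Y: "Y \<in> V"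
  shows "D X Y = D' X Y"
proof -
  define E where "E X Y = D X Y - D' X Y" for X Y
  have gof: "one_form A (g X)" if "X \<in> V" for X
    using g that by (simp add: semi_riemannian_metric_def symmetric_tensor02_def)
  have gsym: "g X Y = g Y X" if "X \<in> V" "Y \<in> V" for X Y
    using g that by (simp add: semi_riemannian_metric_def symmetric_tensor02_def)
  have nd: "vec_at X p = 0" if "X \<in> V" "\<And>Y. Y \<in> V \<Longrightarrow> g X Y p = 0" for X p
    using g that by (simp add: semi_riemannian_metric_def)
  have vD: "D X Y \<in> V" "D' X Y \<in> V" if "X \<in> V" "Y \<in> V" for X Y
    using D D' that by (simp_all add: levi_civita_def affine_connection_def tensor11_def)
  have tors: "D X Y - D Y X = lie_bracket X Y" "D' X Y - D' Y X = lie_bracket X Y" if "X \<in> V" "Y \<in> V" for X Y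
    using D D' that by (simp_all add: levi_civita_def)
  have met: "X (g Y Z) = g (D X Y) Z + g Y (D X Z)" "X (g Y Z) = g (D' X Y) Z + g Y (D' X Z)"
    if "X \<in> V" "Y \<in> V" "Z \<in> V" for X Y Z
    using D D' that unfolding levi_civita_def by blast+
  have E [simp]: "E X Y \<in> V" if "X \<in> V" "Y \<in> V" for X Y
    using vD that by (simp add: E_def)
  have Es: "E X Y = E Y X" if "X \<in> V" "Y \<in> V" for X Y
    using tors[OF that] by (simp add: E_def fun_eq_iff) (smt (verit))
  have sk: "g (E X Y) Z p = - g (E X Z) Y p" if v: "X \<in> V" "Y \<in> V" "Z \<in> V" for X Y Z p
  proof -
    have 1: "g (E X Y) Z = g (D X Y) Z - g (D' X Y) Z" if "X \<in> V" "Y \<in> V" "Z \<in> V" for X Y Z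
      using that vD by (simp add: E_def gsym[of _ Z] one_form_diff[OF gof])
    have "(g (D X Y) Z + g Y (D X Z)) p = (g (D' X Y) Z + g Y (D' X Z)) p"
      using met[OF v] by simp
    then show ?thesis using v vD by (simp add: 1 gsym[of Y])
  qed
  have "g (E X Y) Z p = 0" if [simp]: "Z \<in> V" for Z p
    using sk[of X Y Z p] sk[of Z X Y p] sk[of Y Z X p] Es[of X Y] Es[of X Z] Es[of Y Z] X Y by simp
  then have "vec_at (E X Y) p = 0" for p using nd X Y by simp
  then have "E X Y = 0" by (simp add: vec_at_def fun_eq_iff)
  then show ?thesis by (simp add: E_def)
qed

lemma kappa_mu_curvatureI:
  assumes g: "semi_riemannian_metric A g" and D: "levi_civita A g D" and Z: "Z \<in> V"
    and c: "\<And>X Y. X \<in> V \<Longrightarrow> Y \<in> V \<Longrightarrow> curvature D X Y Z =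
      \<kappa> \<odot>\<^sub>R (\<eta> Y \<odot> X - \<eta> X \<odot> Y) + \<mu> \<odot>\<^sub>R (\<eta> Y \<odot> h X - \<eta> X \<odot> h Y)"
  shows "kappa_mu_curvature A Z \<eta> g h \<kappa> \<mu>"
  unfolding kappa_mu_curvature_def
proof (intro conjI exI[of _ D] D allI impI ballI)
  fix D' X Y assume D': "levi_civita A g D'" and X: "X \<in> V" and Y: "Y \<in> V"
  have vD: "D X Y \<in> V" if "X \<in> V" "Y \<in> V" for X Y
    using D that by (simp add: levi_civita_def affine_connection_def tensor11_def)
  have "curvature D' X Y Z = curvature D X Y Z"
    using X Y Z vD by (simp add: curvature_def levi_civita_unique[OF g D' D])
  then show "curvature D' X Y Z = \<kappa> \<odot>\<^sub>R (\<eta> Y \<odot> X - \<eta> X \<odot> Y) + \<mu> \<odot>\<^sub>R (\<eta> Y \<odot> h X - \<eta> X \<odot> h Y)"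
    using c X Y by simp
qed

end

context contact begin

text \<open>A symmetric difference tensor preserves torsion-freeness; what remains to be checked for a new
  metric is compatibility.\<close>
lemma levi_civita_shift:
  assumes C: "\<And>Y. Y \<in> V \<Longrightarrow> tensor11 A (\<lambda>X. C X Y)"
    and sym: "\<And>X Y. X \<in> V \<Longrightarrow> Y \<in> V \<Longrightarrow> C X Y = C Y X"
    and met: "\<And>X Y Z. X \<in> V \<Longrightarrow> Y \<in> V \<Longrightarrow> Z \<in> V \<Longrightarrow>
      X (g' Y Z) = g' (D X Y + C X Y) Z + g' Y (D X Z + C X Z)"
  shows "levi_civita A g' (\<lambda>X Y. D X Y + C X Y)"
proof -
  note [simp] = tensor11_rules[OF C]
  have C': "tensor11 A (C X)" if X: "X \<in> V" for X
  proof -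
    have *: "C X Y = C Y X" if "Y \<in> V" for Y using X that by (rule sym)
    show ?thesis by (rule tensor11I) (simp_all add: * X)
  qed
  have "tensor11 A (\<lambda>X. D X Y + C X Y)" if Y: "Y \<in> V" for Y
    by (rule tensor11I; simp add: Y) (simp_all add: fun_eq_iff algebra_simps)
  moreover have "D X Y + C X Y - (D Y X + C Y X) = lie_bracket X Y" if "X \<in> V" "Y \<in> V" for X Y
    using that sym[OF that] by (simp add: D_torsion[symmetric])
  ultimately show ?thesis
    by (simp add: levi_civita_def affine_connection_def tensor11_add[OF C'] tensor11_fmul[OF C'] met)
      (simp add: fun_eq_iff algebra_simps)
qed

end

section \<open>The associated paracontact metrics\<close>

context nonsasakian_kappa_mu
begin

abbreviation "g1 \<equiv> assoc_metric \<eta> P"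
abbreviation "g2 \<equiv> assoc_metric \<eta> Q"

lemma g1_eq: "X \<in> V \<Longrightarrow> Y \<in> V \<Longrightarrow> g1 X Y = \<eta> X * \<eta> Y - g X (Q Y)"
  and g2_eq: "X \<in> V \<Longrightarrow> Y \<in> V \<Longrightarrow> g2 X Y = \<eta> X * \<eta> Y + g X (P Y)"
  by (simp_all add: assoc_metric_def deta)

text \<open>The difference tensors between the Levi-Civita connections of \<open>g1\<close>, \<open>g2\<close> and \<open>D\<close>, found by solving the
  Koszul formula with the known derivatives of \<open>Q\<close> and \<open>P\<close>. The operators \<open>L1\<close>, \<open>L2\<close> are the
  values \<open>C1 X \<xi>\<close>, \<open>C2 X \<xi>\<close>; on horizontal arguments \<open>C1\<close> and \<open>C2\<close> are multiples of \<open>\<xi>\<close>.\<close>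
definition "L1 X = (lam - 1) \<odot>\<^sub>R P X + (\<mu> / 2) \<odot>\<^sub>R \<phi> X"
definition "L2 X = (\<mu> / 2) \<odot>\<^sub>R \<phi> X - Q X"
definition "C1 X Y = (a - lam) \<odot>\<^sub>R g X (P Y) \<odot> \<xi> + \<eta> Y \<odot> L1 X + \<eta> X \<odot> L1 Y"
definition "C2 X Y = a \<odot>\<^sub>R g X (Q Y) \<odot> \<xi> - lam \<odot>\<^sub>R g X (P Y) \<odot> \<xi>
  + lam \<odot>\<^sub>R (g X Y - \<eta> X * \<eta> Y) \<odot> \<xi>
  + \<eta> Y \<odot> L2 X + \<eta> X \<odot> L2 Y"

lemma C1_tensor11: "Y \<in> V \<Longrightarrow> tensor11 A (\<lambda>X. C1 X Y)"
  by (rule tensor11I) (simp_all add: C1_def L1_def, simp_all add: fun_eq_iff algebra_simps)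

lemma C2_tensor11: "Y \<in> V \<Longrightarrow> tensor11 A (\<lambda>X. C2 X Y)"
  by (rule tensor11I) (simp_all add: C2_def L2_def, simp_all add: fun_eq_iff algebra_simps)

lemma g_PQ_sym:
  assumes "X \<in> V" "Y \<in> V"
  shows "g X (P Y) = g Y (P X)" "g X (Q Y) = g Y (Q X)" "g X (\<phi> Y) = - g Y (\<phi> X)"
  using assms P_sym[of X Y] Q_sym[of X Y] phi_skew[of X Y] by (simp_all add: g_sym[of _ Y])

lemma C1_sym: "X \<in> V \<Longrightarrow> Y \<in> V \<Longrightarrow> C1 X Y = C1 Y X"
  by (simp add: C1_def g_PQ_sym(1)[of X Y] fun_eq_iff)

lemma C2_sym: "X \<in> V \<Longrightarrow> Y \<in> V \<Longrightarrow> C2 X Y = C2 Y X"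
  by (simp add: C2_def g_PQ_sym(1,2)[of X Y] g_sym[of X Y] fun_eq_iff)

lemma levi_civita_g1: "levi_civita A g1 (\<lambda>X Y. D X Y + C1 X Y)"
proof (rule levi_civita_shift[OF C1_tensor11 C1_sym])
  fix X Y Z assume v [simp]: "X \<in> V" "Y \<in> V" "Z \<in> V"
  note X = v(1)
  have [simp]: "C1 X W \<in> V" if "W \<in> V" for W
    using that by (simp add: C1_def L1_def)
  show "X (g1 Y Z) = g1 (D X Y + C1 X Y) Z + g1 Y (D X Z + C1 X Z)"
    by (simp add: g1_eq vf_app_diff[OF X] vf_app_mult[OF X] app_eta[OF X] D_metric[OF X] D_Q D_xi_PQ nab_Q)
      (simp add: C1_def L1_def g_adj g_xi g_PQ_sym[of Y X] g_PQ_sym[of Z X] g_sym[of Y X] g_sym[of Z X]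
        fun_eq_iff algebra_simps)
qed auto

lemma levi_civita_g2: "levi_civita A g2 (\<lambda>X Y. D X Y + C2 X Y)"
proof (rule levi_civita_shift[OF C2_tensor11 C2_sym])
  fix X Y Z assume v [simp]: "X \<in> V" "Y \<in> V" "Z \<in> V"
  note X = v(1)
  have [simp]: "C2 X W \<in> V" if "W \<in> V" for W
    using that by (simp add: C2_def L2_def)
  show "X (g2 Y Z) = g2 (D X Y + C2 X Y) Z + g2 Y (D X Z + C2 X Z)"
    by (simp add: g2_eq vf_app_add[OF X] vf_app_mult[OF X] app_eta[OF X] D_metric[OF X] D_P D_xi_PQ nab_P)
      (simp add: C2_def L2_def g_adj g_xi g_PQ_sym[of Y X] g_PQ_sym[of Z X] g_sym[of Y X] g_sym[of Z X]
        fun_eq_iff algebra_simps)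
qed auto

lemma half_lie_P: "X \<in> V \<Longrightarrow> half_lie \<xi> P X = - (a \<odot>\<^sub>R Q X)"
  by (simp add: half_lie_def lie_deriv11_def D_torsion[symmetric] D_P nab_P D_xi_PQ g_xi)
    (simp add: fun_eq_iff algebra_simps)

lemma half_lie_Q: "X \<in> V \<Longrightarrow> half_lie \<xi> Q X = a \<odot>\<^sub>R P X + lam \<odot>\<^sub>R \<phi> X"
  by (simp add: half_lie_def lie_deriv11_def D_torsion[symmetric] D_Q nab_Q D_xi_PQ g_xi)
    (simp add: fun_eq_iff algebra_simps)

text \<open>Nondegeneracy reduces to positivity of \<open>g\<close>: pairing \<open>X\<close> with \<open>\<eta>(X) \<xi> - Q X\<close> under \<open>g1\<close> gives
  \<open>g(X, X)\<close>.\<close>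
lemma semi_riemannian_g1: "semi_riemannian_metric A g1"
proof -
  have "one_form A (g1 X)" if [simp]: "X \<in> V" for X
    unfolding one_form_def
    by (simp add: g1_eq) (simp add: fun_eq_iff algebra_simps)
  moreover have "g1 X Y = g1 Y X" if "X \<in> V" "Y \<in> V" for X Y
    using that by (simp add: g1_eq g_PQ_sym[of X Y] fun_eq_iff)
  moreover have "vec_at X p = 0" if [simp]: "X \<in> V" and 0: "\<forall>Y\<in>V. g1 X Y p = 0" for X p
  proof (rule ccontr)
    assume "vec_at X p \<noteq> 0"
    then have "g X X p > 0" by (rule g_pos[OF that(1)])
    moreover have "g1 X (\<eta> X \<odot> \<xi> - Q X) p = 0" using 0 by simp
    ultimately show False by (simp add: g1_eq g_xi)
  qed
  ultimately show ?thesis by (simp add: semi_riemannian_metric_def symmetric_tensor02_def)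
qed

text \<open>Here the pairing with \<open>\<eta>(X) \<xi> + P X\<close> gives \<open>g(X, X)\<close>.\<close>
lemma semi_riemannian_g2: "semi_riemannian_metric A g2"
proof -
  have "one_form A (g2 X)" if [simp]: "X \<in> V" for X
    unfolding one_form_def
    by (simp add: g2_eq) (simp add: fun_eq_iff algebra_simps)
  moreover have "g2 X Y = g2 Y X" if "X \<in> V" "Y \<in> V" for X Y
    using that by (simp add: g2_eq g_PQ_sym[of X Y] fun_eq_iff)
  moreover have "vec_at X p = 0" if [simp]: "X \<in> V" and 0: "\<forall>Y\<in>V. g2 X Y p = 0" for X p
  proof (rule ccontr)
    assume "vec_at X p \<noteq> 0"
    then have "g X X p > 0" by (rule g_pos[OF that(1)])
    moreover have "g2 X (\<eta> X \<odot> \<xi> + P X) p = 0" using 0 by simp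
    ultimately show False by (simp add: g2_eq g_xi)
  qed
  ultimately show ?thesis by (simp add: semi_riemannian_metric_def symmetric_tensor02_def)
qed

text \<open>With \<open>B = - P - a \<phi>\<close> for the derivative of \<open>\<xi>\<close>, the curvature is the skew-symmetrised derivative
  of \<open>B\<close>; the part of \<open>C1\<close> along \<open>\<xi>\<close> is symmetric there and drops out.\<close>
lemma kappa_mu_curvature_g1: "kappa_mu_curvature A \<xi> \<eta> g1 (half_lie \<xi> P) (a\<^sup>2 - 1) (2 * (1 - lam))"
proof (rule kappa_mu_curvatureI[OF semi_riemannian_g1 levi_civita_g1 xi_vector_field])
  fix X Y assume [simp]: "X \<in> V" "Y \<in> V"
  have B: "D W \<xi> + C1 W \<xi> = - P W - a \<odot>\<^sub>R \<phi> W" if "W \<in> V" for W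
    using that by (simp add: D_xi_PQ C1_def L1_def) (simp add: fun_eq_iff algebra_simps)
  show "curvature (\<lambda>X Y. D X Y + C1 X Y) X Y \<xi> = (a\<^sup>2 - 1) \<odot>\<^sub>R (\<eta> Y \<odot> X - \<eta> X \<odot> Y)
     + (2 * (1 - lam)) \<odot>\<^sub>R (\<eta> Y \<odot> half_lie \<xi> P X - \<eta> X \<odot> half_lie \<xi> P Y)"
    unfolding curvature_def
    by (simp add: B, simp add: D_torsion[symmetric] D_P D_phi nab_P nab_phi half_lie_P)
      (simp add: C1_def L1_def g_adj g_xi g_PQ_sym[of Y X] g_sym[of Y X]
        fun_eq_iff algebra_simps add_divide_distrib diff_divide_distrib power2_eq_square)
qed

text \<open>The same computation with \<open>B = - Q - a \<phi> - \<lambda> P\<close>.\<close>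
lemma kappa_mu_curvature_g2: "kappa_mu_curvature A \<xi> \<eta> g2 (half_lie \<xi> Q) (\<kappa> - 2 + a\<^sup>2) 2"
proof (rule kappa_mu_curvatureI[OF semi_riemannian_g2 levi_civita_g2 xi_vector_field])
  fix X Y assume [simp]: "X \<in> V" "Y \<in> V"
  have B: "D W \<xi> + C2 W \<xi> = - Q W - a \<odot>\<^sub>R \<phi> W - lam \<odot>\<^sub>R P W" if "W \<in> V" for W
    using that by (simp add: D_xi_PQ C2_def L2_def g_xi) (simp add: fun_eq_iff algebra_simps)
  \<comment> \<open>Only this coefficient is rewritten: \<open>\<kappa>\<close> also occurs inside \<open>P\<close> and \<open>Q\<close>.\<close>
  have k: "\<kappa> - 2 + a\<^sup>2 = a\<^sup>2 - 1 - lam * lam" using lam2 by simp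
  show "curvature (\<lambda>X Y. D X Y + C2 X Y) X Y \<xi> = (\<kappa> - 2 + a\<^sup>2) \<odot>\<^sub>R (\<eta> Y \<odot> X - \<eta> X \<odot> Y)
     + 2 \<odot>\<^sub>R (\<eta> Y \<odot> half_lie \<xi> Q X - \<eta> X \<odot> half_lie \<xi> Q Y)"
    unfolding curvature_def k
    by (simp add: B, simp add: D_torsion[symmetric] D_P D_phi D_Q nab_P nab_phi nab_Q half_lie_Q)
      (simp add: C2_def L2_def g_adj g_xi g_PQ_sym[of Y X] g_sym[of Y X]
        fun_eq_iff algebra_simps add_divide_distrib diff_divide_distrib power2_eq_square)
qed

lemma nijenhuis_P:
  "X \<in> V \<Longrightarrow> Y \<in> V \<Longrightarrow> nijenhuis P X Y - 2 \<odot>\<^sub>R (ext_deriv \<eta> X Y \<odot> \<xi>)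
     = (2 * a) \<odot>\<^sub>R (\<eta> X \<odot> \<phi> Y - \<eta> Y \<odot> \<phi> X)"
  by (simp add: nijenhuis_nab[OF P_tensor11] nab_P deta)
    (simp add: g_adj g_xi g_PQ_sym[of Y X] g_sym[of Y X] fun_eq_iff algebra_simps)

lemma almost_paracontact_P: "almost_paracontact A n P \<xi> \<eta>"
  and almost_paracontact_Q: "almost_paracontact A n Q \<xi> \<eta>"
proof -
  have dim: "DIM('e) = 2 * n + 1" using contact by (simp add: contact_metric_def)
  have "fdim (eigenspace_at A P \<eta> s p) = n" if "s = 1 \<or> s = -1" for s p
    by (rule fdim_eigenspace[where \<psi> = P and \<phi> = \<phi> and \<xi> = \<xi> and \<eta> = \<eta>])
      (simp_all add: dim P_tensor11 phi_tensor11 eta_one_form that)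
  moreover have "fdim (eigenspace_at A Q \<eta> s p) = n" if "s = 1 \<or> s = -1" for s p
    by (rule fdim_eigenspace[where \<psi> = Q and \<phi> = \<phi> and \<xi> = \<xi> and \<eta> = \<eta>])
      (simp_all add: dim Q_tensor11 phi_tensor11 eta_one_form that)
  ultimately show "almost_paracontact A n P \<xi> \<eta>" "almost_paracontact A n Q \<xi> \<eta>"
    using manifold dim by (simp_all add: almost_paracontact_def P_tensor11 Q_tensor11 eta_one_form P_P)
qed

lemma paracontact_metric_P: "paracontact_metric A n P \<xi> \<eta> g1"
  by (simp add: paracontact_metric_def almost_paracontact_P semi_riemannian_g1 g1_eq deta g_adj)

lemma paracontact_metric_Q: "paracontact_metric A n Q \<xi> \<eta> g2"
  by (simp add: paracontact_metric_def almost_paracontact_Q semi_riemannian_g2 g2_eq deta g_adj)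

text \<open>Evaluating the normality tensor on \<open>(X, \<xi>)\<close> isolates \<open>a \<phi> X\<close>, and \<open>\<phi>\<close> cannot vanish on a
  structure that is not Sasakian.\<close>
lemma para_sasakian_P_iff:
  assumes "\<not> sasakian A n \<phi> \<xi> \<eta> g"
  shows "para_sasakian A n P \<xi> \<eta> g1 \<longleftrightarrow> a = 0"
proof
  assume ps: "para_sasakian A n P \<xi> \<eta> g1"
  obtain X where [simp]: "X \<in> V" and X: "\<phi> X \<noteq> 0"
    using assms sasakian_if_phi_0 by blast
  have "nijenhuis P X \<xi> - 2 \<odot>\<^sub>R (ext_deriv \<eta> X \<xi> \<odot> \<xi>) = 0"
    using ps by (simp add: para_sasakian_def)
  then have "(2 * a) \<odot>\<^sub>R (- \<phi> X) = 0"
    by (simp only: nijenhuis_P[OF \<open>X \<in> V\<close> xi_vector_field] phi_xi fmul_simps eta_xi diff_0)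
  then have "a * \<phi> X k p = 0" for k p by (auto simp: fun_eq_iff)
  then show "a = 0" using X by (auto simp: fun_eq_iff)
next
  assume "a = 0"
  then show "para_sasakian A n P \<xi> \<eta> g1"
    by (simp add: para_sasakian_def paracontact_metric_P nijenhuis_P) (simp add: fun_eq_iff)
qed

end

theorem theorem5p9:
  fixes A :: "('a::{t2_space, second_countable_topology}, 'e::euclidean_space) atlas"
    and n :: nat
    and \<phi> :: "'a vfield \<Rightarrow> 'a vfield"
    and \<xi> :: "'a vfield"
    and \<eta> :: "'a vfield \<Rightarrow> 'a \<Rightarrow> real"
    and g :: "'a vfield \<Rightarrow> 'a vfield \<Rightarrow> 'a \<Rightarrow> real"
    and \<kappa> \<mu> :: real
  assumes "kappa_mu_space A n \<phi> \<xi> \<eta> g \<kappa> \<mu>"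
    and "\<not> sasakian A n \<phi> \<xi> \<eta> g"
  shows "let \<phi>\<^sub>1 = std1 \<kappa> \<phi> \<xi>; \<phi>\<^sub>2 = std2 \<kappa> \<phi> \<xi>;
             g\<^sub>1 = assoc_metric \<eta> \<phi>\<^sub>1; g\<^sub>2 = assoc_metric \<eta> \<phi>\<^sub>2;
             h\<^sub>1 = half_lie \<xi> \<phi>\<^sub>1; h\<^sub>2 = half_lie \<xi> \<phi>\<^sub>2;
             \<kappa>\<^sub>1 = (1 - \<mu> / 2)\<^sup>2 - 1; \<mu>\<^sub>1 = 2 * (1 - sqrt (1 - \<kappa>));
             \<kappa>\<^sub>2 = \<kappa> - 2 + (1 - \<mu> / 2)\<^sup>2; \<mu>\<^sub>2 = 2
         in paracontact_metric A n \<phi>\<^sub>1 \<xi> \<eta> g\<^sub>1 \<and>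
            paracontact_metric A n \<phi>\<^sub>2 \<xi> \<eta> g\<^sub>2 \<and>
            kappa_mu_curvature A \<xi> \<eta> g\<^sub>1 h\<^sub>1 \<kappa>\<^sub>1 \<mu>\<^sub>1 \<and>
            kappa_mu_curvature A \<xi> \<eta> g\<^sub>2 h\<^sub>2 \<kappa>\<^sub>2 \<mu>\<^sub>2 \<and>
            (boeckx_invariant \<kappa> \<mu> = 0 \<longleftrightarrow> para_sasakian A n \<phi>\<^sub>1 \<xi> \<eta> g\<^sub>1)"
proof -
  have contact: "contact_metric A n \<phi> \<xi> \<eta> g" and km: "kappa_mu_curvature A \<xi> \<eta> g (half_lie \<xi> \<phi>) \<kappa> \<mu>"
    using assms(1) by (auto simp: kappa_mu_space_def)
  then obtain D where D: "levi_civita A g D" unfolding kappa_mu_curvature_def by blast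
  interpret kappa_mu A n \<phi> \<xi> \<eta> g D \<kappa> \<mu>
    by unfold_locales (use contact D km in \<open>auto simp: contact_metric_def kappa_mu_curvature_def\<close>)
  interpret nonsasakian_kappa_mu A n \<phi> \<xi> \<eta> g D \<kappa> \<mu>
    by unfold_locales (rule kappa_lt_1[OF assms(2)])
  have "boeckx_invariant \<kappa> \<mu> = 0 \<longleftrightarrow> a = 0"
    using lam_pos by (simp add: boeckx_invariant_def lam_def)
  then show ?thesis
    using paracontact_metric_P paracontact_metric_Q kappa_mu_curvature_g1 kappa_mu_curvature_g2 para_sasakian_P_iff[OF assms(2)]
    unfolding Let_def lam_def by blast
qed

end
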